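(* Let $(A,\Delta)$ be an algebraic quantum group with dual $B=\widehat A$, and let $V\in M(B\otimes A)$ be the unique element with $\langle V,a\otimes b\rangle=\langle a,b\rangle$ for all $a\in A$, $b\in B$. Then $V$ is invertible in $M(B\otimes A)$ and its inverse is given by $$V^{-1}=(S\otimes\iota)V=(\iota\otimes S)V.$$
   Context: All algebras are associative algebras over $\mathbb C$, possibly non-unital, with non-degenerate product; $M(A)$ is the multiplier algebra of $A$; $\iota$ denotes identity maps. Regular multiplier Hopf algebra: an algebra $A$ with a homomorphism $\Delta:A\to M(A\otimes A)$ such that $\Delta(a)(1\otimes a')$, $(a\otimes 1)\Delta(a')$, $\Delta(a)(a'\otimes 1)$ and $(1\otimes a)\Delta(a')$ lie in $A\otimes A$ for all $a,a'$; $\Delta$ is coassociative, $(a\otimes1\otimes1)(\Delta\otimes\iota)(\Delta(c)(1\otimes a'))=((\iota\otimes\Delta)((a\otimes1)\Delta(c)))(1\otimes1\otimes a')$; and the maps $a\otimes a'\mapsto\Delta(a)(1\otimes a')$, $a\otimes a'\mapsto(a\otimes1)\Delta(a')$, and the same two maps for the flipped coproduct, are bijections of $A\otimes A$. It has a unique counit $\varepsilon:A\to\mathbb C$ (a homomorphism) and antipode $S:A\to A$ (a bijective anti-homomorphism), characterized by $(\varepsilon\otimes\iota)(\Delta(a)(1\otimes a'))=aa'$ and $m(S\otimes\iota)(\Delta(a)(1\otimes a'))=\varepsilon(a)a'$, with $m$ the multiplication. A left integral is a non-zero linear functional $\varphi$ on $A$ with $(\iota\otimes\varphi)\Delta(a)=\varphi(a)1$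 in $M(A)$ for all $a$. An algebraic quantum group is a regular multiplier Hopf algebra with (left and right) integrals. Fix a left integral $\varphi$. Dual: $B=\widehat A=\{\varphi(\,\cdot\,c):c\in A\}$, with $\langle a,b\rangle=b(a)$. Its product is $\langle a,bb'\rangle=\langle\Delta(a),b\otimes b'\rangle$; its coproduct $\Delta:B\to M(B\otimes B)$ is determined by $\langle a\otimes a',(b'\otimes1)\Delta(b)\rangle=\langle\Delta(a)(1\otimes a'),b'\otimes b\rangle$ and $\langle a\otimes a',\Delta(b)(1\otimes b')\rangle=\langle(a\otimes1)\Delta(a'),b\otimes b'\rangle$. $(B,\Delta)$ is again an algebraic quantum group; $S$ also denotes its antipode, and $\langle S(a),b\rangle=\langle a,S(b)\rangle$. There are unital left actions given by $\langle a',a\triangleright b\rangle=\langle a'a,b\rangle$ and $\langle b\triangleright a,b'\rangle=\langle a,b'b\rangle$. The pairing of $B\otimes A$ with $A\otimes B$ is $\langle b\otimes a,a'\otimes b'\rangle=\langle a',b\rangle\langle a,b'\rangle$; it extends uniquely to $M(B\otimes A)\times(A\otimes B)$ by $\langle m,(b\triangleright a')\otimes(a\triangleright b')\rangle=\langle m(b\otimes a),a'\otimes b'\rangle$. This is the pairing in the definition of $V$; existence and uniqueness of $V$ are known. $(\iota\otimes S)V$ and $(S\otimes\iota)V$ are the elements of $M(B\otimes A)$ (known to exist) determined by $\langle(\iota\otimes S)V,a\otimes b\rangle=\langle V,a\otimes S(b)\rangle$ and $\langle(S\otimes\iota)V,a\otimes b\rangle=\langle V,S(a)\otimes b\rangle$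 for all $a\in A$, $b\in B$. *)

theory Defs
  imports
    Complex_Main
    "HOL-Library.Function_Algebras"
    "HOL-Library.Product_Plus"
    "HOL-Library.Poly_Mapping"
    "HOL-Algebra.Group"
begin

section \<open>Complex vector spaces\<close>

class complex_vector = ab_group_add +
  fixes scaleC :: "complex \<Rightarrow> 'a \<Rightarrow> 'a" (infixr "*\<^sub>C" 75)
  assumes scaleC_add_right: "c *\<^sub>C (x + y) = c *\<^sub>C x + c *\<^sub>C y"
    and scaleC_add_left: "(c + d) *\<^sub>C x = c *\<^sub>C x + d *\<^sub>C x"
    and scaleC_scaleC: "c *\<^sub>C d *\<^sub>C x = (c * d) *\<^sub>C x"
    and scaleC_one: "1 *\<^sub>C x = x"

interpretation cvec: vector_space "scaleC :: complex \<Rightarrow> 'a \<Rightarrow> 'a::complex_vector"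
  by unfold_locales (simp_all add: scaleC_add_right scaleC_add_left scaleC_scaleC scaleC_one)

interpretation cvec_pair: vector_space_pair
  "scaleC :: complex \<Rightarrow> 'a \<Rightarrow> 'a::complex_vector" "scaleC :: complex \<Rightarrow> 'b \<Rightarrow> 'b::complex_vector"
  by unfold_locales

instantiation complex :: complex_vector
begin
definition scaleC_complex :: "complex \<Rightarrow> complex \<Rightarrow> complex" where
  [simp]: "scaleC_complex c x = c * x"
instance by standard (simp_all add: algebra_simps)
end

instantiation "fun" :: (type, complex_vector) complex_vector
begin
definition scaleC_fun :: "complex \<Rightarrow> ('a \<Rightarrow> 'b) \<Rightarrow> 'a \<Rightarrow> 'b" where
  "scaleC_fun c f = (\<lambda>x. c *\<^sub>C f x)"
instance
  by standard (simp_all add: scaleC_fun_def fun_eq_iff scaleC_add_right scaleC_add_left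
      scaleC_scaleC scaleC_one)
end

instantiation prod :: (complex_vector, complex_vector) complex_vector
begin
definition scaleC_prod :: "complex \<Rightarrow> 'a \<times> 'b \<Rightarrow> 'a \<times> 'b" where
  "scaleC_prod c p = (c *\<^sub>C fst p, c *\<^sub>C snd p)"
instance
  by standard (simp_all add: scaleC_prod_def prod_eq_iff scaleC_add_right scaleC_add_left
      scaleC_scaleC scaleC_one)
end

instantiation poly_mapping :: (type, complex_vector) complex_vector
begin
lift_definition scaleC_poly_mapping :: "complex \<Rightarrow> ('a \<Rightarrow>\<^sub>0 'b) \<Rightarrow> 'a \<Rightarrow>\<^sub>0 'b"
  is "\<lambda>c f x. c *\<^sub>C f x"
  by (rule finite_subset[rotated]) auto
instance
  by standard (transfer; simp add: fun_eq_iff scaleC_add_right scaleC_add_left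
      scaleC_scaleC scaleC_one)+
end

definition linear_on :: "'a::complex_vector set \<Rightarrow> ('a \<Rightarrow> 'b::complex_vector) \<Rightarrow> bool" where
  "linear_on U f \<longleftrightarrow>
     (\<forall>x\<in>U. \<forall>y\<in>U. f (x + y) = f x + f y) \<and> (\<forall>c. \<forall>x\<in>U. f (c *\<^sub>C x) = c *\<^sub>C f x)"

definition bilinear_on ::
    "'a::complex_vector set \<Rightarrow> 'b::complex_vector set \<Rightarrow> ('a \<Rightarrow> 'b \<Rightarrow> 'c::complex_vector) \<Rightarrow> bool" where
  "bilinear_on U W f \<longleftrightarrow> (\<forall>x\<in>U. linear_on W (f x)) \<and> (\<forall>y\<in>W. linear_on U (\<lambda>x. f x y))"


section \<open>The algebraic tensor product\<close>

abbreviation free_gen :: "'a \<Rightarrow> 'b \<Rightarrow> ('a \<times> 'b) \<Rightarrow>\<^sub>0 complex" where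
  "free_gen x y \<equiv> Poly_Mapping.single (x, y) 1"

definition tensor_relations :: "(('a::complex_vector \<times> 'b::complex_vector) \<Rightarrow>\<^sub>0 complex) set" where
  "tensor_relations =
     {free_gen (x + x') y - free_gen x y - free_gen x' y | x x' y. True} \<union>
     {free_gen x (y + y') - free_gen x y - free_gen x y' | x y y'. True} \<union>
     {free_gen (c *\<^sub>C x) y - c *\<^sub>C free_gen x y | c x y. True} \<union>
     {free_gen x (c *\<^sub>C y) - c *\<^sub>C free_gen x y | c x y. True}"

definition tensor_rel ::
    "(('a::complex_vector \<times> 'b::complex_vector) \<Rightarrow>\<^sub>0 complex) \<Rightarrow> (('a \<times> 'b) \<Rightarrow>\<^sub>0 complex) \<Rightarrow> bool" where
  "tensor_rel p q \<longleftrightarrow> p - q \<in> cvec.span tensor_relations"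

lemma tensor_rel_equivp:
  "equivp (tensor_rel :: (('a::complex_vector \<times> 'b::complex_vector) \<Rightarrow>\<^sub>0 complex) \<Rightarrow> _)"
proof (rule equivpI)
  show "reflp (tensor_rel :: (('a \<times> 'b) \<Rightarrow>\<^sub>0 complex) \<Rightarrow> _)" by (rule reflpI) (simp add: tensor_rel_def cvec.span_zero)
  show "symp (tensor_rel :: (('a \<times> 'b) \<Rightarrow>\<^sub>0 complex) \<Rightarrow> _)"
  proof (rule sympI)
    fix p q :: "('a \<times> 'b) \<Rightarrow>\<^sub>0 complex" assume "tensor_rel p q"
    then have "- (p - q) \<in> cvec.span tensor_relations"
      unfolding tensor_rel_def by (rule cvec.span_neg)
    then show "tensor_rel q p" by (simp add: tensor_rel_def)
  qed
  show "transp (tensor_rel :: (('a \<times> 'b) \<Rightarrow>\<^sub>0 complex) \<Rightarrow> _)"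
  proof (rule transpI)
    fix p q r :: "('a \<times> 'b) \<Rightarrow>\<^sub>0 complex" assume "tensor_rel p q" "tensor_rel q r"
    then have "(p - q) + (q - r) \<in> cvec.span tensor_relations"
      unfolding tensor_rel_def by (rule cvec.span_add)
    then show "tensor_rel p r" by (simp add: tensor_rel_def)
  qed
qed

quotient_type (overloaded) ('a, 'b) tensor =
  "('a::complex_vector \<times> 'b::complex_vector) \<Rightarrow>\<^sub>0 complex" / tensor_rel
  by (rule tensor_rel_equivp)

instantiation tensor :: (complex_vector, complex_vector) complex_vector
begin

lift_definition zero_tensor :: "('a, 'b) tensor" is 0 .

lift_definition plus_tensor :: "('a, 'b) tensor \<Rightarrow> ('a, 'b) tensor \<Rightarrow> ('a, 'b) tensor" is "(+)"
proof -
  fix p p' q q' :: "('a \<times> 'b) \<Rightarrow>\<^sub>0 complex"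
  assume "tensor_rel p p'" "tensor_rel q q'"
  then have "(p - p') + (q - q') \<in> cvec.span tensor_relations"
    unfolding tensor_rel_def by (rule cvec.span_add)
  then show "tensor_rel (p + q) (p' + q')" by (simp add: tensor_rel_def algebra_simps)
qed

lift_definition minus_tensor :: "('a, 'b) tensor \<Rightarrow> ('a, 'b) tensor \<Rightarrow> ('a, 'b) tensor" is "(-)"
proof -
  fix p p' q q' :: "('a \<times> 'b) \<Rightarrow>\<^sub>0 complex"
  assume "tensor_rel p p'" "tensor_rel q q'"
  then have "(p - p') - (q - q') \<in> cvec.span tensor_relations"
    unfolding tensor_rel_def by (rule cvec.span_diff)
  then show "tensor_rel (p - q) (p' - q')" by (simp add: tensor_rel_def algebra_simps)
qed

lift_definition uminus_tensor :: "('a, 'b) tensor \<Rightarrow> ('a, 'b) tensor" is uminus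
proof -
  fix p p' :: "('a \<times> 'b) \<Rightarrow>\<^sub>0 complex"
  assume "tensor_rel p p'"
  then have "- (p - p') \<in> cvec.span tensor_relations"
    unfolding tensor_rel_def by (rule cvec.span_neg)
  then show "tensor_rel (- p) (- p')" by (simp add: tensor_rel_def algebra_simps)
qed

lift_definition scaleC_tensor :: "complex \<Rightarrow> ('a, 'b) tensor \<Rightarrow> ('a, 'b) tensor" is scaleC
proof -
  fix c and p p' :: "('a \<times> 'b) \<Rightarrow>\<^sub>0 complex"
  assume "tensor_rel p p'"
  then have "c *\<^sub>C (p - p') \<in> cvec.span tensor_relations"
    unfolding tensor_rel_def by (rule cvec.span_scale)
  then show "tensor_rel (c *\<^sub>C p) (c *\<^sub>C p')" by (simp add: tensor_rel_def cvec.scale_right_diff_distrib)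
qed

instance
proof
  fix x y z :: "('a, 'b) tensor" and c d :: complex
  have r: "tensor_rel p p" for p :: "('a \<times> 'b) \<Rightarrow>\<^sub>0 complex"
    by (simp add: tensor_rel_def cvec.span_zero)
  show "x + y + z = x + (y + z)" by transfer (simp add: r add.assoc)
  show "x + y = y + x" by transfer (simp add: r add.commute)
  show "0 + x = x" by transfer (simp add: r)
  show "- x + x = 0" by transfer (simp add: r)
  show "x - y = x + - y" by transfer (simp add: r)
  show "c *\<^sub>C (x + y) = c *\<^sub>C x + c *\<^sub>C y" by transfer (simp add: r scaleC_add_right)
  show "(c + d) *\<^sub>C x = c *\<^sub>C x + d *\<^sub>C x" by transfer (simp add: r scaleC_add_left)
  show "c *\<^sub>C d *\<^sub>C x = (c * d) *\<^sub>C x" by transfer (simp add: r scaleC_scaleC)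
  show "1 *\<^sub>C x = x" by transfer (simp add: r scaleC_one)
qed

end

lift_definition tensor_of :: "'a::complex_vector \<Rightarrow> 'b::complex_vector \<Rightarrow> ('a, 'b) tensor"
    (infixr "\<otimes>\<^sub>t" 72) is free_gen .

lemma tensor_relation_eq:
  assumes "p - q \<in> tensor_relations"
  shows "abs_tensor p = abs_tensor q"
  using assms by (simp add: tensor.abs_eq_iff tensor_rel_def cvec.span_base)

lemma bilinear_tensor_of: "bilinear_on UNIV UNIV (\<otimes>\<^sub>t)"
proof -
  have 1: "(x + x') \<otimes>\<^sub>t y = x \<otimes>\<^sub>t y + x' \<otimes>\<^sub>t y" for x x' :: 'a and y :: 'b
  proof -
    have "free_gen (x + x') y - (free_gen x y + free_gen x' y) \<in> tensor_relations"
      unfolding tensor_relations_def diff_diff_add[symmetric] by blast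
    from tensor_relation_eq[OF this] show ?thesis
      by (simp add: tensor_of.abs_eq plus_tensor.abs_eq)
  qed
  have 2: "x \<otimes>\<^sub>t (y + y') = x \<otimes>\<^sub>t y + x \<otimes>\<^sub>t y'" for x :: 'a and y y' :: 'b
  proof -
    have "free_gen x (y + y') - (free_gen x y + free_gen x y') \<in> tensor_relations"
      unfolding tensor_relations_def diff_diff_add[symmetric] by blast
    from tensor_relation_eq[OF this] show ?thesis
      by (simp add: tensor_of.abs_eq plus_tensor.abs_eq)
  qed
  have 3: "(c *\<^sub>C x) \<otimes>\<^sub>t y = c *\<^sub>C (x \<otimes>\<^sub>t y)" for c and x :: 'a and y :: 'b
  proof -
    have "free_gen (c *\<^sub>C x) y - c *\<^sub>C free_gen x y \<in> tensor_relations"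
      unfolding tensor_relations_def by blast
    from tensor_relation_eq[OF this] show ?thesis
      by (simp add: tensor_of.abs_eq scaleC_tensor.abs_eq)
  qed
  have 4: "x \<otimes>\<^sub>t (c *\<^sub>C y) = c *\<^sub>C (x \<otimes>\<^sub>t y)" for c and x :: 'a and y :: 'b
  proof -
    have "free_gen x (c *\<^sub>C y) - c *\<^sub>C free_gen x y \<in> tensor_relations"
      unfolding tensor_relations_def by blast
    from tensor_relation_eq[OF this] show ?thesis
      by (simp add: tensor_of.abs_eq scaleC_tensor.abs_eq)
  qed
  show ?thesis by (simp add: bilinear_on_def linear_on_def 1 2 3 4)
qed

text \<open>The tensor product of two subspaces is taken inside the tensor product of the ambient
  spaces, which loses nothing over a field.\<close>

definition tensor_set ::
    "'a::complex_vector set \<Rightarrow> 'b::complex_vector set \<Rightarrow> ('a, 'b) tensor set" where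
  "tensor_set U W = cvec.span {x \<otimes>\<^sub>t y | x y. x \<in> U \<and> y \<in> W}"

text \<open>The linear extension of a map that is bilinear on the product of two subspaces; it does not
  depend on the chosen representation, see \<open>tensor_lift_tensor_of\<close> and \<open>linear_on_tensor_lift\<close>.\<close>

definition tensor_lift :: "'a::complex_vector set \<Rightarrow> 'b::complex_vector set \<Rightarrow>
    ('a \<Rightarrow> 'b \<Rightarrow> 'c::complex_vector) \<Rightarrow> ('a, 'b) tensor \<Rightarrow> 'c" where
  "tensor_lift U W f t =
     (let ps = SOME ps. set ps \<subseteq> U \<times> W \<and> t = (\<Sum>(x, y)\<leftarrow>ps. x \<otimes>\<^sub>t y)
      in \<Sum>(x, y)\<leftarrow>ps. f x y)"

lemma linear_on_UNIV: "linear_on UNIV f \<longleftrightarrow> Vector_Spaces.linear scaleC scaleC f"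
  by (auto simp: linear_on_def Vector_Spaces.linear_iff cvec.vector_space_axioms)

lemma linear_on_subset: "linear_on U f \<Longrightarrow> U' \<subseteq> U \<Longrightarrow> linear_on U' f"
  unfolding linear_on_def by blast

lemma tensor_universal:
  fixes g :: "'a::complex_vector \<Rightarrow> 'b::complex_vector \<Rightarrow> 'c::complex_vector"
  assumes g: "bilinear_on UNIV UNIV g"
  shows "\<exists>h. Vector_Spaces.linear scaleC scaleC h \<and> (\<forall>x y. h (x \<otimes>\<^sub>t y) = g x y)"
proof -
  define L :: "(('a \<times> 'b) \<Rightarrow>\<^sub>0 complex) \<Rightarrow> 'c" where
    "L p = (\<Sum>k\<in>Poly_Mapping.keys p. Poly_Mapping.lookup p k *\<^sub>C g (fst k) (snd k))" for p
  have L_add: "L (p + q) = L p + L q" for p q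
    unfolding L_def
    by (rule setsum_keys_plus_distrib[where f = "\<lambda>k z. z *\<^sub>C g (fst k) (snd k)"])
      (simp_all add: scaleC_add_left)
  have L_scale: "L (c *\<^sub>C p) = c *\<^sub>C L p" for c p
  proof -
    have "L (c *\<^sub>C p) = (\<Sum>k\<in>Poly_Mapping.keys p. Poly_Mapping.lookup (c *\<^sub>C p) k *\<^sub>C g (fst k) (snd k))"
      unfolding L_def
      by (rule sum.mono_neutral_left) (auto simp: scaleC_poly_mapping.rep_eq in_keys_iff)
    then show ?thesis
      by (simp add: L_def scaleC_poly_mapping.rep_eq cvec.scale_sum_right)
  qed
  interpret L: Vector_Spaces.linear scaleC scaleC L
    by (simp add: L_add L_scale linear_on_def flip: linear_on_UNIV)
  have L_gen: "L (free_gen x y) = g x y" for x y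
    by (simp add: L_def)
  have "L r = 0" if "r \<in> tensor_relations" for r
    using that g
    by (auto simp: tensor_relations_def L.diff L.scale L_gen bilinear_on_def linear_on_def)
  then have "L r = 0" if "r \<in> cvec.span tensor_relations" for r
    using that cvec_pair.linear_eq_0_on_span[OF L.linear_axioms] by blast
  then have L_eq: "L p = L q" if "tensor_rel p q" for p q
    using that unfolding tensor_rel_def by (metis L.diff eq_iff_diff_eq_0)
  define h where "h t = L (rep_tensor t)" for t
  have h_abs: "h (abs_tensor p) = L p" for p
    unfolding h_def
    by (rule L_eq, subst tensor.abs_eq_iff[symmetric]) (rule Quotient3_abs_rep[OF Quotient3_tensor])
  have "h (s + t) = h s + h t" for s t
    by (induction s rule: tensor.abs_induct, induction t rule: tensor.abs_induct)
      (simp add: plus_tensor.abs_eq h_abs L_add)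
  moreover have "h (c *\<^sub>C t) = c *\<^sub>C h t" for c t
    by (induction t rule: tensor.abs_induct) (simp add: scaleC_tensor.abs_eq h_abs L_scale)
  ultimately have "Vector_Spaces.linear scaleC scaleC h"
    by (simp add: linear_on_def flip: linear_on_UNIV)
  moreover have "h (x \<otimes>\<^sub>t y) = g x y" for x y
    by (simp add: tensor_of.abs_eq h_abs L_gen)
  ultimately show ?thesis by blast
qed

lemma tensor_set_rep:
  assumes U: "cvec.subspace U" and t: "t \<in> tensor_set U W"
  shows "\<exists>ps. set ps \<subseteq> U \<times> W \<and> t = (\<Sum>(x, y)\<leftarrow>ps. x \<otimes>\<^sub>t y)"
  using t unfolding tensor_set_def
proof (induction rule: cvec.span_induct_alt)
  case base
  then show ?case by (intro exI[of _ "[]"]) simp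
next
  case (step c s t)
  from step.hyps obtain x y where s: "s = x \<otimes>\<^sub>t y" "x \<in> U" "y \<in> W" by blast
  from step obtain ps where ps: "set ps \<subseteq> U \<times> W" "t = (\<Sum>(x, y)\<leftarrow>ps. x \<otimes>\<^sub>t y)" by blast
  have "c *\<^sub>C s = (c *\<^sub>C x) \<otimes>\<^sub>t y"
    using bilinear_tensor_of[where 'a = 'a and 'b = 'b] by (simp add: s bilinear_on_def linear_on_def)
  moreover have "c *\<^sub>C x \<in> U" using U s by (simp add: cvec.subspace_scale)
  ultimately show ?case
    using ps s by (intro exI[of _ "(c *\<^sub>C x, y) # ps"]) simp
qed

lemma tensor_lift_ex:
  assumes U: "cvec.subspace U" and W: "cvec.subspace W" and f: "bilinear_on U W f"
  shows "\<exists>h. Vector_Spaces.linear scaleC scaleC h \<and> (\<forall>x\<in>U. \<forall>y\<in>W. h (x \<otimes>\<^sub>t y) = f x y) \<and>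
    (\<forall>t\<in>tensor_set U W. tensor_lift U W f t = h t)"
proof -
  obtain p where p: "p \<in> UNIV \<rightarrow> U" "Vector_Spaces.linear scaleC scaleC p" "\<forall>v\<in>U. p (id v) = v"
    using cvec_pair.linear_exists_left_inverse_on[OF cvec.linear_id U inj_on_id] by blast
  obtain q where q: "q \<in> UNIV \<rightarrow> W" "Vector_Spaces.linear scaleC scaleC q" "\<forall>v\<in>W. q (id v) = v"
    using cvec_pair.linear_exists_left_inverse_on[OF cvec.linear_id W inj_on_id] by blast
  have pU: "p x \<in> U" and qW: "q y \<in> W" for x y using p q by auto
  have "bilinear_on UNIV UNIV (\<lambda>x y. f (p x) (q y))"
    using f p(2) q(2) pU qW unfolding linear_on_UNIV[symmetric]
    by (simp add: bilinear_on_def linear_on_def)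
  then obtain h where h: "Vector_Spaces.linear scaleC scaleC h"
      "\<forall>x y. h (x \<otimes>\<^sub>t y) = f (p x) (q y)"
    using tensor_universal by blast
  have hf: "h (x \<otimes>\<^sub>t y) = f x y" if "x \<in> U" "y \<in> W" for x y
    using that h(2) p(3) q(3) by simp
  have hsum: "h (\<Sum>(x, y)\<leftarrow>ps. x \<otimes>\<^sub>t y) = (\<Sum>(x, y)\<leftarrow>ps. f x y)" if "set ps \<subseteq> U \<times> W" for ps
    using that
  proof (induction ps)
    case Nil
    then show ?case using h(1) by (simp add: cvec_pair.linear_0)
  next
    case (Cons z ps)
    then show ?case using h(1) by (auto simp: cvec_pair.linear_add hf)
  qed
  have "tensor_lift U W f t = h t" if "t \<in> tensor_set U W" for t
  proof -
    define ps where "ps = (SOME ps. set ps \<subseteq> U \<times> W \<and> t = (\<Sum>(x, y)\<leftarrow>ps. x \<otimes>\<^sub>t y))"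
    have "set ps \<subseteq> U \<times> W \<and> t = (\<Sum>(x, y)\<leftarrow>ps. x \<otimes>\<^sub>t y)"
      unfolding ps_def by (rule someI_ex) (rule tensor_set_rep[OF U that])
    then have "h t = (\<Sum>(x, y)\<leftarrow>ps. f x y)" using hsum[of ps] by metis
    then show ?thesis by (simp only: tensor_lift_def Let_def flip: ps_def)
  qed
  with h(1) hf show ?thesis by blast
qed

lemma tensor_lift_tensor_of:
  assumes "cvec.subspace U" "cvec.subspace W" "bilinear_on U W f" "x \<in> U" "y \<in> W"
  shows "tensor_lift U W f (x \<otimes>\<^sub>t y) = f x y"
proof -
  have "x \<otimes>\<^sub>t y \<in> tensor_set U W"
    unfolding tensor_set_def using assms by (blast intro: cvec.span_base)
  moreover obtain h where "\<forall>x\<in>U. \<forall>y\<in>W. h (x \<otimes>\<^sub>t y) = f x y"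
      "\<forall>t\<in>tensor_set U W. tensor_lift U W f t = h t"
    using tensor_lift_ex[OF assms(1-3)] by blast
  ultimately show ?thesis using assms(4,5) by simp
qed

lemma linear_on_tensor_lift:
  assumes "cvec.subspace U" "cvec.subspace W" "bilinear_on U W f"
  shows "linear_on (tensor_set U W) (tensor_lift U W f)"
proof -
  have "cvec.subspace (tensor_set U W)" by (simp add: tensor_set_def)
  then have "s + t \<in> tensor_set U W" "c *\<^sub>C s \<in> tensor_set U W"
    if "s \<in> tensor_set U W" "t \<in> tensor_set U W" for s t c
    using that by (simp_all add: cvec.subspace_add cvec.subspace_scale)
  moreover obtain h where "Vector_Spaces.linear scaleC scaleC h"
      "\<forall>t\<in>tensor_set U W. tensor_lift U W f t = h t"
    using tensor_lift_ex[OF assms] by blast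
  ultimately show ?thesis
    by (simp add: linear_on_def cvec_pair.linear_add cvec_pair.linear_scale)
qed


section \<open>Algebras and multiplier algebras\<close>

text \<open>Algebras are possibly non-unital, with a subspace of an ambient complex vector space as
  carrier.\<close>

record 'a algebra = "'a partial_object" +
  alg_mult :: "'a \<Rightarrow> 'a \<Rightarrow> 'a" (infixl "\<cdot>\<index>" 70)

locale complex_algebra =
  fixes A :: "'a::complex_vector algebra" (structure)
  assumes subspace_carrier: "cvec.subspace (carrier A)"
    and alg_mult_closed: "x \<in> carrier A \<Longrightarrow> y \<in> carrier A \<Longrightarrow> x \<cdot> y \<in> carrier A"
    and alg_mult_assoc: "x \<in> carrier A \<Longrightarrow> y \<in> carrier A \<Longrightarrow> z \<in> carrier A \<Longrightarrow>
      (x \<cdot> y) \<cdot> z = x \<cdot> (y \<cdot> z)"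
    and alg_mult_bilinear: "bilinear_on (carrier A) (carrier A) (\<lambda>x y. x \<cdot> y)"

locale nondegenerate_algebra = complex_algebra +
  assumes nondegenerate_left: "x \<in> carrier A \<Longrightarrow> (\<forall>y\<in>carrier A. x \<cdot> y = 0) \<Longrightarrow> x = 0"
    and nondegenerate_right: "x \<in> carrier A \<Longrightarrow> (\<forall>y\<in>carrier A. y \<cdot> x = 0) \<Longrightarrow> x = 0"

definition tensor_algebra ::
    "'a::complex_vector algebra \<Rightarrow> 'b::complex_vector algebra \<Rightarrow> ('a, 'b) tensor algebra"
    (infixr "\<otimes>\<^sub>A" 72) where
  "A \<otimes>\<^sub>A B =
     \<lparr>carrier = tensor_set (carrier A) (carrier B),
      alg_mult = \<lambda>s t. tensor_lift (carrier A) (carrier B) (\<lambda>x y.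
        tensor_lift (carrier A) (carrier B) (\<lambda>x' y'. (x \<cdot>\<^bsub>A\<^esub> x') \<otimes>\<^sub>t (y \<cdot>\<^bsub>B\<^esub> y')) t) s\<rparr>"

text \<open>A multiplier \<open>m\<close> is the pair of the maps \<open>x \<mapsto> m x\<close> and \<open>x \<mapsto> x m\<close>. Both maps are set to
  \<open>0\<close> outside the carrier, so that equality of multipliers is equality of pairs.\<close>

type_synonym 'a multiplier = "('a \<Rightarrow> 'a) \<times> ('a \<Rightarrow> 'a)"

definition is_multiplier :: "'a::complex_vector algebra \<Rightarrow> 'a multiplier \<Rightarrow> bool" where
  "is_multiplier A m \<longleftrightarrow>
     (let L = fst m; R = snd m in
      linear_on (carrier A) L \<and> linear_on (carrier A) R \<and>
      L \<in> carrier A \<rightarrow> carrier A \<and> R \<in> carrier A \<rightarrow> carrier A \<and>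
      (\<forall>x. x \<notin> carrier A \<longrightarrow> L x = 0 \<and> R x = 0) \<and>
      (\<forall>x\<in>carrier A. \<forall>y\<in>carrier A.
         L (x \<cdot>\<^bsub>A\<^esub> y) = L x \<cdot>\<^bsub>A\<^esub> y \<and> R (x \<cdot>\<^bsub>A\<^esub> y) = x \<cdot>\<^bsub>A\<^esub> R y \<and>
         R x \<cdot>\<^bsub>A\<^esub> y = x \<cdot>\<^bsub>A\<^esub> L y))"

definition multipliers :: "'a::complex_vector algebra \<Rightarrow> 'a multiplier monoid" where
  "multipliers A =
     \<lparr>carrier = {m. is_multiplier A m},
      mult = \<lambda>m n. (fst m \<circ> fst n, snd n \<circ> snd m),
      one = (\<lambda>x. if x \<in> carrier A then x else 0, \<lambda>x. if x \<in> carrier A then x else 0)\<rparr>"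

definition embed :: "'a::complex_vector algebra \<Rightarrow> 'a \<Rightarrow> 'a multiplier" where
  "embed A a =
     (\<lambda>x. if x \<in> carrier A then a \<cdot>\<^bsub>A\<^esub> x else 0, \<lambda>x. if x \<in> carrier A then x \<cdot>\<^bsub>A\<^esub> a else 0)"

definition in_algebra :: "'a::complex_vector algebra \<Rightarrow> 'a multiplier \<Rightarrow> bool" where
  "in_algebra A m \<longleftrightarrow> m \<in> embed A ` carrier A"

text \<open>The element of \<open>A\<close> that a multiplier lying in \<open>A\<close> comes from.\<close>

definition element :: "'a::complex_vector algebra \<Rightarrow> 'a multiplier \<Rightarrow> 'a" where
  "element A m = inv_into (carrier A) (embed A) m"

definition tensor_multiplier ::
    "'a::complex_vector algebra \<Rightarrow> 'b::complex_vector algebra \<Rightarrow> 'a multiplier \<Rightarrow> 'b multiplier \<Rightarrow>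
     ('a, 'b) tensor multiplier" where
  "tensor_multiplier A B m n =
     (\<lambda>t. if t \<in> carrier (A \<otimes>\<^sub>A B)
          then tensor_lift (carrier A) (carrier B) (\<lambda>x y. fst m x \<otimes>\<^sub>t fst n y) t else 0,
      \<lambda>t. if t \<in> carrier (A \<otimes>\<^sub>A B)
          then tensor_lift (carrier A) (carrier B) (\<lambda>x y. snd m x \<otimes>\<^sub>t snd n y) t else 0)"

definition tensor_one ::
    "'a::complex_vector algebra \<Rightarrow> 'b::complex_vector algebra \<Rightarrow> 'a \<Rightarrow> ('a, 'b) tensor multiplier" where
  "tensor_one A B a = tensor_multiplier A B (embed A a) \<one>\<^bsub>multipliers B\<^esub>"

definition one_tensor ::
    "'a::complex_vector algebra \<Rightarrow> 'b::complex_vector algebra \<Rightarrow> 'b \<Rightarrow> ('a, 'b) tensor multiplier" where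
  "one_tensor A B b = tensor_multiplier A B \<one>\<^bsub>multipliers A\<^esub> (embed B b)"

text \<open>The isomorphism \<open>M(A) \<rightarrow> M(B)\<close> induced by an isomorphism \<open>f\<close> from \<open>A\<close> to \<open>B\<close>.\<close>

definition transport ::
    "'a::complex_vector algebra \<Rightarrow> 'b::complex_vector algebra \<Rightarrow> ('a \<Rightarrow> 'b) \<Rightarrow> 'a multiplier \<Rightarrow>
     'b multiplier" where
  "transport A B f m =
     (\<lambda>y. if y \<in> carrier B then f (fst m (inv_into (carrier A) f y)) else 0,
      \<lambda>y. if y \<in> carrier B then f (snd m (inv_into (carrier A) f y)) else 0)"

definition tensor_flip :: "('a::complex_vector, 'b::complex_vector) tensor \<Rightarrow> ('b, 'a) tensor" where
  "tensor_flip = tensor_lift UNIV UNIV (\<lambda>x y. y \<otimes>\<^sub>t x)"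

definition tensor_assoc ::
    "(('a::complex_vector, 'b::complex_vector) tensor, 'c::complex_vector) tensor \<Rightarrow>
     ('a, ('b, 'c) tensor) tensor" where
  "tensor_assoc =
     tensor_lift UNIV UNIV (\<lambda>s z. tensor_lift UNIV UNIV (\<lambda>x y. x \<otimes>\<^sub>t (y \<otimes>\<^sub>t z)) s)"


section \<open>Regular multiplier Hopf algebras\<close>

type_synonym 'a coproduct = "'a \<Rightarrow> ('a, 'a) tensor multiplier"

definition flip_coproduct :: "'a::complex_vector algebra \<Rightarrow> 'a coproduct \<Rightarrow> 'a coproduct" where
  "flip_coproduct A \<Delta> a = transport (A \<otimes>\<^sub>A A) (A \<otimes>\<^sub>A A) tensor_flip (\<Delta> a)"

definition coproduct_one_tensor where
  "coproduct_one_tensor A \<Delta> a a' = \<Delta> a \<otimes>\<^bsub>multipliers (A \<otimes>\<^sub>A A)\<^esub> one_tensor A A a'"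

definition tensor_one_coproduct where
  "tensor_one_coproduct A \<Delta> a a' = tensor_one A A a \<otimes>\<^bsub>multipliers (A \<otimes>\<^sub>A A)\<^esub> \<Delta> a'"

definition coproduct_tensor_one where
  "coproduct_tensor_one A \<Delta> a a' = \<Delta> a \<otimes>\<^bsub>multipliers (A \<otimes>\<^sub>A A)\<^esub> tensor_one A A a'"

definition one_tensor_coproduct where
  "one_tensor_coproduct A \<Delta> a a' = one_tensor A A a \<otimes>\<^bsub>multipliers (A \<otimes>\<^sub>A A)\<^esub> \<Delta> a'"

definition coproduct_id ::
    "'a::complex_vector algebra \<Rightarrow> 'a coproduct \<Rightarrow> ('a, 'a) tensor \<Rightarrow> (('a, 'a) tensor, 'a) tensor multiplier" where
  "coproduct_id A \<Delta> = tensor_lift (carrier A) (carrier A)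
     (\<lambda>x y. tensor_multiplier (A \<otimes>\<^sub>A A) A (\<Delta> x) (embed A y))"

definition id_coproduct ::
    "'a::complex_vector algebra \<Rightarrow> 'a coproduct \<Rightarrow> ('a, 'a) tensor \<Rightarrow> ('a, ('a, 'a) tensor) tensor multiplier" where
  "id_coproduct A \<Delta> = tensor_lift (carrier A) (carrier A)
     (\<lambda>x y. tensor_multiplier A (A \<otimes>\<^sub>A A) (embed A x) (\<Delta> y))"

definition galois_bijective :: "'a::complex_vector algebra \<Rightarrow> 'a coproduct \<Rightarrow> bool" where
  "galois_bijective A \<Delta> \<longleftrightarrow>
     bij_betw
       (tensor_lift (carrier A) (carrier A)
         (\<lambda>a a'. element (A \<otimes>\<^sub>A A) (coproduct_one_tensor A \<Delta> a a')))
       (carrier (A \<otimes>\<^sub>A A)) (carrier (A \<otimes>\<^sub>A A)) \<and>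
     bij_betw
       (tensor_lift (carrier A) (carrier A)
         (\<lambda>a a'. element (A \<otimes>\<^sub>A A) (tensor_one_coproduct A \<Delta> a a')))
       (carrier (A \<otimes>\<^sub>A A)) (carrier (A \<otimes>\<^sub>A A))"

locale regular_multiplier_hopf_algebra = nondegenerate_algebra A
  for A :: "'a::complex_vector algebra" (structure) +
  fixes \<Delta> :: "'a coproduct"
  assumes coproduct_closed: "a \<in> carrier A \<Longrightarrow> \<Delta> a \<in> carrier (multipliers (A \<otimes>\<^sub>A A))"
    and coproduct_linear: "linear_on (carrier A) \<Delta>"
    and coproduct_alg_mult: "a \<in> carrier A \<Longrightarrow> a' \<in> carrier A \<Longrightarrow>
      \<Delta> (a \<cdot> a') = \<Delta> a \<otimes>\<^bsub>multipliers (A \<otimes>\<^sub>A A)\<^esub> \<Delta> a'"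
    and coproduct_one_tensor_in: "a \<in> carrier A \<Longrightarrow> a' \<in> carrier A \<Longrightarrow>
      in_algebra (A \<otimes>\<^sub>A A) (coproduct_one_tensor A \<Delta> a a')"
    and tensor_one_coproduct_in: "a \<in> carrier A \<Longrightarrow> a' \<in> carrier A \<Longrightarrow>
      in_algebra (A \<otimes>\<^sub>A A) (tensor_one_coproduct A \<Delta> a a')"
    and coproduct_tensor_one_in: "a \<in> carrier A \<Longrightarrow> a' \<in> carrier A \<Longrightarrow>
      in_algebra (A \<otimes>\<^sub>A A) (coproduct_tensor_one A \<Delta> a a')"
    and one_tensor_coproduct_in: "a \<in> carrier A \<Longrightarrow> a' \<in> carrier A \<Longrightarrow>
      in_algebra (A \<otimes>\<^sub>A A) (one_tensor_coproduct A \<Delta> a a')"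
    and coassociative: "a \<in> carrier A \<Longrightarrow> a' \<in> carrier A \<Longrightarrow> c \<in> carrier A \<Longrightarrow>
      transport ((A \<otimes>\<^sub>A A) \<otimes>\<^sub>A A) (A \<otimes>\<^sub>A A \<otimes>\<^sub>A A) tensor_assoc
        (tensor_multiplier (A \<otimes>\<^sub>A A) A (tensor_one A A a) \<one>\<^bsub>multipliers A\<^esub>
          \<otimes>\<^bsub>multipliers ((A \<otimes>\<^sub>A A) \<otimes>\<^sub>A A)\<^esub>
         coproduct_id A \<Delta> (element (A \<otimes>\<^sub>A A) (coproduct_one_tensor A \<Delta> c a'))) =
      id_coproduct A \<Delta> (element (A \<otimes>\<^sub>A A) (tensor_one_coproduct A \<Delta> a c))
          \<otimes>\<^bsub>multipliers (A \<otimes>\<^sub>A A \<otimes>\<^sub>A A)\<^esub>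
        tensor_multiplier A (A \<otimes>\<^sub>A A) \<one>\<^bsub>multipliers A\<^esub> (one_tensor A A a')"
    and galois: "galois_bijective A \<Delta>"
    and galois_flip: "galois_bijective A (flip_coproduct A \<Delta>)"

definition is_counit :: "'a::complex_vector algebra \<Rightarrow> 'a coproduct \<Rightarrow> ('a \<Rightarrow> complex) \<Rightarrow> bool" where
  "is_counit A \<Delta> \<epsilon> \<longleftrightarrow>
     linear_on (carrier A) \<epsilon> \<and>
     (\<forall>a\<in>carrier A. \<forall>a'\<in>carrier A. \<epsilon> (a \<cdot>\<^bsub>A\<^esub> a') = \<epsilon> a * \<epsilon> a') \<and>
     (\<forall>a\<in>carrier A. \<forall>a'\<in>carrier A.
        tensor_lift (carrier A) (carrier A) (\<lambda>x y. \<epsilon> x *\<^sub>C y)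
          (element (A \<otimes>\<^sub>A A) (coproduct_one_tensor A \<Delta> a a')) = a \<cdot>\<^bsub>A\<^esub> a')"

definition is_antipode ::
    "'a::complex_vector algebra \<Rightarrow> 'a coproduct \<Rightarrow> ('a \<Rightarrow> complex) \<Rightarrow> ('a \<Rightarrow> 'a) \<Rightarrow> bool" where
  "is_antipode A \<Delta> \<epsilon> S \<longleftrightarrow>
     linear_on (carrier A) S \<and> bij_betw S (carrier A) (carrier A) \<and>
     (\<forall>a\<in>carrier A. \<forall>a'\<in>carrier A. S (a \<cdot>\<^bsub>A\<^esub> a') = S a' \<cdot>\<^bsub>A\<^esub> S a) \<and>
     (\<forall>a\<in>carrier A. \<forall>a'\<in>carrier A.
        tensor_lift (carrier A) (carrier A) (\<lambda>x y. S x \<cdot>\<^bsub>A\<^esub> y)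
          (element (A \<otimes>\<^sub>A A) (coproduct_one_tensor A \<Delta> a a')) = \<epsilon> a *\<^sub>C a')"


section \<open>Algebraic quantum groups\<close>

text \<open>\<open>(\<iota> \<otimes> \<phi>)\<Delta>(a)\<close> is the multiplier of \<open>A\<close> sending \<open>b\<close> to \<open>(\<iota> \<otimes> \<phi>)(\<Delta>(a)(b \<otimes> 1))\<close> by left
  and to \<open>(\<iota> \<otimes> \<phi>)((b \<otimes> 1)\<Delta>(a))\<close> by right multiplication.\<close>

definition id_slice ::
    "'a::complex_vector algebra \<Rightarrow> 'a coproduct \<Rightarrow> ('a \<Rightarrow> complex) \<Rightarrow> 'a \<Rightarrow> 'a multiplier" where
  "id_slice A \<Delta> \<phi> a =
     (\<lambda>b. if b \<in> carrier A then tensor_lift (carrier A) (carrier A) (\<lambda>x y. \<phi> y *\<^sub>C x)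
            (element (A \<otimes>\<^sub>A A) (coproduct_tensor_one A \<Delta> a b)) else 0,
      \<lambda>b. if b \<in> carrier A then tensor_lift (carrier A) (carrier A) (\<lambda>x y. \<phi> y *\<^sub>C x)
            (element (A \<otimes>\<^sub>A A) (tensor_one_coproduct A \<Delta> b a)) else 0)"

definition slice_id ::
    "'a::complex_vector algebra \<Rightarrow> 'a coproduct \<Rightarrow> ('a \<Rightarrow> complex) \<Rightarrow> 'a \<Rightarrow> 'a multiplier" where
  "slice_id A \<Delta> \<psi> a =
     (\<lambda>b. if b \<in> carrier A then tensor_lift (carrier A) (carrier A) (\<lambda>x y. \<psi> x *\<^sub>C y)
            (element (A \<otimes>\<^sub>A A) (coproduct_one_tensor A \<Delta> a b)) else 0,
      \<lambda>b. if b \<in> carrier A then tensor_lift (carrier A) (carrier A) (\<lambda>x y. \<psi> x *\<^sub>C y)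
            (element (A \<otimes>\<^sub>A A) (one_tensor_coproduct A \<Delta> b a)) else 0)"

definition left_integral ::
    "'a::complex_vector algebra \<Rightarrow> 'a coproduct \<Rightarrow> ('a \<Rightarrow> complex) \<Rightarrow> bool" where
  "left_integral A \<Delta> \<phi> \<longleftrightarrow>
     linear_on (carrier A) \<phi> \<and> (\<exists>a\<in>carrier A. \<phi> a \<noteq> 0) \<and>
     (\<forall>a\<in>carrier A. id_slice A \<Delta> \<phi> a = \<phi> a *\<^sub>C \<one>\<^bsub>multipliers A\<^esub>)"

definition right_integral ::
    "'a::complex_vector algebra \<Rightarrow> 'a coproduct \<Rightarrow> ('a \<Rightarrow> complex) \<Rightarrow> bool" where
  "right_integral A \<Delta> \<psi> \<longleftrightarrow>
     linear_on (carrier A) \<psi> \<and> (\<exists>a\<in>carrier A. \<psi> a \<noteq> 0) \<and>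
     (\<forall>a\<in>carrier A. slice_id A \<Delta> \<psi> a = \<psi> a *\<^sub>C \<one>\<^bsub>multipliers A\<^esub>)"

locale algebraic_quantum_group = regular_multiplier_hopf_algebra A \<Delta>
  for A :: "'a::complex_vector algebra" (structure) and \<Delta> :: "'a coproduct" +
  assumes ex_left_integral: "\<exists>\<phi>. left_integral A \<Delta> \<phi>"
    and ex_right_integral: "\<exists>\<psi>. right_integral A \<Delta> \<psi>"


section \<open>The dual\<close>

text \<open>The functional \<open>\<phi>(\<cdot> c)\<close>, set to \<open>0\<close> outside \<open>A\<close>\<close>

definition dual_element ::
    "'a::complex_vector algebra \<Rightarrow> ('a \<Rightarrow> complex) \<Rightarrow> 'a \<Rightarrow> 'a \<Rightarrow> complex" where
  "dual_element A \<phi> c = (\<lambda>x. if x \<in> carrier A then \<phi> (x \<cdot>\<^bsub>A\<^esub> c) else 0)"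

text \<open>The value \<open>\<langle>m, b \<otimes> b'\<rangle>\<close> for \<open>m \<in> M(A \<otimes> A)\<close>: for \<open>b = \<phi>(\<cdot> c)\<close> and \<open>b' = \<phi>(\<cdot> c')\<close> it is
  \<open>(\<phi> \<otimes> \<phi>)(m(c \<otimes> c'))\<close>.\<close>

definition multiplier_pairing ::
    "'a::complex_vector algebra \<Rightarrow> ('a \<Rightarrow> complex) \<Rightarrow> ('a, 'a) tensor multiplier \<Rightarrow>
     ('a \<Rightarrow> complex) \<Rightarrow> ('a \<Rightarrow> complex) \<Rightarrow> complex" where
  "multiplier_pairing A \<phi> m b b' =
     (THE z. \<exists>c\<in>carrier A. \<exists>c'\<in>carrier A. b = dual_element A \<phi> c \<and> b' = dual_element A \<phi> c' \<and>
        z = tensor_lift (carrier A) (carrier A) (\<lambda>x y. \<phi> x * \<phi> y) (fst m (c \<otimes>\<^sub>t c')))"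

definition dual ::
    "'a::complex_vector algebra \<Rightarrow> 'a coproduct \<Rightarrow> ('a \<Rightarrow> complex) \<Rightarrow> ('a \<Rightarrow> complex) algebra" where
  "dual A \<Delta> \<phi> =
     \<lparr>carrier = dual_element A \<phi> ` carrier A,
      alg_mult = \<lambda>b b' a. if a \<in> carrier A then multiplier_pairing A \<phi> (\<Delta> a) b b' else 0\<rparr>"

text \<open>The pairing of \<open>A \<otimes> A\<close> with \<open>B \<otimes> B\<close>, for an algebra \<open>B\<close> of functionals on \<open>A\<close>\<close>

definition tensor_pairing ::
    "'a::complex_vector algebra \<Rightarrow> ('a \<Rightarrow> complex) algebra \<Rightarrow>
     ('a, 'a) tensor \<Rightarrow> ('a \<Rightarrow> complex, 'a \<Rightarrow> complex) tensor \<Rightarrow> complex" where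
  "tensor_pairing A B s t =
     tensor_lift (carrier A) (carrier A) (\<lambda>a a'.
       tensor_lift (carrier B) (carrier B) (\<lambda>b b'. b a * b' a') t) s"

definition is_dual_coproduct ::
    "'a::complex_vector algebra \<Rightarrow> 'a coproduct \<Rightarrow> ('a \<Rightarrow> complex) algebra \<Rightarrow>
     ('a \<Rightarrow> complex) coproduct \<Rightarrow> bool" where
  "is_dual_coproduct A \<Delta> B \<Delta>\<^sub>B \<longleftrightarrow>
     (\<forall>b\<in>carrier B. \<Delta>\<^sub>B b \<in> carrier (multipliers (B \<otimes>\<^sub>A B))) \<and>
     (\<forall>b\<in>carrier B. \<forall>b'\<in>carrier B.
        in_algebra (B \<otimes>\<^sub>A B) (tensor_one_coproduct B \<Delta>\<^sub>B b' b) \<and>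
        in_algebra (B \<otimes>\<^sub>A B) (coproduct_one_tensor B \<Delta>\<^sub>B b b') \<and>
        (\<forall>a\<in>carrier A. \<forall>a'\<in>carrier A.
           tensor_pairing A B (a \<otimes>\<^sub>t a') (element (B \<otimes>\<^sub>A B) (tensor_one_coproduct B \<Delta>\<^sub>B b' b)) =
           tensor_pairing A B (element (A \<otimes>\<^sub>A A) (coproduct_one_tensor A \<Delta> a a')) (b' \<otimes>\<^sub>t b) \<and>
           tensor_pairing A B (a \<otimes>\<^sub>t a') (element (B \<otimes>\<^sub>A B) (coproduct_one_tensor B \<Delta>\<^sub>B b b')) =
           tensor_pairing A B (element (A \<otimes>\<^sub>A A) (tensor_one_coproduct A \<Delta> a a')) (b \<otimes>\<^sub>t b')))"

text \<open>The left actions \<open>a \<triangleright> b\<close> of \<open>A\<close> on \<open>B\<close> and \<open>b \<triangleright> a\<close> of \<open>B\<close> on \<open>A\<close>\<close>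

definition act_on_dual ::
    "'a::complex_vector algebra \<Rightarrow> 'a \<Rightarrow> ('a \<Rightarrow> complex) \<Rightarrow> ('a \<Rightarrow> complex)" where
  "act_on_dual A a b = (\<lambda>a'. if a' \<in> carrier A then b (a' \<cdot>\<^bsub>A\<^esub> a) else 0)"

definition dual_act ::
    "'a::complex_vector algebra \<Rightarrow> ('a \<Rightarrow> complex) algebra \<Rightarrow> ('a \<Rightarrow> complex) \<Rightarrow> 'a \<Rightarrow> 'a" where
  "dual_act A B b a = (THE x. x \<in> carrier A \<and> (\<forall>b'\<in>carrier B. b' x = (b' \<cdot>\<^bsub>B\<^esub> b) a))"

definition cross_pairing ::
    "'a::complex_vector algebra \<Rightarrow> ('a \<Rightarrow> complex) algebra \<Rightarrow>
     ('a \<Rightarrow> complex, 'a) tensor \<Rightarrow> ('a, 'a \<Rightarrow> complex) tensor \<Rightarrow> complex" where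
  "cross_pairing A B s t =
     tensor_lift (carrier B) (carrier A) (\<lambda>b a.
       tensor_lift (carrier A) (carrier B) (\<lambda>a' b'. b a' * b' a) t) s"

text \<open>The extension of the cross pairing to \<open>M(B \<otimes> A) \<times> (A \<otimes> B)\<close>. Since both actions are unital,
  linearity in the second argument makes it unique.\<close>

definition is_extended_pairing ::
    "'a::complex_vector algebra \<Rightarrow> ('a \<Rightarrow> complex) algebra \<Rightarrow>
     (('a \<Rightarrow> complex, 'a) tensor multiplier \<Rightarrow> ('a, 'a \<Rightarrow> complex) tensor \<Rightarrow> complex) \<Rightarrow> bool" where
  "is_extended_pairing A B P \<longleftrightarrow>
     bilinear_on (carrier (multipliers (B \<otimes>\<^sub>A A))) (carrier (A \<otimes>\<^sub>A B)) P \<and>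
     (\<forall>m\<in>carrier (multipliers (B \<otimes>\<^sub>A A)).
        \<forall>a\<in>carrier A. \<forall>a'\<in>carrier A. \<forall>b\<in>carrier B. \<forall>b'\<in>carrier B.
          P m (dual_act A B b a' \<otimes>\<^sub>t act_on_dual A a b') =
          cross_pairing A B (fst m (b \<otimes>\<^sub>t a)) (a' \<otimes>\<^sub>t b'))"

end

theory Submission
  imports Defs
begin

text \<open>Write \<open>B\<close> for the dual, \<open>b \<triangleright> a = (\<iota> \<otimes> b)\<Delta>(a)\<close>, and let \<open>t = \<Sum> b\<^sub>i \<otimes> a\<^sub>i\<close> in \<open>B \<otimes> A\<close> act as the
finite rank operator \<open>T\<^sub>t(w) = \<Sum> b\<^sub>i(w) a\<^sub>i\<close> on \<open>A\<close> (\<open>eval_dual\<close>). Since functionals in \<open>B\<close> are functions on \<open>A\<close>, \<open>t\<close> is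
determined by \<open>T\<^sub>t\<close>. The pairing that defines \<open>V\<close> says, once \<open>B\<close> is known to separate the points of
\<open>A\<close>, that \<open>V(b \<otimes> a)\<close> acts as \<open>w \<mapsto> (b \<triangleright> w) a\<close> and \<open>((S \<otimes> \<iota>)V)(b \<otimes> a)\<close> as
\<open>w \<mapsto> S(b \<triangleright> w) a\<close> (\<open>multiplier_eval\<close>). In Sweedler notation \<open>T\<^sub>V\<^sub>t(w) = w\<^sub>(\<^sub>1\<^sub>) T\<^sub>t(w\<^sub>(\<^sub>2\<^sub>))\<close> and
\<open>T\<^sub>W\<^sub>t(w) = S(w\<^sub>(\<^sub>1\<^sub>)) T\<^sub>t(w\<^sub>(\<^sub>2\<^sub>))\<close> for \<open>W = (S \<otimes> \<iota>)V\<close>, so \<open>V W = 1 = W V\<close> are the two antipode identities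
\<open>w\<^sub>(\<^sub>1\<^sub>) S(w\<^sub>(\<^sub>2\<^sub>)) \<otimes> w\<^sub>(\<^sub>3\<^sub>) = 1 \<otimes> w = S(w\<^sub>(\<^sub>1\<^sub>)) w\<^sub>(\<^sub>2\<^sub>) \<otimes> w\<^sub>(\<^sub>3\<^sub>)\<close>.

Three facts make this rigorous. The first is the slice \<open>left_cop_act\<close> of coassociativity, with a
functional \<open>\<phi>(\<cdot> c)\<close> applied to the third leg: threefold tensors occur only on
the way to it, and all other uses of coassociativity go through it. The second is that \<open>B\<close> separates the
points of \<open>A\<close>, which is the faithfulness \<open>integral_faithful\<close> of the left integral; it rests on
\<open>strong_left_invariance\<close>, \<open>(\<iota> \<otimes> \<phi>)((1 \<otimes> a)\<Delta>(d)) = S((\<iota> \<otimes> \<phi>)(\<Delta>(a)(1 \<otimes> d)))\<close>, and on the right-handed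
counit and antipode identities. The third is that the antipode of \<open>B\<close> is the transpose of \<open>S\<close>
(\<open>dual_antipode_eq\<close>), from which \<open>(\<iota> \<otimes> S)V\<close> and \<open>(S \<otimes> \<iota>)V\<close> have the same pairing with \<open>A \<otimes> B\<close> and
hence coincide. It follows from the defining identity of the antipode of \<open>B\<close> by inverting the
canonical map of \<open>B\<close> explicitly: if \<open>\<Delta>(d)(c \<otimes> 1) = \<Sum> c\<^sub>i \<otimes> d\<^sub>i\<close>, then
\<open>\<Sum> \<Delta>(\<phi>(\<cdot> c\<^sub>i))(1 \<otimes> \<phi>(\<cdot> d\<^sub>i)) = \<phi>(\<cdot> c) \<otimes> \<phi>(\<cdot> d)\<close>.

Multipliers are pairs of maps. All computations concern the left components; the right ones follow
by cancellation in \<open>B \<otimes> A\<close>.\<close>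

section \<open>Linear maps and tensors on subspaces\<close>

lemma linear_onD:
  assumes "linear_on U f"
  shows "x \<in> U \<Longrightarrow> y \<in> U \<Longrightarrow> f (x + y) = f x + f y" "x \<in> U \<Longrightarrow> f (c *\<^sub>C x) = c *\<^sub>C f x"
  using assms by (auto simp: linear_on_def)

lemma linear_on_zero:
  assumes "linear_on U f" "cvec.subspace U" shows "f 0 = 0"
  using linear_onD(2)[OF assms(1), of 0 0] cvec.subspace_0[OF assms(2)] by simp

lemma linear_on_sum:
  assumes "linear_on U f" "cvec.subspace U" "\<And>i. i \<in> I \<Longrightarrow> x i \<in> U"
  shows "f (\<Sum>i\<in>I. x i) = (\<Sum>i\<in>I. f (x i))"
  using assms(3)
proof (induction I rule: infinite_finite_induct)
  case (insert i I)
  then show ?case using assms(1,2) by (simp add: linear_onD(1) cvec.subspace_sum)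
qed (use assms in \<open>simp_all add: linear_on_zero\<close>)

lemma linear_on_diff:
  assumes "linear_on U f" "cvec.subspace U" "x \<in> U" "y \<in> U"
  shows "f (x - y) = f x - f y"
proof -
  have "f ((x - y) + y) = f (x - y) + f y"
    using assms by (intro linear_onD(1)) (simp_all add: cvec.subspace_diff)
  then show ?thesis by simp
qed

lemma linear_on_sum_of_maps:
  "(\<And>i. i \<in> I \<Longrightarrow> linear_on U (f i)) \<Longrightarrow> linear_on U (\<lambda>x. \<Sum>i\<in>I. f i x)"
  unfolding linear_on_def by (auto simp: sum.distrib cvec.scale_sum_right intro!: sum.cong simp flip: sum.distrib)

lemma linear_on_cong:
  assumes "cvec.subspace U" "\<And>x. x \<in> U \<Longrightarrow> f x = g x" "linear_on U g"
  shows "linear_on U f"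
  using assms by (simp add: linear_on_def cvec.subspace_add cvec.subspace_scale)

lemma bilinear_onI:
  assumes "\<And>x x' y. x \<in> U \<Longrightarrow> x' \<in> U \<Longrightarrow> y \<in> W \<Longrightarrow> f (x + x') y = f x y + f x' y"
    and "\<And>x y y'. x \<in> U \<Longrightarrow> y \<in> W \<Longrightarrow> y' \<in> W \<Longrightarrow> f x (y + y') = f x y + f x y'"
    and "\<And>c x y. x \<in> U \<Longrightarrow> y \<in> W \<Longrightarrow> f (c *\<^sub>C x) y = c *\<^sub>C f x y"
    and "\<And>c x y. x \<in> U \<Longrightarrow> y \<in> W \<Longrightarrow> f x (c *\<^sub>C y) = c *\<^sub>C f x y"
  shows "bilinear_on U W f"
  using assms by (auto simp: bilinear_on_def linear_on_def)

lemma sum_fun_apply: "(\<Sum>i\<in>I. f i) x = (\<Sum>i\<in>I. f i x)"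
  by (induction I rule: infinite_finite_induct) auto

lemma scaleC_fun_apply: "(c *\<^sub>C f) x = c *\<^sub>C f x"
  by (simp add: scaleC_fun_def)

lemma tensor_of_linear:
  fixes x x' :: "'a::complex_vector" and y y' :: "'b::complex_vector"
  shows "(x + x') \<otimes>\<^sub>t y = x \<otimes>\<^sub>t y + x' \<otimes>\<^sub>t y" "x \<otimes>\<^sub>t (y + y') = x \<otimes>\<^sub>t y + x \<otimes>\<^sub>t y'"
  "(c *\<^sub>C x) \<otimes>\<^sub>t y = c *\<^sub>C (x \<otimes>\<^sub>t y)" "x \<otimes>\<^sub>t (c *\<^sub>C y) = c *\<^sub>C (x \<otimes>\<^sub>t y)"
  using bilinear_tensor_of[where 'a = 'a and 'b = 'b] by (simp_all add: bilinear_on_def linear_on_def)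

lemma tensor_of_sum_left: "(\<Sum>i\<in>I. x i) \<otimes>\<^sub>t y = (\<Sum>i\<in>I. x i \<otimes>\<^sub>t y)"
  by (rule linear_on_sum[where U = UNIV and f = "\<lambda>x. x \<otimes>\<^sub>t y"])
    (simp_all add: linear_on_def tensor_of_linear)

lemma tensor_of_sum_right: "x \<otimes>\<^sub>t (\<Sum>i\<in>I. y i) = (\<Sum>i\<in>I. x \<otimes>\<^sub>t y i)"
  by (rule linear_on_sum[where U = UNIV and f = "\<lambda>y. x \<otimes>\<^sub>t y"])
    (simp_all add: linear_on_def tensor_of_linear)

lemma tensor_of_zero: "0 \<otimes>\<^sub>t y = 0" "x \<otimes>\<^sub>t 0 = 0"
  using tensor_of_linear(3)[of 0 0 y] tensor_of_linear(4)[of x 0 0] by simp_all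

lemma subspace_tensor_set: "cvec.subspace (tensor_set U W)"
  by (simp add: tensor_set_def)

lemma tensor_of_in_tensor_set: "x \<in> U \<Longrightarrow> y \<in> W \<Longrightarrow> x \<otimes>\<^sub>t y \<in> tensor_set U W"
  unfolding tensor_set_def by (blast intro: cvec.span_base)

lemma tensor_set_decompose:
  assumes "cvec.subspace U" "t \<in> tensor_set U W"
  shows "\<exists>(I::nat set) u w. finite I \<and> (\<forall>i\<in>I. u i \<in> U \<and> w i \<in> W) \<and> t = (\<Sum>i\<in>I. u i \<otimes>\<^sub>t w i)"
proof -
  obtain ps where ps: "set ps \<subseteq> U \<times> W" "t = (\<Sum>(x, y)\<leftarrow>ps. x \<otimes>\<^sub>t y)"
    using tensor_set_rep[OF assms] by blast
  have "t = (\<Sum>i\<in>{..<length ps}. fst (ps ! i) \<otimes>\<^sub>t snd (ps ! i))"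
    unfolding ps(2) by (subst sum_list_sum_nth) (simp add: atLeast0LessThan case_prod_beta)
  moreover have "\<forall>i\<in>{..<length ps}. fst (ps ! i) \<in> U \<and> snd (ps ! i) \<in> W"
    using ps(1) nth_mem by fastforce
  ultimately show ?thesis
    by (intro exI[of _ "{..<length ps}"] exI[of _ "\<lambda>i. fst (ps ! i)"] exI[of _ "\<lambda>i. snd (ps ! i)"]) simp
qed

lemma tensor_set_cases:
  assumes "cvec.subspace U" "t \<in> tensor_set U W"
  obtains I :: "nat set" and u w where "finite I" "\<And>i. i \<in> I \<Longrightarrow> u i \<in> U" "\<And>i. i \<in> I \<Longrightarrow> w i \<in> W"
    "t = (\<Sum>i\<in>I. u i \<otimes>\<^sub>t w i)"
  using tensor_set_decompose[OF assms]
proof (elim exE conjE)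
  fix I :: "nat set" and u w
  assume "finite I" "\<forall>i\<in>I. u i \<in> U \<and> w i \<in> W" "t = (\<Sum>i\<in>I. u i \<otimes>\<^sub>t w i)"
  then show thesis by (intro that[of I u w]) auto
qed

lemma tensor_lift_sum:
  assumes "cvec.subspace U" "cvec.subspace W" "bilinear_on U W f" "\<And>i. i \<in> I \<Longrightarrow> t i \<in> tensor_set U W"
  shows "tensor_lift U W f (\<Sum>i\<in>I. t i) = (\<Sum>i\<in>I. tensor_lift U W f (t i))"
  using linear_on_sum[OF linear_on_tensor_lift[OF assms(1-3)] subspace_tensor_set assms(4)] .

lemma tensor_lift_sum_tensor:
  assumes "cvec.subspace U" "cvec.subspace W" "bilinear_on U W f"
    "\<And>i. i \<in> I \<Longrightarrow> u i \<in> U" "\<And>i. i \<in> I \<Longrightarrow> w i \<in> W"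
  shows "tensor_lift U W f (\<Sum>i\<in>I. u i \<otimes>\<^sub>t w i) = (\<Sum>i\<in>I. f (u i) (w i))"
  using assms by (simp add: tensor_lift_sum tensor_of_in_tensor_set tensor_lift_tensor_of)

lemma tensor_lift_cong:
  assumes "cvec.subspace U" "t \<in> tensor_set U W" "\<And>x y. x \<in> U \<Longrightarrow> y \<in> W \<Longrightarrow> f x y = g x y"
  shows "tensor_lift U W f t = tensor_lift U W g t"
proof -
  define ps where "ps = (SOME ps. set ps \<subseteq> U \<times> W \<and> t = (\<Sum>(x, y)\<leftarrow>ps. x \<otimes>\<^sub>t y))"
  have "set ps \<subseteq> U \<times> W"
    using someI_ex[OF tensor_set_rep[OF assms(1,2)]] by (simp add: ps_def)
  then have "(\<Sum>(x, y)\<leftarrow>ps. f x y) = (\<Sum>(x, y)\<leftarrow>ps. g x y)"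
    using assms(3) by (intro arg_cong[where f = sum_list] map_cong) auto
  then show ?thesis by (simp only: tensor_lift_def Let_def flip: ps_def)
qed

lemma sum_scaleC_remove:
  assumes "finite I" "k \<in> I" "c k \<noteq> 0" "(\<Sum>i\<in>I. c i *\<^sub>C x i) = 0"
  shows "x k = (\<Sum>i\<in>I - {k}. (- c i / c k) *\<^sub>C x i)"
proof -
  have "c k *\<^sub>C x k = - (\<Sum>i\<in>I - {k}. c i *\<^sub>C x i)"
    using assms by (simp add: sum.remove eq_neg_iff_add_eq_0)
  then have "(1 / c k) *\<^sub>C c k *\<^sub>C x k = - ((1 / c k) *\<^sub>C (\<Sum>i\<in>I - {k}. c i *\<^sub>C x i))"
    by simp
  then show ?thesis
    using assms(3) by (simp add: scaleC_scaleC scaleC_one cvec.scale_sum_right sum_negf)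
qed

text \<open>A decomposition with the least number of summands is linearly independent on both sides: a relation
between the \<open>u i\<close> expresses one of them by the others, and moving its coefficients to the other leg
saves a summand.\<close>

lemma tensor_set_independent_cases:
  assumes U: "cvec.subspace U" and W: "cvec.subspace W" and t: "t \<in> tensor_set U W"
  obtains I :: "nat set" and u w where "finite I" "\<And>i. i \<in> I \<Longrightarrow> u i \<in> U" "\<And>i. i \<in> I \<Longrightarrow> w i \<in> W"
    "t = (\<Sum>i\<in>I. u i \<otimes>\<^sub>t w i)"
    "\<And>c i. (\<Sum>i\<in>I. c i *\<^sub>C u i) = 0 \<Longrightarrow> i \<in> I \<Longrightarrow> c i = 0"
    "\<And>c i. (\<Sum>i\<in>I. c i *\<^sub>C w i) = 0 \<Longrightarrow> i \<in> I \<Longrightarrow> c i = 0"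
proof -
  define Q where "Q n \<longleftrightarrow> (\<exists>(I::nat set) u w. finite I \<and> card I = n \<and> (\<forall>i\<in>I. u i \<in> U \<and> w i \<in> W) \<and>
    t = (\<Sum>i\<in>I. u i \<otimes>\<^sub>t w i))" for n
  have "\<exists>n. Q n"
    using tensor_set_decompose[OF U t] unfolding Q_def by metis
  then have "Q (LEAST n. Q n)" by (rule LeastI_ex)
  then obtain I :: "nat set" and u w where I: "finite I" "card I = (LEAST n. Q n)" "\<forall>i\<in>I. u i \<in> U \<and> w i \<in> W"
    "t = (\<Sum>i\<in>I. u i \<otimes>\<^sub>t w i)"
    unfolding Q_def[of "LEAST n. Q n"] by (elim exE conjE) (rule that; assumption)
  have minimal: False
    if k: "k \<in> I" and "\<forall>i\<in>I - {k}. u' i \<in> U \<and> w' i \<in> W" "t = (\<Sum>i\<in>I - {k}. u' i \<otimes>\<^sub>t w' i)" for k u' w'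
  proof -
    have "Q (card (I - {k}))"
      unfolding Q_def using that I(1)
      by (intro exI[of _ "I - {k}"] exI[of _ u'] exI[of _ w']) auto
    then have "(LEAST n. Q n) \<le> card (I - {k})" by (rule Least_le)
    moreover have "card (I - {k}) < card I" using card_Diff1_less[OF I(1) k] .
    ultimately show False using I(2) by simp
  qed
  have indep_u: "c k = 0" if c: "(\<Sum>i\<in>I. c i *\<^sub>C u i) = 0" "k \<in> I" for c k
  proof (rule ccontr)
    assume "c k \<noteq> 0"
    define d where "d i = - c i / c k" for i
    have uk: "u k = (\<Sum>i\<in>I - {k}. d i *\<^sub>C u i)"
      unfolding d_def using c I(1) \<open>c k \<noteq> 0\<close> by (intro sum_scaleC_remove) auto
    have "t = u k \<otimes>\<^sub>t w k + (\<Sum>i\<in>I - {k}. u i \<otimes>\<^sub>t w i)"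
      using I(1,4) c(2) by (simp add: sum.remove)
    also have "\<dots> = (\<Sum>i\<in>I - {k}. u i \<otimes>\<^sub>t (w i + d i *\<^sub>C w k))"
      by (subst uk) (simp add: tensor_of_sum_left tensor_of_linear sum.distrib add.commute)
    finally show False
      using minimal[of k u "\<lambda>i. w i + d i *\<^sub>C w k"] I(3) c(2) W by (simp add: cvec.subspace_add cvec.subspace_scale)
  qed
  have indep_w: "c k = 0" if c: "(\<Sum>i\<in>I. c i *\<^sub>C w i) = 0" "k \<in> I" for c k
  proof (rule ccontr)
    assume "c k \<noteq> 0"
    define d where "d i = - c i / c k" for i
    have wk: "w k = (\<Sum>i\<in>I - {k}. d i *\<^sub>C w i)"
      unfolding d_def using c I(1) \<open>c k \<noteq> 0\<close> by (intro sum_scaleC_remove) auto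
    have "t = u k \<otimes>\<^sub>t w k + (\<Sum>i\<in>I - {k}. u i \<otimes>\<^sub>t w i)"
      using I(1,4) c(2) by (simp add: sum.remove)
    also have "\<dots> = (\<Sum>i\<in>I - {k}. (u i + d i *\<^sub>C u k) \<otimes>\<^sub>t w i)"
      by (subst wk) (simp add: tensor_of_sum_right tensor_of_linear sum.distrib add.commute)
    finally show False
      using minimal[of k "\<lambda>i. u i + d i *\<^sub>C u k" w] I(3) c(2) U by (simp add: cvec.subspace_add cvec.subspace_scale)
  qed
  show thesis
    by (rule that[of I u w]) (use I in \<open>auto dest: indep_u indep_w\<close>)
qed

text \<open>Slicing a decomposition with independent right legs shows that the functionals in \<open>H\<close> vanish on every left leg.\<close>

lemma tensor_separated_left:
  assumes U: "cvec.subspace U" and W: "cvec.subspace W" and t: "t \<in> tensor_set U W"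
    and lin: "\<And>h. h \<in> H \<Longrightarrow> linear_on U h"
    and sep: "\<And>x. x \<in> U \<Longrightarrow> (\<And>h. h \<in> H \<Longrightarrow> h x = (0::complex)) \<Longrightarrow> x = 0"
    and zero: "\<And>h. h \<in> H \<Longrightarrow> tensor_lift U W (\<lambda>x y. h x *\<^sub>C y) t = 0"
  shows "t = 0"
proof -
  obtain I :: "nat set" and u w where I: "finite I" "\<And>i. i \<in> I \<Longrightarrow> u i \<in> U" "\<And>i. i \<in> I \<Longrightarrow> w i \<in> W"
    "t = (\<Sum>i\<in>I. u i \<otimes>\<^sub>t w i)" "\<And>c i. (\<Sum>i\<in>I. c i *\<^sub>C w i) = 0 \<Longrightarrow> i \<in> I \<Longrightarrow> c i = 0"
    by (rule tensor_set_independent_cases[OF U W t]) blast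
  have "h (u i) = 0" if h: "h \<in> H" and i: "i \<in> I" for h i
  proof -
    have "bilinear_on U W (\<lambda>x y. h x *\<^sub>C y)"
      using lin[OF h] by (intro bilinear_onI)
        (simp_all add: linear_onD scaleC_add_left scaleC_add_right scaleC_scaleC mult.commute)
    then have "(\<Sum>i\<in>I. h (u i) *\<^sub>C w i) = 0"
      using zero[OF h] I by (simp add: tensor_lift_sum_tensor U W)
    then show ?thesis using I(5)[of "\<lambda>i. h (u i)"] i by blast
  qed
  then have "u i = 0" if "i \<in> I" for i using sep that I(2) by blast
  then show ?thesis by (simp add: I(4) tensor_of_zero)
qed

lemma linear_functionals_separate:
  fixes x :: "'a::complex_vector"
  assumes "\<And>h :: 'a \<Rightarrow> complex. linear_on UNIV h \<Longrightarrow> h x = 0"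
  shows "x = 0"
proof (rule ccontr)
  assume "x \<noteq> 0"
  then have "cvec.independent {x}" by simp
  then obtain h :: "'a \<Rightarrow> complex" where "Vector_Spaces.linear scaleC scaleC h" "\<forall>y\<in>{x}. h y = 1"
    using cvec_pair.linear_independent_extend[of "{x}" "\<lambda>_. 1"] by blast
  then show False using assms[of h] by (simp flip: linear_on_UNIV)
qed

text \<open>Composing the maps \<open>f i\<close> with linear functionals leads to the one-sided criterion; the slices that it
requires to vanish lie in \<open>W\<close> and are annihilated by every \<open>g j\<close>.\<close>

lemma tensor_separated:
  fixes U :: "'a::complex_vector set" and W :: "'b::complex_vector set"
  assumes U: "cvec.subspace U" and W: "cvec.subspace W" and t: "t \<in> tensor_set U W"
    and f: "\<And>i. i \<in> I \<Longrightarrow> linear_on U (f i)" and g: "\<And>j. j \<in> J \<Longrightarrow> linear_on W (g j)"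
    and sepf: "\<And>x. x \<in> U \<Longrightarrow> (\<And>i. i \<in> I \<Longrightarrow> f i x = 0) \<Longrightarrow> x = 0"
    and sepg: "\<And>y. y \<in> W \<Longrightarrow> (\<And>j. j \<in> J \<Longrightarrow> g j y = 0) \<Longrightarrow> y = 0"
    and zero: "\<And>i j. i \<in> I \<Longrightarrow> j \<in> J \<Longrightarrow> tensor_lift U W (\<lambda>x y. f i x \<otimes>\<^sub>t g j y) t = 0"
  shows "t = 0"
proof -
  obtain K :: "nat set" and u w where K: "finite K" "\<And>k. k \<in> K \<Longrightarrow> u k \<in> U" "\<And>k. k \<in> K \<Longrightarrow> w k \<in> W"
    "t = (\<Sum>k\<in>K. u k \<otimes>\<^sub>t w k)"
    by (rule tensor_set_cases[OF U t]) (rule that; assumption)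
  \<comment> \<open>The separating functionals on \<open>U\<close> are all the \<open>h \<circ> f i\<close> with \<open>h\<close> linear.\<close>
  define H :: "('a \<Rightarrow> complex) set" where "H = {(\<lambda>x. h (f i x)) | h i. i \<in> I \<and> linear_on UNIV h}"
  show ?thesis
  proof (rule tensor_separated_left[OF U W t, where H = H])
    show "linear_on U h" if "h \<in> H" for h
      using that f by (auto simp: H_def linear_on_def)
    show "x = 0" if "x \<in> U" "\<And>h. h \<in> H \<Longrightarrow> h x = (0::complex)" for x
    proof (rule sepf[OF that(1)])
      show "f i x = 0" if "i \<in> I" for i
        by (rule linear_functionals_separate) (use \<open>\<And>h. h \<in> H \<Longrightarrow> h x = 0\<close> that in \<open>auto simp: H_def\<close>)
    qed
    show "tensor_lift U W (\<lambda>x y. h x *\<^sub>C y) t = 0" if hH: "h \<in> H" for h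
    proof -
      obtain h' i where h: "h = (\<lambda>x. h' (f i x))" "i \<in> I" "linear_on UNIV h'"
        using hH by (auto simp: H_def)
      have bil: "bilinear_on U W (\<lambda>x y. h x *\<^sub>C y)"
        using h f[OF h(2)] by (intro bilinear_onI)
          (simp_all add: linear_onD scaleC_add_left scaleC_add_right scaleC_scaleC mult.commute)
      have eq: "tensor_lift U W (\<lambda>x y. h x *\<^sub>C y) t = (\<Sum>k\<in>K. h (u k) *\<^sub>C w k)"
        using K by (simp add: tensor_lift_sum_tensor U W bil)
      have "(\<Sum>k\<in>K. h (u k) *\<^sub>C w k) = 0"
      proof (rule sepg)
        show "(\<Sum>k\<in>K. h (u k) *\<^sub>C w k) \<in> W"
          using K W by (simp add: cvec.subspace_sum cvec.subspace_scale)
        show "g j (\<Sum>k\<in>K. h (u k) *\<^sub>C w k) = 0" if j: "j \<in> J" for j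
        proof -
          have b1: "bilinear_on U W (\<lambda>x y. f i x \<otimes>\<^sub>t g j y)"
            using f[OF h(2)] g[OF j] by (intro bilinear_onI) (simp_all add: linear_onD tensor_of_linear)
          have b2: "bilinear_on UNIV UNIV (\<lambda>x y. h' x *\<^sub>C y)"
            using h(3) by (intro bilinear_onI)
              (simp_all add: linear_onD scaleC_add_left scaleC_add_right scaleC_scaleC mult.commute)
          have "tensor_lift UNIV UNIV (\<lambda>x y. h' x *\<^sub>C y) (\<Sum>k\<in>K. f i (u k) \<otimes>\<^sub>t g j (w k)) =
              tensor_lift UNIV UNIV (\<lambda>x y. h' x *\<^sub>C y) (\<Sum>k\<in>{}. f i (u k) \<otimes>\<^sub>t g j (w k))"
            using zero[OF h(2) j] K by (simp add: tensor_lift_sum_tensor U W b1)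
          then have "(\<Sum>k\<in>K. h' (f i (u k)) *\<^sub>C g j (w k)) = 0"
            unfolding tensor_lift_sum_tensor[OF cvec.subspace_UNIV cvec.subspace_UNIV b2 UNIV_I UNIV_I] by simp
          then show ?thesis
            using K W g[OF j] by (simp add: linear_on_sum linear_onD cvec.subspace_scale h(1))
        qed
      qed
      with eq show ?thesis by simp
    qed
  qed
qed

context complex_algebra
begin

lemma carrier_closed:
  "x \<in> carrier A \<Longrightarrow> y \<in> carrier A \<Longrightarrow> x + y \<in> carrier A"
  "x \<in> carrier A \<Longrightarrow> y \<in> carrier A \<Longrightarrow> x - y \<in> carrier A"
  "x \<in> carrier A \<Longrightarrow> c *\<^sub>C x \<in> carrier A"
  "0 \<in> carrier A"
  "(\<And>i. i \<in> I \<Longrightarrow> f i \<in> carrier A) \<Longrightarrow> (\<Sum>i\<in>I. f i) \<in> carrier A"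
  using subspace_carrier
  by (simp_all add: cvec.subspace_add cvec.subspace_diff cvec.subspace_scale cvec.subspace_0
      cvec.subspace_sum)

lemma mult_linear:
  "x \<in> carrier A \<Longrightarrow> x' \<in> carrier A \<Longrightarrow> y \<in> carrier A \<Longrightarrow> (x + x') \<cdot> y = x \<cdot> y + x' \<cdot> y"
  "x \<in> carrier A \<Longrightarrow> y \<in> carrier A \<Longrightarrow> y' \<in> carrier A \<Longrightarrow> x \<cdot> (y + y') = x \<cdot> y + x \<cdot> y'"
  "x \<in> carrier A \<Longrightarrow> y \<in> carrier A \<Longrightarrow> (c *\<^sub>C x) \<cdot> y = c *\<^sub>C (x \<cdot> y)"
  "x \<in> carrier A \<Longrightarrow> y \<in> carrier A \<Longrightarrow> x \<cdot> (c *\<^sub>C y) = c *\<^sub>C (x \<cdot> y)"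
  using alg_mult_bilinear by (auto simp: bilinear_on_def linear_on_def)

lemma linear_on_mult_left: "x \<in> carrier A \<Longrightarrow> linear_on (carrier A) (\<lambda>y. x \<cdot> y)"
  and linear_on_mult_right: "y \<in> carrier A \<Longrightarrow> linear_on (carrier A) (\<lambda>x. x \<cdot> y)"
  by (simp_all add: linear_on_def mult_linear)

lemma mult_sum_left:
  "y \<in> carrier A \<Longrightarrow> (\<And>i. i \<in> I \<Longrightarrow> f i \<in> carrier A) \<Longrightarrow> (\<Sum>i\<in>I. f i) \<cdot> y = (\<Sum>i\<in>I. f i \<cdot> y)"
  by (rule linear_on_sum[OF linear_on_mult_right subspace_carrier]) auto

lemma mult_sum_right:
  "x \<in> carrier A \<Longrightarrow> (\<And>i. i \<in> I \<Longrightarrow> f i \<in> carrier A) \<Longrightarrow> x \<cdot> (\<Sum>i\<in>I. f i) = (\<Sum>i\<in>I. x \<cdot> f i)"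
  by (rule linear_on_sum[OF linear_on_mult_left subspace_carrier]) auto

lemma mult_diff:
  "x \<in> carrier A \<Longrightarrow> x' \<in> carrier A \<Longrightarrow> y \<in> carrier A \<Longrightarrow> (x - x') \<cdot> y = x \<cdot> y - x' \<cdot> y"
  "x \<in> carrier A \<Longrightarrow> y \<in> carrier A \<Longrightarrow> y' \<in> carrier A \<Longrightarrow> x \<cdot> (y - y') = x \<cdot> y - x \<cdot> y'"
  using linear_on_diff[OF linear_on_mult_right subspace_carrier]
    linear_on_diff[OF linear_on_mult_left subspace_carrier] by auto

end

lemma (in nondegenerate_algebra) mult_right_cancel:
  assumes "x \<in> carrier A" "y \<in> carrier A" "\<And>z. z \<in> carrier A \<Longrightarrow> x \<cdot> z = y \<cdot> z"
  shows "x = y"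
  using nondegenerate_left[of "x - y"] assms by (simp add: mult_diff carrier_closed)

lemma (in nondegenerate_algebra) mult_left_cancel:
  assumes "x \<in> carrier A" "y \<in> carrier A" "\<And>z. z \<in> carrier A \<Longrightarrow> z \<cdot> x = z \<cdot> y"
  shows "x = y"
  using nondegenerate_right[of "x - y"] assms by (simp add: mult_diff carrier_closed)

section \<open>Tensor products of algebras\<close>

lemma carrier_tensor_algebra: "carrier (A \<otimes>\<^sub>A B) = tensor_set (carrier A) (carrier B)"
  by (simp add: tensor_algebra_def)

text \<open>Products are only asked to be bilinear, with values anywhere in the ambient space. The dual, whose
product is given as a functional on \<open>A\<close>, is then an instance at once.\<close>

locale bilinear_multiplications =
  fixes A :: "'a::complex_vector algebra" and B :: "'b::complex_vector algebra"
  assumes sub1: "cvec.subspace (carrier A)" and sub2: "cvec.subspace (carrier B)"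
    and bil1: "bilinear_on (carrier A) (carrier A) (\<lambda>x y. x \<cdot>\<^bsub>A\<^esub> y)"
    and bil2: "bilinear_on (carrier B) (carrier B) (\<lambda>x y. x \<cdot>\<^bsub>B\<^esub> y)"
begin

lemma linear_mult1: "x \<in> carrier A \<Longrightarrow> linear_on (carrier A) (\<lambda>y. x \<cdot>\<^bsub>A\<^esub> y)"
  "y \<in> carrier A \<Longrightarrow> linear_on (carrier A) (\<lambda>x. x \<cdot>\<^bsub>A\<^esub> y)"
  using bil1 by (auto simp: bilinear_on_def)

lemma linear_mult2: "x \<in> carrier B \<Longrightarrow> linear_on (carrier B) (\<lambda>y. x \<cdot>\<^bsub>B\<^esub> y)"
  "y \<in> carrier B \<Longrightarrow> linear_on (carrier B) (\<lambda>x. x \<cdot>\<^bsub>B\<^esub> y)"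
  using bil2 by (auto simp: bilinear_on_def)

lemma mult1_distrib:
  "x \<in> carrier A \<Longrightarrow> x' \<in> carrier A \<Longrightarrow> y \<in> carrier A \<Longrightarrow> (x + x') \<cdot>\<^bsub>A\<^esub> y = x \<cdot>\<^bsub>A\<^esub> y + x' \<cdot>\<^bsub>A\<^esub> y"
  "x \<in> carrier A \<Longrightarrow> y \<in> carrier A \<Longrightarrow> (c *\<^sub>C x) \<cdot>\<^bsub>A\<^esub> y = c *\<^sub>C (x \<cdot>\<^bsub>A\<^esub> y)"
  using bil1 by (auto simp: bilinear_on_def linear_on_def)

lemma mult2_distrib:
  "x \<in> carrier B \<Longrightarrow> x' \<in> carrier B \<Longrightarrow> y \<in> carrier B \<Longrightarrow> (x + x') \<cdot>\<^bsub>B\<^esub> y = x \<cdot>\<^bsub>B\<^esub> y + x' \<cdot>\<^bsub>B\<^esub> y"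
  "x \<in> carrier B \<Longrightarrow> y \<in> carrier B \<Longrightarrow> (c *\<^sub>C x) \<cdot>\<^bsub>B\<^esub> y = c *\<^sub>C (x \<cdot>\<^bsub>B\<^esub> y)"
  using bil2 by (auto simp: bilinear_on_def linear_on_def)

lemma bilinear_tensor_left:
  assumes "x \<in> carrier A" "y \<in> carrier B"
  shows "bilinear_on (carrier A) (carrier B) (\<lambda>x' y'. (x \<cdot>\<^bsub>A\<^esub> x') \<otimes>\<^sub>t (y \<cdot>\<^bsub>B\<^esub> y'))"
  using linear_mult1(1)[OF assms(1)] linear_mult2(1)[OF assms(2)]
  by (intro bilinear_onI) (simp_all add: linear_on_def tensor_of_linear)

lemma bilinear_tensor_right:
  assumes "x' \<in> carrier A" "y' \<in> carrier B"
  shows "bilinear_on (carrier A) (carrier B) (\<lambda>x y. (x \<cdot>\<^bsub>A\<^esub> x') \<otimes>\<^sub>t (y \<cdot>\<^bsub>B\<^esub> y'))"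
  using linear_mult1(2)[OF assms(1)] linear_mult2(2)[OF assms(2)]
  by (intro bilinear_onI) (simp_all add: linear_on_def tensor_of_linear)

lemma bilinear_tensor_lift_left:
  assumes t: "t \<in> carrier (A \<otimes>\<^sub>A B)"
  shows "bilinear_on (carrier A) (carrier B)
    (\<lambda>x y. tensor_lift (carrier A) (carrier B) (\<lambda>x' y'. (x \<cdot>\<^bsub>A\<^esub> x') \<otimes>\<^sub>t (y \<cdot>\<^bsub>B\<^esub> y')) t)"
proof -
  obtain J :: "nat set" and u w where J: "finite J" "\<And>j. j \<in> J \<Longrightarrow> u j \<in> carrier A"
    "\<And>j. j \<in> J \<Longrightarrow> w j \<in> carrier B" "t = (\<Sum>j\<in>J. u j \<otimes>\<^sub>t w j)"
    using t tensor_set_cases[OF sub1] unfolding carrier_tensor_algebra by blast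
  have eq: "tensor_lift (carrier A) (carrier B) (\<lambda>x' y'. (x \<cdot>\<^bsub>A\<^esub> x') \<otimes>\<^sub>t (y \<cdot>\<^bsub>B\<^esub> y')) t =
      (\<Sum>j\<in>J. (x \<cdot>\<^bsub>A\<^esub> u j) \<otimes>\<^sub>t (y \<cdot>\<^bsub>B\<^esub> w j))" if "x \<in> carrier A" "y \<in> carrier B" for x y
    unfolding J(4) by (intro tensor_lift_sum_tensor sub1 sub2 bilinear_tensor_left that J(2,3))
  show ?thesis
    using J(2,3)
    by (intro bilinear_onI)
      (simp_all add: eq sub1 sub2 cvec.subspace_add cvec.subspace_scale mult1_distrib mult2_distrib
        tensor_of_linear sum.distrib cvec.scale_sum_right)
qed

lemma tensor_mult_tensor_of:
  assumes "x \<in> carrier A" "y \<in> carrier B" "t \<in> carrier (A \<otimes>\<^sub>A B)"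
  shows "x \<otimes>\<^sub>t y \<cdot>\<^bsub>A \<otimes>\<^sub>A B\<^esub> t =
    tensor_lift (carrier A) (carrier B) (\<lambda>x' y'. (x \<cdot>\<^bsub>A\<^esub> x') \<otimes>\<^sub>t (y \<cdot>\<^bsub>B\<^esub> y')) t"
  using tensor_lift_tensor_of[OF sub1 sub2 bilinear_tensor_lift_left[OF assms(3)] assms(1,2)]
  by (simp add: tensor_algebra_def)

lemma linear_on_tensor_mult:
  "t \<in> carrier (A \<otimes>\<^sub>A B) \<Longrightarrow> linear_on (carrier (A \<otimes>\<^sub>A B)) (\<lambda>s. s \<cdot>\<^bsub>A \<otimes>\<^sub>A B\<^esub> t)"
  using linear_on_tensor_lift[OF sub1 sub2 bilinear_tensor_lift_left]
  by (simp add: tensor_algebra_def)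

lemma tensor_mult_sums:
  assumes "\<And>i. i \<in> I \<Longrightarrow> u i \<in> carrier A" "\<And>i. i \<in> I \<Longrightarrow> w i \<in> carrier B"
    "\<And>j. j \<in> J \<Longrightarrow> u' j \<in> carrier A" "\<And>j. j \<in> J \<Longrightarrow> w' j \<in> carrier B"
  shows "(\<Sum>i\<in>I. u i \<otimes>\<^sub>t w i) \<cdot>\<^bsub>A \<otimes>\<^sub>A B\<^esub> (\<Sum>j\<in>J. u' j \<otimes>\<^sub>t w' j) =
    (\<Sum>i\<in>I. \<Sum>j\<in>J. (u i \<cdot>\<^bsub>A\<^esub> u' j) \<otimes>\<^sub>t (w i \<cdot>\<^bsub>B\<^esub> w' j))"
proof -
  have t: "(\<Sum>j\<in>J. u' j \<otimes>\<^sub>t w' j) \<in> carrier (A \<otimes>\<^sub>A B)"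
    using assms by (simp add: carrier_tensor_algebra cvec.subspace_sum subspace_tensor_set
        tensor_of_in_tensor_set)
  have "(\<Sum>i\<in>I. u i \<otimes>\<^sub>t w i) \<cdot>\<^bsub>A \<otimes>\<^sub>A B\<^esub> (\<Sum>j\<in>J. u' j \<otimes>\<^sub>t w' j) =
      (\<Sum>i\<in>I. u i \<otimes>\<^sub>t w i \<cdot>\<^bsub>A \<otimes>\<^sub>A B\<^esub> (\<Sum>j\<in>J. u' j \<otimes>\<^sub>t w' j))"
    using assms by (intro linear_on_sum[OF linear_on_tensor_mult[OF t]])
      (auto simp: carrier_tensor_algebra subspace_tensor_set tensor_of_in_tensor_set)
  also have "\<dots> = (\<Sum>i\<in>I. \<Sum>j\<in>J. (u i \<cdot>\<^bsub>A\<^esub> u' j) \<otimes>\<^sub>t (w i \<cdot>\<^bsub>B\<^esub> w' j))"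
    using assms t by (intro sum.cong refl)
      (simp add: tensor_mult_tensor_of tensor_lift_sum_tensor sub1 sub2 bilinear_tensor_left)
  finally show ?thesis .
qed

lemma tensor_mult_pure:
  assumes "x \<in> carrier A" "y \<in> carrier B" "x' \<in> carrier A" "y' \<in> carrier B"
  shows "x \<otimes>\<^sub>t y \<cdot>\<^bsub>A \<otimes>\<^sub>A B\<^esub> (x' \<otimes>\<^sub>t y') = (x \<cdot>\<^bsub>A\<^esub> x') \<otimes>\<^sub>t (y \<cdot>\<^bsub>B\<^esub> y')"
  using assms tensor_mult_sums[of "{()}" "\<lambda>_. x" "\<lambda>_. y" "{()}" "\<lambda>_. x'" "\<lambda>_. y'"] by simp

lemma tensor_algebra_cases:
  assumes "t \<in> carrier (A \<otimes>\<^sub>A B)"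
  obtains I :: "nat set" and u w where "finite I" "\<And>i. i \<in> I \<Longrightarrow> u i \<in> carrier A"
    "\<And>i. i \<in> I \<Longrightarrow> w i \<in> carrier B" "t = (\<Sum>i\<in>I. u i \<otimes>\<^sub>t w i)"
  using tensor_set_cases[OF sub1] assms unfolding carrier_tensor_algebra by blast

end

text \<open>Multiplication by elementary tensors separates tensors, because multiplication by elements separates each factor.\<close>

lemma nondegenerate_tensor_algebra:
  assumes "nondegenerate_algebra A" "nondegenerate_algebra B"
  shows "nondegenerate_algebra (A \<otimes>\<^sub>A B)"
proof -
  interpret A: nondegenerate_algebra A by fact
  interpret B: nondegenerate_algebra B by fact
  interpret bilinear_multiplications A B
    by unfold_locales (rule A.subspace_carrier B.subspace_carrier A.alg_mult_bilinear B.alg_mult_bilinear)+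
  note C = carrier_tensor_algebra[of A B]
  have sub: "cvec.subspace (carrier (A \<otimes>\<^sub>A B))" by (simp add: C subspace_tensor_set)
  show ?thesis
  proof
    show "cvec.subspace (carrier (A \<otimes>\<^sub>A B))" by fact
    fix s t r assume s: "s \<in> carrier (A \<otimes>\<^sub>A B)" and t: "t \<in> carrier (A \<otimes>\<^sub>A B)"
    obtain I :: "nat set" and u w where I: "\<And>i. i \<in> I \<Longrightarrow> u i \<in> carrier A"
      "\<And>i. i \<in> I \<Longrightarrow> w i \<in> carrier B" "s = (\<Sum>i\<in>I. u i \<otimes>\<^sub>t w i)"
      using tensor_algebra_cases[OF s] by metis
    obtain J :: "nat set" and u' w' where J: "\<And>i. i \<in> J \<Longrightarrow> u' i \<in> carrier A"
      "\<And>i. i \<in> J \<Longrightarrow> w' i \<in> carrier B" "t = (\<Sum>i\<in>J. u' i \<otimes>\<^sub>t w' i)"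
      using tensor_algebra_cases[OF t] by metis
    show "s \<cdot>\<^bsub>A \<otimes>\<^sub>A B\<^esub> t \<in> carrier (A \<otimes>\<^sub>A B)"
      unfolding I(3) J(3) using I(1,2) J(1,2)
      by (subst tensor_mult_sums) (auto simp: C intro!: cvec.subspace_sum subspace_tensor_set
          tensor_of_in_tensor_set A.alg_mult_closed B.alg_mult_closed)
    assume r: "r \<in> carrier (A \<otimes>\<^sub>A B)"
    obtain K :: "nat set" and u'' w'' where K: "\<And>i. i \<in> K \<Longrightarrow> u'' i \<in> carrier A"
      "\<And>i. i \<in> K \<Longrightarrow> w'' i \<in> carrier B" "r = (\<Sum>i\<in>K. u'' i \<otimes>\<^sub>t w'' i)"
      using tensor_algebra_cases[OF r] by metis
    have st: "s \<cdot>\<^bsub>A \<otimes>\<^sub>A B\<^esub> t = (\<Sum>p\<in>I \<times> J. (u (fst p) \<cdot>\<^bsub>A\<^esub> u' (snd p)) \<otimes>\<^sub>t (w (fst p) \<cdot>\<^bsub>B\<^esub> w' (snd p)))"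
      unfolding I(3) J(3) using I(1,2) J(1,2)
      by (subst tensor_mult_sums) (simp_all add: sum.cartesian_product case_prod_beta)
    have tr: "t \<cdot>\<^bsub>A \<otimes>\<^sub>A B\<^esub> r = (\<Sum>p\<in>J \<times> K. (u' (fst p) \<cdot>\<^bsub>A\<^esub> u'' (snd p)) \<otimes>\<^sub>t (w' (fst p) \<cdot>\<^bsub>B\<^esub> w'' (snd p)))"
      unfolding K(3) J(3) using J(1,2) K(1,2)
      by (subst tensor_mult_sums) (simp_all add: sum.cartesian_product case_prod_beta)
    have "s \<cdot>\<^bsub>A \<otimes>\<^sub>A B\<^esub> t \<cdot>\<^bsub>A \<otimes>\<^sub>A B\<^esub> r = (\<Sum>p\<in>I \<times> J. \<Sum>k\<in>K.
        (u (fst p) \<cdot>\<^bsub>A\<^esub> u' (snd p) \<cdot>\<^bsub>A\<^esub> u'' k) \<otimes>\<^sub>t (w (fst p) \<cdot>\<^bsub>B\<^esub> w' (snd p) \<cdot>\<^bsub>B\<^esub> w'' k))"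
      unfolding st K(3) using I(1,2) J(1,2) K(1,2)
      by (intro tensor_mult_sums) (auto simp: A.alg_mult_closed B.alg_mult_closed)
    also have "\<dots> = (\<Sum>i\<in>I. \<Sum>p\<in>J \<times> K.
        (u i \<cdot>\<^bsub>A\<^esub> (u' (fst p) \<cdot>\<^bsub>A\<^esub> u'' (snd p))) \<otimes>\<^sub>t (w i \<cdot>\<^bsub>B\<^esub> (w' (fst p) \<cdot>\<^bsub>B\<^esub> w'' (snd p))))"
      using I(1,2) J(1,2) K(1,2)
      by (simp add: sum.cartesian_product' A.alg_mult_assoc B.alg_mult_assoc)
    also have "\<dots> = s \<cdot>\<^bsub>A \<otimes>\<^sub>A B\<^esub> (t \<cdot>\<^bsub>A \<otimes>\<^sub>A B\<^esub> r)"
      unfolding tr I(3) using I(1,2) J(1,2) K(1,2)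
      by (intro tensor_mult_sums[symmetric]) (auto simp: A.alg_mult_closed B.alg_mult_closed)
    finally show "s \<cdot>\<^bsub>A \<otimes>\<^sub>A B\<^esub> t \<cdot>\<^bsub>A \<otimes>\<^sub>A B\<^esub> r = s \<cdot>\<^bsub>A \<otimes>\<^sub>A B\<^esub> (t \<cdot>\<^bsub>A \<otimes>\<^sub>A B\<^esub> r)" .
  next
    have "linear_on (carrier (A \<otimes>\<^sub>A B)) (\<lambda>t. s \<cdot>\<^bsub>A \<otimes>\<^sub>A B\<^esub> t)" if s: "s \<in> carrier (A \<otimes>\<^sub>A B)" for s
    proof -
      obtain I :: "nat set" and u w where I: "\<And>i. i \<in> I \<Longrightarrow> u i \<in> carrier A"
        "\<And>i. i \<in> I \<Longrightarrow> w i \<in> carrier B" "s = (\<Sum>i\<in>I. u i \<otimes>\<^sub>t w i)"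
        using tensor_algebra_cases[OF s] by metis
      have eq: "s \<cdot>\<^bsub>A \<otimes>\<^sub>A B\<^esub> t = (\<Sum>i\<in>I. u i \<otimes>\<^sub>t w i \<cdot>\<^bsub>A \<otimes>\<^sub>A B\<^esub> t)" if t: "t \<in> carrier (A \<otimes>\<^sub>A B)" for t
        unfolding I(3) using I by (intro linear_on_sum[OF linear_on_tensor_mult[OF t] sub])
          (simp add: C tensor_of_in_tensor_set)
      have lin: "linear_on (carrier (A \<otimes>\<^sub>A B)) (\<lambda>t. u i \<otimes>\<^sub>t w i \<cdot>\<^bsub>A \<otimes>\<^sub>A B\<^esub> t)" if "i \<in> I" for i
      proof -
        have "linear_on (carrier (A \<otimes>\<^sub>A B)) (tensor_lift (carrier A) (carrier B)
            (\<lambda>x' y'. (u i \<cdot>\<^bsub>A\<^esub> x') \<otimes>\<^sub>t (w i \<cdot>\<^bsub>B\<^esub> y')))"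
          unfolding C using that I by (intro linear_on_tensor_lift sub1 sub2 bilinear_tensor_left)
        then show ?thesis
          using I(1,2)[OF that] by (simp add: linear_on_def tensor_mult_tensor_of cvec.subspace_add[OF sub]
              cvec.subspace_scale[OF sub])
      qed
      show ?thesis
        by (rule linear_on_cong[OF sub eq linear_on_sum_of_maps[OF lin]])
    qed
    then show "bilinear_on (carrier (A \<otimes>\<^sub>A B)) (carrier (A \<otimes>\<^sub>A B)) (\<lambda>s t. s \<cdot>\<^bsub>A \<otimes>\<^sub>A B\<^esub> t)"
      by (simp add: bilinear_on_def linear_on_tensor_mult)
  next
    fix t assume t: "t \<in> carrier (A \<otimes>\<^sub>A B)" and zero: "\<forall>s\<in>carrier (A \<otimes>\<^sub>A B). t \<cdot>\<^bsub>A \<otimes>\<^sub>A B\<^esub> s = 0"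
    obtain I :: "nat set" and u w where I: "\<And>i. i \<in> I \<Longrightarrow> u i \<in> carrier A"
      "\<And>i. i \<in> I \<Longrightarrow> w i \<in> carrier B" "t = (\<Sum>i\<in>I. u i \<otimes>\<^sub>t w i)"
      using tensor_algebra_cases[OF t] by metis
    show "t = 0"
    proof (rule tensor_separated[where U = "carrier A" and W = "carrier B" and I = "carrier A" and J = "carrier B"
          and f = "\<lambda>x' x. x \<cdot>\<^bsub>A\<^esub> x'" and g = "\<lambda>y' y. y \<cdot>\<^bsub>B\<^esub> y'"])
      fix x' y' assume xy: "x' \<in> carrier A" "y' \<in> carrier B"
      have "tensor_lift (carrier A) (carrier B) (\<lambda>x y. (x \<cdot>\<^bsub>A\<^esub> x') \<otimes>\<^sub>t (y \<cdot>\<^bsub>B\<^esub> y')) t = t \<cdot>\<^bsub>A \<otimes>\<^sub>A B\<^esub> (x' \<otimes>\<^sub>t y')"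
        unfolding I(3) using xy I(1,2) tensor_mult_sums[of I u w "{()}" "\<lambda>_. x'" "\<lambda>_. y'"]
        by (simp add: tensor_lift_sum_tensor sub1 sub2 bilinear_tensor_right)
      also have "\<dots> = 0" using zero xy by (simp add: C tensor_of_in_tensor_set)
      finally show "tensor_lift (carrier A) (carrier B) (\<lambda>x y. (x \<cdot>\<^bsub>A\<^esub> x') \<otimes>\<^sub>t (y \<cdot>\<^bsub>B\<^esub> y')) t = 0" .
    qed (use t in \<open>auto simp: C sub1 sub2 linear_mult1 linear_mult2 intro: A.nondegenerate_left B.nondegenerate_left\<close>)
  next
    fix t assume t: "t \<in> carrier (A \<otimes>\<^sub>A B)" and zero: "\<forall>s\<in>carrier (A \<otimes>\<^sub>A B). s \<cdot>\<^bsub>A \<otimes>\<^sub>A B\<^esub> t = 0"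
    show "t = 0"
    proof (rule tensor_separated[where U = "carrier A" and W = "carrier B" and I = "carrier A" and J = "carrier B"
          and f = "\<lambda>x' x. x' \<cdot>\<^bsub>A\<^esub> x" and g = "\<lambda>y' y. y' \<cdot>\<^bsub>B\<^esub> y"])
      fix x' y' assume xy: "x' \<in> carrier A" "y' \<in> carrier B"
      then show "tensor_lift (carrier A) (carrier B) (\<lambda>x y. (x' \<cdot>\<^bsub>A\<^esub> x) \<otimes>\<^sub>t (y' \<cdot>\<^bsub>B\<^esub> y)) t = 0"
        using zero t by (simp add: C tensor_of_in_tensor_set flip: tensor_mult_tensor_of)
    qed (use t in \<open>auto simp: C sub1 sub2 linear_mult1 linear_mult2 intro: A.nondegenerate_right B.nondegenerate_right\<close>)
  qed
qed

lemma multiplierD: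
  assumes "m \<in> carrier (multipliers A)"
  shows "linear_on (carrier A) (fst m)" "linear_on (carrier A) (snd m)"
    "x \<in> carrier A \<Longrightarrow> fst m x \<in> carrier A" "x \<in> carrier A \<Longrightarrow> snd m x \<in> carrier A"
    "x \<notin> carrier A \<Longrightarrow> fst m x = 0" "x \<notin> carrier A \<Longrightarrow> snd m x = 0"
    "x \<in> carrier A \<Longrightarrow> y \<in> carrier A \<Longrightarrow> fst m (x \<cdot>\<^bsub>A\<^esub> y) = fst m x \<cdot>\<^bsub>A\<^esub> y"
    "x \<in> carrier A \<Longrightarrow> y \<in> carrier A \<Longrightarrow> snd m x \<cdot>\<^bsub>A\<^esub> y = x \<cdot>\<^bsub>A\<^esub> fst m y"
  using assms by (auto simp: multipliers_def is_multiplier_def Let_def)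

lemma mult_multipliers: "m \<otimes>\<^bsub>multipliers A\<^esub> n = (fst m \<circ> fst n, snd n \<circ> snd m)"
  by (simp add: multipliers_def)

lemma one_multipliers:
  "\<one>\<^bsub>multipliers A\<^esub> = (\<lambda>x. if x \<in> carrier A then x else 0, \<lambda>x. if x \<in> carrier A then x else 0)"
  by (simp add: multipliers_def)

lemma element_in_carrier: "in_algebra A m \<Longrightarrow> element A m \<in> carrier A"
  unfolding in_algebra_def element_def by (rule inv_into_into)

lemma element_mult:
  assumes "in_algebra A m" "x \<in> carrier A"
  shows "element A m \<cdot>\<^bsub>A\<^esub> x = fst m x"
proof -
  have "embed A (element A m) = m"
    using assms(1) unfolding in_algebra_def element_def by (rule f_inv_into_f)
  then have "fst m x = fst (embed A (element A m)) x" by simp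
  then show ?thesis using assms(2) by (simp add: embed_def)
qed

section \<open>Reassociation of threefold tensors\<close>

lemma tensor_set_UNIV: "tensor_set UNIV UNIV = (UNIV :: ('a::complex_vector, 'b::complex_vector) tensor set)"
proof -
  have "abs_tensor p \<in> tensor_set UNIV UNIV" for p :: "('a \<times> 'b) \<Rightarrow>\<^sub>0 complex"
  proof (induction p rule: update_induct)
    case const
    show ?case
      by (simp add: cvec.subspace_0[OF subspace_tensor_set] flip: zero_tensor.abs_eq)
  next
    case (update p k v)
    have "Poly_Mapping.update k v p = v *\<^sub>C free_gen (fst k) (snd k) + p"
      using update(1) by (intro poly_mapping_eqI)
        (auto simp: scaleC_poly_mapping.rep_eq lookup_single lookup_update lookup_add when_def in_keys_iff)
    then have "abs_tensor (Poly_Mapping.update k v p) = v *\<^sub>C (fst k \<otimes>\<^sub>t snd k) + abs_tensor p"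
      by (simp add: tensor_of.abs_eq scaleC_tensor.abs_eq plus_tensor.abs_eq)
    then show ?case
      using update by (simp add: cvec.subspace_scale cvec.subspace_add subspace_tensor_set tensor_of_in_tensor_set)
  qed
  then have "t \<in> tensor_set UNIV UNIV" for t :: "('a, 'b) tensor"
    by (induction t rule: tensor.abs_induct) simp
  then show ?thesis by blast
qed

lemma linear_eq_on_tensors:
  fixes f g :: "('a::complex_vector, 'b::complex_vector) tensor \<Rightarrow> 'c::complex_vector"
  assumes "linear_on UNIV f" "linear_on UNIV g" "\<And>x y. f (x \<otimes>\<^sub>t y) = g (x \<otimes>\<^sub>t y)"
  shows "f t = g t"
proof -
  have "t \<in> tensor_set UNIV UNIV" by (simp add: tensor_set_UNIV)
  then obtain I :: "nat set" and u w where "t = (\<Sum>i\<in>I. u i \<otimes>\<^sub>t w i)"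
    using tensor_set_cases[OF cvec.subspace_UNIV] by metis
  then show ?thesis
    using assms(3) by (simp add: linear_on_sum[OF assms(1)] linear_on_sum[OF assms(2)])
qed

lemma linear_on_tensor_lift_UNIV:
  "bilinear_on UNIV UNIV f \<Longrightarrow> linear_on UNIV (tensor_lift UNIV UNIV f)"
  using linear_on_tensor_lift[OF cvec.subspace_UNIV cvec.subspace_UNIV] by (simp add: tensor_set_UNIV)

lemma tensor_lift_UNIV_tensor_of:
  "bilinear_on UNIV UNIV f \<Longrightarrow> tensor_lift UNIV UNIV f (x \<otimes>\<^sub>t y) = f x y"
  by (simp add: tensor_lift_tensor_of)

text \<open>Linear extension in two variables at a time, with the third as a parameter; both directions of the
reassociation are of this form.\<close>

lemma bilinear_on_curried_lift:
  assumes "\<And>z. bilinear_on UNIV UNIV (\<lambda>x y. f x y z)" "\<And>x y. linear_on UNIV (f x y)"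
  shows "bilinear_on UNIV UNIV (\<lambda>s z. tensor_lift UNIV UNIV (\<lambda>x y. f x y z) s)"
proof (rule bilinear_onI)
  fix s s' z z' c
  note lin = linear_on_tensor_lift_UNIV[OF assms(1)] and pure = tensor_lift_UNIV_tensor_of[OF assms(1)]
  show "tensor_lift UNIV UNIV (\<lambda>x y. f x y z) (s + s') =
      tensor_lift UNIV UNIV (\<lambda>x y. f x y z) s + tensor_lift UNIV UNIV (\<lambda>x y. f x y z) s'"
    "tensor_lift UNIV UNIV (\<lambda>x y. f x y z) (c *\<^sub>C s) = c *\<^sub>C tensor_lift UNIV UNIV (\<lambda>x y. f x y z) s"
    using linear_onD[OF lin] by auto
  show "tensor_lift UNIV UNIV (\<lambda>x y. f x y (z + z')) s =
      tensor_lift UNIV UNIV (\<lambda>x y. f x y z) s + tensor_lift UNIV UNIV (\<lambda>x y. f x y z') s"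
  proof (rule linear_eq_on_tensors[OF lin])
    show "linear_on UNIV (\<lambda>s. tensor_lift UNIV UNIV (\<lambda>x y. f x y z) s + tensor_lift UNIV UNIV (\<lambda>x y. f x y z') s)"
      using lin[of z] lin[of z'] by (simp add: linear_on_def scaleC_add_right)
  qed (simp only: pure, use assms(2) in \<open>simp add: linear_on_def\<close>)
  show "tensor_lift UNIV UNIV (\<lambda>x y. f x y (c *\<^sub>C z)) s = c *\<^sub>C tensor_lift UNIV UNIV (\<lambda>x y. f x y z) s"
  proof (rule linear_eq_on_tensors[OF lin])
    show "linear_on UNIV (\<lambda>s. c *\<^sub>C tensor_lift UNIV UNIV (\<lambda>x y. f x y z) s)"
      using lin[of z] by (simp add: linear_on_def scaleC_add_right scaleC_scaleC mult.commute)
  qed (simp only: pure, use assms(2) in \<open>simp add: linear_on_def\<close>)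
qed

lemma bilinear_assoc_inner:
  "bilinear_on UNIV UNIV (\<lambda>x y. x \<otimes>\<^sub>t (y \<otimes>\<^sub>t z))" "linear_on UNIV (\<lambda>z. x \<otimes>\<^sub>t (y \<otimes>\<^sub>t z))"
  "bilinear_on UNIV UNIV (\<lambda>y z. (x \<otimes>\<^sub>t y) \<otimes>\<^sub>t z)" "linear_on UNIV (\<lambda>x. (x \<otimes>\<^sub>t y) \<otimes>\<^sub>t z)"
  by (simp_all add: bilinear_on_def linear_on_def tensor_of_linear)

lemma bilinear_assoc:
  "bilinear_on UNIV UNIV (\<lambda>s z. tensor_lift UNIV UNIV (\<lambda>x y. x \<otimes>\<^sub>t (y \<otimes>\<^sub>t z)) s)"
  by (rule bilinear_on_curried_lift) (rule bilinear_assoc_inner)+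

lemma linear_on_tensor_assoc: "linear_on UNIV tensor_assoc"
  unfolding tensor_assoc_def by (rule linear_on_tensor_lift_UNIV[OF bilinear_assoc])

lemma tensor_assoc_tensor_of: "tensor_assoc ((x \<otimes>\<^sub>t y) \<otimes>\<^sub>t z) = x \<otimes>\<^sub>t (y \<otimes>\<^sub>t z)"
  by (simp add: tensor_assoc_def tensor_lift_UNIV_tensor_of[OF bilinear_assoc]
      tensor_lift_UNIV_tensor_of[OF bilinear_assoc_inner(1)])

lemma inj_tensor_assoc:
  "inj (tensor_assoc :: (('a::complex_vector, 'b::complex_vector) tensor, 'c::complex_vector) tensor \<Rightarrow> _)"
proof (rule inj_on_inverseI)
  have swapped: "bilinear_on UNIV UNIV (\<lambda>r x. tensor_lift UNIV UNIV (\<lambda>y z. (x \<otimes>\<^sub>t y) \<otimes>\<^sub>t z) r)"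
    by (rule bilinear_on_curried_lift) (rule bilinear_assoc_inner)+
  then have bil: "bilinear_on UNIV UNIV (\<lambda>x r. tensor_lift UNIV UNIV (\<lambda>y z. (x \<otimes>\<^sub>t y) \<otimes>\<^sub>t z) r)"
    unfolding bilinear_on_def by blast
  define reassoc :: "('a, ('b, 'c) tensor) tensor \<Rightarrow> (('a, 'b) tensor, 'c) tensor" where
    "reassoc = tensor_lift UNIV UNIV (\<lambda>x r. tensor_lift UNIV UNIV (\<lambda>y z. (x \<otimes>\<^sub>t y) \<otimes>\<^sub>t z) r)"
  have lin: "linear_on UNIV reassoc"
    unfolding reassoc_def by (rule linear_on_tensor_lift_UNIV[OF bil])
  have pure: "reassoc (x \<otimes>\<^sub>t (y \<otimes>\<^sub>t z)) = (x \<otimes>\<^sub>t y) \<otimes>\<^sub>t z" for x y z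
    by (simp add: reassoc_def tensor_lift_UNIV_tensor_of[OF bil]
        tensor_lift_UNIV_tensor_of[OF bilinear_assoc_inner(3)])
  have comp: "linear_on UNIV (\<lambda>t. reassoc (tensor_assoc t))"
    unfolding linear_on_def by (simp add: linear_onD[OF lin] linear_onD[OF linear_on_tensor_assoc])
  show "reassoc (tensor_assoc t) = t" for t
  proof (rule linear_eq_on_tensors[OF comp])
    show "linear_on UNIV (\<lambda>t. t)" by (simp add: linear_on_def)
    fix s z
    show "reassoc (tensor_assoc (s \<otimes>\<^sub>t z)) = s \<otimes>\<^sub>t z"
      by (rule linear_eq_on_tensors[where t = s])
        (use comp in \<open>simp_all add: linear_on_def tensor_of_linear tensor_assoc_tensor_of pure\<close>)
  qed
qed

lemma inv_tensor_assoc: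
  assumes "(x \<otimes>\<^sub>t y) \<otimes>\<^sub>t z \<in> C"
  shows "inv_into C tensor_assoc (x \<otimes>\<^sub>t (y \<otimes>\<^sub>t z)) = (x \<otimes>\<^sub>t y) \<otimes>\<^sub>t z"
  by (rule inv_into_f_eq[OF inj_on_subset[OF inj_tensor_assoc subset_UNIV] assms tensor_assoc_tensor_of])

section \<open>Tensor products of multipliers\<close>

text \<open>The pairs of linear maps form a vector space that contains the multipliers and on which
\<open>tensor_multiplier\<close> is bilinear. Linear extensions such as \<open>coproduct_id\<close> can be computed in it.\<close>

definition linear_pairs :: "'a::complex_vector algebra \<Rightarrow> 'a multiplier set" where
  "linear_pairs A = {m. linear_on (carrier A) (fst m) \<and> linear_on (carrier A) (snd m)}"

lemma fst_scaleC: "fst (c *\<^sub>C p) = c *\<^sub>C fst p" and snd_scaleC: "snd (c *\<^sub>C p) = c *\<^sub>C snd p"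
  by (simp_all add: scaleC_prod_def)

lemma linear_pairs_add: "m \<in> linear_pairs A \<Longrightarrow> n \<in> linear_pairs A \<Longrightarrow> m + n \<in> linear_pairs A"
  by (simp add: linear_pairs_def linear_on_def scaleC_add_right)

lemma linear_pairs_scale: "m \<in> linear_pairs A \<Longrightarrow> c *\<^sub>C m \<in> linear_pairs A"
  by (simp add: linear_pairs_def linear_on_def scaleC_prod_def scaleC_fun_apply scaleC_add_right
      scaleC_scaleC mult.commute)

lemma tensor_multiplier_sum:
  assumes "cvec.subspace (carrier A)" "cvec.subspace (carrier B)" "m \<in> linear_pairs A" "n \<in> linear_pairs B"
    "\<And>i. i \<in> I \<Longrightarrow> u i \<in> carrier A" "\<And>i. i \<in> I \<Longrightarrow> w i \<in> carrier B"
  shows "fst (tensor_multiplier A B m n) (\<Sum>i\<in>I. u i \<otimes>\<^sub>t w i) = (\<Sum>i\<in>I. fst m (u i) \<otimes>\<^sub>t fst n (w i))"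
    and "snd (tensor_multiplier A B m n) (\<Sum>i\<in>I. u i \<otimes>\<^sub>t w i) = (\<Sum>i\<in>I. snd m (u i) \<otimes>\<^sub>t snd n (w i))"
proof -
  have "(\<Sum>i\<in>I. u i \<otimes>\<^sub>t w i) \<in> carrier (A \<otimes>\<^sub>A B)"
    using assms by (simp add: carrier_tensor_algebra cvec.subspace_sum subspace_tensor_set
        tensor_of_in_tensor_set)
  moreover have "bilinear_on (carrier A) (carrier B) (\<lambda>x y. fst m x \<otimes>\<^sub>t fst n y)"
      "bilinear_on (carrier A) (carrier B) (\<lambda>x y. snd m x \<otimes>\<^sub>t snd n y)"
    using assms(3,4) by (auto intro!: bilinear_onI simp: linear_pairs_def linear_onD tensor_of_linear)
  ultimately show "fst (tensor_multiplier A B m n) (\<Sum>i\<in>I. u i \<otimes>\<^sub>t w i) = (\<Sum>i\<in>I. fst m (u i) \<otimes>\<^sub>t fst n (w i))"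
    "snd (tensor_multiplier A B m n) (\<Sum>i\<in>I. u i \<otimes>\<^sub>t w i) = (\<Sum>i\<in>I. snd m (u i) \<otimes>\<^sub>t snd n (w i))"
    using assms by (simp_all add: tensor_multiplier_def tensor_lift_sum_tensor)
qed

lemma tensor_multiplier_tensor_of:
  assumes "cvec.subspace (carrier A)" "cvec.subspace (carrier B)" "m \<in> linear_pairs A" "n \<in> linear_pairs B"
    "x \<in> carrier A" "y \<in> carrier B"
  shows "fst (tensor_multiplier A B m n) (x \<otimes>\<^sub>t y) = fst m x \<otimes>\<^sub>t fst n y"
  using tensor_multiplier_sum(1)[of A B m n "{()}" "\<lambda>_. x" "\<lambda>_. y"] assms by simp

lemma tensor_multiplier_linear:
  assumes "cvec.subspace (carrier A)" "cvec.subspace (carrier B)" "m \<in> linear_pairs A" "n \<in> linear_pairs B"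
  shows "tensor_multiplier A B m n \<in> linear_pairs (A \<otimes>\<^sub>A B)"
proof -
  have sub: "cvec.subspace (carrier (A \<otimes>\<^sub>A B))" by (simp add: carrier_tensor_algebra subspace_tensor_set)
  have "bilinear_on (carrier A) (carrier B) (\<lambda>x y. fst m x \<otimes>\<^sub>t fst n y)"
      "bilinear_on (carrier A) (carrier B) (\<lambda>x y. snd m x \<otimes>\<^sub>t snd n y)"
    using assms(3,4) by (auto intro!: bilinear_onI simp: linear_pairs_def linear_onD tensor_of_linear)
  note lin = this[THEN linear_on_tensor_lift[OF assms(1,2)]]
  have "linear_on (carrier (A \<otimes>\<^sub>A B)) (fst (tensor_multiplier A B m n))"
    by (rule linear_on_cong[OF sub _ lin(1)[folded carrier_tensor_algebra]])
      (simp add: tensor_multiplier_def)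
  moreover have "linear_on (carrier (A \<otimes>\<^sub>A B)) (snd (tensor_multiplier A B m n))"
    by (rule linear_on_cong[OF sub _ lin(2)[folded carrier_tensor_algebra]])
      (simp add: tensor_multiplier_def)
  ultimately show ?thesis by (simp add: linear_pairs_def)
qed

lemma bilinear_on_tensor_multiplier:
  assumes sub: "cvec.subspace (carrier A)" "cvec.subspace (carrier B)" "cvec.subspace U" "cvec.subspace W"
    and f: "linear_on U f" "\<And>x. x \<in> U \<Longrightarrow> f x \<in> linear_pairs A"
    and g: "linear_on W g" "\<And>y. y \<in> W \<Longrightarrow> g y \<in> linear_pairs B"
  shows "bilinear_on U W (\<lambda>x y. tensor_multiplier A B (f x) (g y))"
proof -
  have fst_snd: "fst (tensor_multiplier A B m n) t = 0 \<and> snd (tensor_multiplier A B m n) t = 0"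
    if "t \<notin> carrier (A \<otimes>\<^sub>A B)" for m n t
    using that by (simp add: tensor_multiplier_def)
  have eq: "p = q" if "\<And>(I :: nat set) u w. (\<And>i. i \<in> I \<Longrightarrow> u i \<in> carrier A) \<Longrightarrow>
      (\<And>i. i \<in> I \<Longrightarrow> w i \<in> carrier B) \<Longrightarrow>
      fst p (\<Sum>i\<in>I. u i \<otimes>\<^sub>t w i) = fst q (\<Sum>i\<in>I. u i \<otimes>\<^sub>t w i) \<and>
      snd p (\<Sum>i\<in>I. u i \<otimes>\<^sub>t w i) = snd q (\<Sum>i\<in>I. u i \<otimes>\<^sub>t w i)"
    "\<And>t. t \<notin> carrier (A \<otimes>\<^sub>A B) \<Longrightarrow> fst p t = fst q t \<and> snd p t = snd q t"
    for p q :: "('a, 'b) tensor multiplier"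
  proof -
    have "fst p t = fst q t \<and> snd p t = snd q t" for t
    proof (cases "t \<in> carrier (A \<otimes>\<^sub>A B)")
      case True
      then have "t \<in> tensor_set (carrier A) (carrier B)" by (simp add: carrier_tensor_algebra)
      then obtain I :: "nat set" and u w where "\<And>i. i \<in> I \<Longrightarrow> u i \<in> carrier A"
        "\<And>i. i \<in> I \<Longrightarrow> w i \<in> carrier B" and t: "t = (\<Sum>i\<in>I. u i \<otimes>\<^sub>t w i)"
        by (rule tensor_set_cases[OF sub(1)]) (rule that; assumption)
      then show ?thesis unfolding t by (intro that(1))
    qed (use that(2) in auto)
    then show ?thesis by (simp add: prod_eq_iff fun_eq_iff)
  qed
  note sums = tensor_multiplier_sum[OF sub(1,2)]
  show ?thesis
  proof (rule bilinear_onI; rule eq)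
  qed (simp_all add: linear_onD[OF f(1)] linear_onD[OF g(1)] sums fst_snd f(2) g(2)
      linear_pairs_add linear_pairs_scale fst_scaleC snd_scaleC
      tensor_of_linear sum.distrib cvec.scale_sum_right scaleC_fun_apply)
qed

lemma tensor_multiplier_left_mult:
  assumes "bilinear_multiplications A B" "m \<in> linear_pairs A" "n \<in> linear_pairs B"
    and closed: "\<And>x y. x \<in> carrier A \<Longrightarrow> y \<in> carrier A \<Longrightarrow> x \<cdot>\<^bsub>A\<^esub> y \<in> carrier A"
      "\<And>x y. x \<in> carrier B \<Longrightarrow> y \<in> carrier B \<Longrightarrow> x \<cdot>\<^bsub>B\<^esub> y \<in> carrier B"
    and m: "\<And>x. x \<in> carrier A \<Longrightarrow> fst m x \<in> carrier A"
      "\<And>x y. x \<in> carrier A \<Longrightarrow> y \<in> carrier A \<Longrightarrow> fst m (x \<cdot>\<^bsub>A\<^esub> y) = fst m x \<cdot>\<^bsub>A\<^esub> y"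
    and n: "\<And>x. x \<in> carrier B \<Longrightarrow> fst n x \<in> carrier B"
      "\<And>x y. x \<in> carrier B \<Longrightarrow> y \<in> carrier B \<Longrightarrow> fst n (x \<cdot>\<^bsub>B\<^esub> y) = fst n x \<cdot>\<^bsub>B\<^esub> y"
    and st: "s \<in> carrier (A \<otimes>\<^sub>A B)" "t \<in> carrier (A \<otimes>\<^sub>A B)"
  shows "fst (tensor_multiplier A B m n) s \<in> carrier (A \<otimes>\<^sub>A B)"
    and "fst (tensor_multiplier A B m n) (s \<cdot>\<^bsub>A \<otimes>\<^sub>A B\<^esub> t) = fst (tensor_multiplier A B m n) s \<cdot>\<^bsub>A \<otimes>\<^sub>A B\<^esub> t"
proof -
  interpret bilinear_multiplications A B by fact
  obtain I :: "nat set" and u w where I: "\<And>i. i \<in> I \<Longrightarrow> u i \<in> carrier A"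
    "\<And>i. i \<in> I \<Longrightarrow> w i \<in> carrier B" "s = (\<Sum>i\<in>I. u i \<otimes>\<^sub>t w i)"
    using tensor_algebra_cases[OF st(1)] by metis
  obtain J :: "nat set" and u' w' where J: "\<And>i. i \<in> J \<Longrightarrow> u' i \<in> carrier A"
    "\<And>i. i \<in> J \<Longrightarrow> w' i \<in> carrier B" "t = (\<Sum>i\<in>J. u' i \<otimes>\<^sub>t w' i)"
    using tensor_algebra_cases[OF st(2)] by metis
  note sums = tensor_multiplier_sum(1)[OF sub1 sub2 assms(2,3)]
  show "fst (tensor_multiplier A B m n) s \<in> carrier (A \<otimes>\<^sub>A B)"
    unfolding I(3) using I(1,2) by (subst sums)
      (auto simp: carrier_tensor_algebra m n intro!: cvec.subspace_sum subspace_tensor_set tensor_of_in_tensor_set)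
  have "s \<cdot>\<^bsub>A \<otimes>\<^sub>A B\<^esub> t = (\<Sum>p\<in>I \<times> J. (u (fst p) \<cdot>\<^bsub>A\<^esub> u' (snd p)) \<otimes>\<^sub>t (w (fst p) \<cdot>\<^bsub>B\<^esub> w' (snd p)))"
    unfolding I(3) J(3) using I(1,2) J(1,2)
    by (subst tensor_mult_sums) (simp_all add: sum.cartesian_product case_prod_beta)
  then have "fst (tensor_multiplier A B m n) (s \<cdot>\<^bsub>A \<otimes>\<^sub>A B\<^esub> t) =
      (\<Sum>p\<in>I \<times> J. (fst m (u (fst p)) \<cdot>\<^bsub>A\<^esub> u' (snd p)) \<otimes>\<^sub>t (fst n (w (fst p)) \<cdot>\<^bsub>B\<^esub> w' (snd p)))"
    using I(1,2) J(1,2) by (subst \<open>s \<cdot>\<^bsub>A \<otimes>\<^sub>A B\<^esub> t = _\<close>, subst sums) (auto simp: m n closed intro!: sum.cong)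
  also have "\<dots> = fst (tensor_multiplier A B m n) s \<cdot>\<^bsub>A \<otimes>\<^sub>A B\<^esub> t"
    unfolding I(3) J(3) using I(1,2) J(1,2)
    by (subst sums) (simp_all add: tensor_mult_sums m n sum.cartesian_product case_prod_beta)
  finally show "fst (tensor_multiplier A B m n) (s \<cdot>\<^bsub>A \<otimes>\<^sub>A B\<^esub> t) = fst (tensor_multiplier A B m n) s \<cdot>\<^bsub>A \<otimes>\<^sub>A B\<^esub> t" .
qed

lemma one_linear_pairs: "cvec.subspace (carrier A) \<Longrightarrow> \<one>\<^bsub>multipliers A\<^esub> \<in> linear_pairs A"
  by (simp add: linear_pairs_def one_multipliers linear_on_def cvec.subspace_add cvec.subspace_scale)

lemma multiplier_linear_pairs: "m \<in> carrier (multipliers A) \<Longrightarrow> m \<in> linear_pairs A"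
  by (simp add: linear_pairs_def multiplierD)

lemma (in complex_algebra) embed_linear_pairs: "x \<in> carrier A \<Longrightarrow> embed A x \<in> linear_pairs A"
  by (auto simp: linear_pairs_def embed_def linear_on_def mult_linear carrier_closed)

lemma (in complex_algebra) linear_on_embed: "linear_on (carrier A) (embed A)"
  by (auto simp: linear_on_def embed_def mult_linear carrier_closed prod_eq_iff fun_eq_iff
      scaleC_prod_def scaleC_fun_apply)

section \<open>Multiplication by one leg\<close>

sublocale complex_algebra \<subseteq> bilinear_multiplications A A
  by unfold_locales (rule subspace_carrier alg_mult_bilinear)+

context complex_algebra
begin

abbreviation lift :: "('a \<Rightarrow> 'a \<Rightarrow> 'b::complex_vector) \<Rightarrow> ('a, 'a) tensor \<Rightarrow> 'b" where
  "lift \<equiv> tensor_lift (carrier A) (carrier A)"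

text \<open>The substitute for Sweedler notation: names for the legs of a tensor, with respect to which linear
maps become finite sums.\<close>

definition decomposes :: "nat set \<Rightarrow> (nat \<Rightarrow> 'a) \<Rightarrow> (nat \<Rightarrow> 'a) \<Rightarrow> ('a, 'a) tensor \<Rightarrow> bool" where
  "decomposes I u v t \<longleftrightarrow>
    (\<forall>i\<in>I. u i \<in> carrier A) \<and> (\<forall>i\<in>I. v i \<in> carrier A) \<and> t = (\<Sum>i\<in>I. u i \<otimes>\<^sub>t v i)"

lemma decomposesD:
  assumes "decomposes I u v t"
  shows "\<And>i. i \<in> I \<Longrightarrow> u i \<in> carrier A" "\<And>i. i \<in> I \<Longrightarrow> v i \<in> carrier A"
    "t = (\<Sum>i\<in>I. u i \<otimes>\<^sub>t v i)"
  using assms by (auto simp: decomposes_def)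

lemma ex_decomposes:
  assumes "t \<in> carrier (A \<otimes>\<^sub>A A)"
  obtains I u v where "decomposes I u v t"
proof (rule tensor_algebra_cases[OF assms])
  fix I :: "nat set" and u v
  assume "\<And>i. i \<in> I \<Longrightarrow> u i \<in> carrier A" "\<And>i. i \<in> I \<Longrightarrow> v i \<in> carrier A" "t = (\<Sum>i\<in>I. u i \<otimes>\<^sub>t v i)"
  then show thesis by (intro that[of I u v]) (simp add: decomposes_def)
qed

lemma lift_decomposes:
  "decomposes I u v t \<Longrightarrow> bilinear_on (carrier A) (carrier A) f \<Longrightarrow> lift f t = (\<Sum>i\<in>I. f (u i) (v i))"
  unfolding decomposes_def by (simp add: tensor_lift_sum_tensor subspace_carrier)

lemma tensor_of_closed: "x \<in> carrier A \<Longrightarrow> y \<in> carrier A \<Longrightarrow> x \<otimes>\<^sub>t y \<in> carrier (A \<otimes>\<^sub>A A)"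
  by (simp add: carrier_tensor_algebra tensor_of_in_tensor_set)

lemma tensor_sum_closed:
  "(\<And>i. i \<in> I \<Longrightarrow> t i \<in> carrier (A \<otimes>\<^sub>A A)) \<Longrightarrow> (\<Sum>i\<in>I. t i) \<in> carrier (A \<otimes>\<^sub>A A)"
  by (simp add: carrier_tensor_algebra cvec.subspace_sum subspace_tensor_set)

lemma linear_on_lift:
  "bilinear_on (carrier A) (carrier A) f \<Longrightarrow> linear_on (carrier (A \<otimes>\<^sub>A A)) (lift f)"
  using linear_on_tensor_lift[OF subspace_carrier subspace_carrier] by (simp add: carrier_tensor_algebra)

lemma lift_sum:
  "bilinear_on (carrier A) (carrier A) f \<Longrightarrow> (\<And>i. i \<in> I \<Longrightarrow> t i \<in> carrier (A \<otimes>\<^sub>A A)) \<Longrightarrow>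
    lift f (\<Sum>i\<in>I. t i) = (\<Sum>i\<in>I. lift f (t i))"
  by (simp add: tensor_lift_sum subspace_carrier carrier_tensor_algebra)

lemma lift_tensor_of:
  "bilinear_on (carrier A) (carrier A) f \<Longrightarrow> x \<in> carrier A \<Longrightarrow> y \<in> carrier A \<Longrightarrow> lift f (x \<otimes>\<^sub>t y) = f x y"
  by (simp add: tensor_lift_tensor_of subspace_carrier)

text \<open>Left multiplication by \<open>x \<otimes> 1\<close>, and below by \<open>1 \<otimes> y\<close>\<close>

abbreviation leg1 :: "'a \<Rightarrow> ('a, 'a) tensor \<Rightarrow> ('a, 'a) tensor" where
  "leg1 x \<equiv> fst (tensor_one A A x)"

abbreviation leg2 :: "'a \<Rightarrow> ('a, 'a) tensor \<Rightarrow> ('a, 'a) tensor" where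
  "leg2 y \<equiv> fst (one_tensor A A y)"

lemma fst_embed: "y \<in> carrier A \<Longrightarrow> fst (embed A x) y = x \<cdot> y"
  by (simp add: embed_def)

lemma fst_one: "y \<in> carrier A \<Longrightarrow> fst \<one>\<^bsub>multipliers A\<^esub> y = y"
  by (simp add: one_multipliers)

lemma leg1_sum:
  "x \<in> carrier A \<Longrightarrow> (\<And>i. i \<in> I \<Longrightarrow> u i \<in> carrier A) \<Longrightarrow> (\<And>i. i \<in> I \<Longrightarrow> v i \<in> carrier A) \<Longrightarrow>
    leg1 x (\<Sum>i\<in>I. u i \<otimes>\<^sub>t v i) = (\<Sum>i\<in>I. (x \<cdot> u i) \<otimes>\<^sub>t v i)"
  by (simp add: tensor_one_def tensor_multiplier_sum(1) embed_linear_pairs one_linear_pairs subspace_carrier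
      fst_embed fst_one)

lemma leg2_sum:
  "y \<in> carrier A \<Longrightarrow> (\<And>i. i \<in> I \<Longrightarrow> u i \<in> carrier A) \<Longrightarrow> (\<And>i. i \<in> I \<Longrightarrow> v i \<in> carrier A) \<Longrightarrow>
    leg2 y (\<Sum>i\<in>I. u i \<otimes>\<^sub>t v i) = (\<Sum>i\<in>I. u i \<otimes>\<^sub>t (y \<cdot> v i))"
  by (simp add: one_tensor_def tensor_multiplier_sum(1) embed_linear_pairs one_linear_pairs subspace_carrier
      fst_embed fst_one)

lemma leg1_tensor_of:
  "x \<in> carrier A \<Longrightarrow> u \<in> carrier A \<Longrightarrow> v \<in> carrier A \<Longrightarrow> leg1 x (u \<otimes>\<^sub>t v) = (x \<cdot> u) \<otimes>\<^sub>t v"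
  using leg1_sum[of x "{()}" "\<lambda>_. u" "\<lambda>_. v"] by simp

lemma leg2_tensor_of:
  "y \<in> carrier A \<Longrightarrow> u \<in> carrier A \<Longrightarrow> v \<in> carrier A \<Longrightarrow> leg2 y (u \<otimes>\<^sub>t v) = u \<otimes>\<^sub>t (y \<cdot> v)"
  using leg2_sum[of y "{()}" "\<lambda>_. u" "\<lambda>_. v"] by simp

lemma legs_closed:
  "x \<in> carrier A \<Longrightarrow> s \<in> carrier (A \<otimes>\<^sub>A A) \<Longrightarrow> leg1 x s \<in> carrier (A \<otimes>\<^sub>A A)"
  "x \<in> carrier A \<Longrightarrow> s \<in> carrier (A \<otimes>\<^sub>A A) \<Longrightarrow> leg2 x s \<in> carrier (A \<otimes>\<^sub>A A)"
  and legs_mult: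
  "x \<in> carrier A \<Longrightarrow> s \<in> carrier (A \<otimes>\<^sub>A A) \<Longrightarrow> t \<in> carrier (A \<otimes>\<^sub>A A) \<Longrightarrow>
    leg1 x (s \<cdot>\<^bsub>A \<otimes>\<^sub>A A\<^esub> t) = leg1 x s \<cdot>\<^bsub>A \<otimes>\<^sub>A A\<^esub> t"
  "x \<in> carrier A \<Longrightarrow> s \<in> carrier (A \<otimes>\<^sub>A A) \<Longrightarrow> t \<in> carrier (A \<otimes>\<^sub>A A) \<Longrightarrow>
    leg2 x (s \<cdot>\<^bsub>A \<otimes>\<^sub>A A\<^esub> t) = leg2 x s \<cdot>\<^bsub>A \<otimes>\<^sub>A A\<^esub> t"
  unfolding tensor_one_def one_tensor_def
  by (auto intro!: tensor_multiplier_left_mult bilinear_multiplications_axioms embed_linear_pairs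
      one_linear_pairs subspace_carrier simp: alg_mult_closed fst_embed fst_one alg_mult_assoc)

lemma tensor_mult_eq_legs:
  assumes "x \<in> carrier A" "y \<in> carrier A" "s \<in> carrier (A \<otimes>\<^sub>A A)"
  shows "x \<otimes>\<^sub>t y \<cdot>\<^bsub>A \<otimes>\<^sub>A A\<^esub> s = leg1 x (leg2 y s)" "x \<otimes>\<^sub>t y \<cdot>\<^bsub>A \<otimes>\<^sub>A A\<^esub> s = leg2 y (leg1 x s)"
proof -
  obtain I u v where I: "decomposes I u v s" by (rule ex_decomposes[OF assms(3)])
  have "x \<otimes>\<^sub>t y \<cdot>\<^bsub>A \<otimes>\<^sub>A A\<^esub> s = (\<Sum>i\<in>I. (x \<cdot> u i) \<otimes>\<^sub>t (y \<cdot> v i))"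
    using tensor_mult_sums[of "{()}" "\<lambda>_. x" "\<lambda>_. y" I u v] assms decomposesD[OF I] by simp
  then show "x \<otimes>\<^sub>t y \<cdot>\<^bsub>A \<otimes>\<^sub>A A\<^esub> s = leg1 x (leg2 y s)" "x \<otimes>\<^sub>t y \<cdot>\<^bsub>A \<otimes>\<^sub>A A\<^esub> s = leg2 y (leg1 x s)"
    using assms decomposesD(1,2)[OF I] unfolding decomposesD(3)[OF I]
    by (simp_all add: leg1_sum leg2_sum alg_mult_closed)
qed

lemma right_legs_sum:
  assumes "decomposes I u v t" "y \<in> carrier A"
  shows "(\<Sum>i\<in>I. u i \<otimes>\<^sub>t (v i \<cdot> y)) \<in> carrier (A \<otimes>\<^sub>A A)" "(\<Sum>i\<in>I. (u i \<cdot> y) \<otimes>\<^sub>t v i) \<in> carrier (A \<otimes>\<^sub>A A)"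
  using decomposesD[OF assms(1)] assms(2)
  by (auto intro!: tensor_sum_closed tensor_of_closed alg_mult_closed)

text \<open>The sums are \<open>t(1 \<otimes> y)\<close> and \<open>t(y \<otimes> 1)\<close>. Identities between such elements are proved by multiplying
them by an arbitrary \<open>s\<close>, which turns right multiplication into left multiplication of \<open>s\<close>.\<close>

lemma right_legs_mult:
  assumes I: "decomposes I u v t" and y: "y \<in> carrier A" and s: "s \<in> carrier (A \<otimes>\<^sub>A A)"
  shows "(\<Sum>i\<in>I. u i \<otimes>\<^sub>t (v i \<cdot> y)) \<cdot>\<^bsub>A \<otimes>\<^sub>A A\<^esub> s = t \<cdot>\<^bsub>A \<otimes>\<^sub>A A\<^esub> leg2 y s"
    "(\<Sum>i\<in>I. (u i \<cdot> y) \<otimes>\<^sub>t v i) \<cdot>\<^bsub>A \<otimes>\<^sub>A A\<^esub> s = t \<cdot>\<^bsub>A \<otimes>\<^sub>A A\<^esub> leg1 y s"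
proof -
  obtain J p q where J: "decomposes J p q s" by (rule ex_decomposes[OF s])
  show "(\<Sum>i\<in>I. u i \<otimes>\<^sub>t (v i \<cdot> y)) \<cdot>\<^bsub>A \<otimes>\<^sub>A A\<^esub> s = t \<cdot>\<^bsub>A \<otimes>\<^sub>A A\<^esub> leg2 y s"
    "(\<Sum>i\<in>I. (u i \<cdot> y) \<otimes>\<^sub>t v i) \<cdot>\<^bsub>A \<otimes>\<^sub>A A\<^esub> s = t \<cdot>\<^bsub>A \<otimes>\<^sub>A A\<^esub> leg1 y s"
    using decomposesD(1,2)[OF I] decomposesD(1,2)[OF J] y
    unfolding decomposesD(3)[OF I] decomposesD(3)[OF J]
    by (simp_all add: leg1_sum leg2_sum tensor_mult_sums alg_mult_closed alg_mult_assoc)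
qed

end

lemma (in nondegenerate_algebra) leg1_cancel:
  assumes "s \<in> carrier (A \<otimes>\<^sub>A A)" "t \<in> carrier (A \<otimes>\<^sub>A A)" "\<And>x. x \<in> carrier A \<Longrightarrow> leg1 x s = leg1 x t"
  shows "s = t"
proof -
  interpret AA: nondegenerate_algebra "A \<otimes>\<^sub>A A"
    using nondegenerate_tensor_algebra nondegenerate_algebra_axioms by blast
  have "x \<cdot>\<^bsub>A \<otimes>\<^sub>A A\<^esub> s = x \<cdot>\<^bsub>A \<otimes>\<^sub>A A\<^esub> t" if x: "x \<in> carrier (A \<otimes>\<^sub>A A)" for x
  proof -
    obtain I u v where I: "decomposes I u v x" by (rule ex_decomposes[OF x])
    have "u i \<otimes>\<^sub>t v i \<cdot>\<^bsub>A \<otimes>\<^sub>A A\<^esub> s = u i \<otimes>\<^sub>t v i \<cdot>\<^bsub>A \<otimes>\<^sub>A A\<^esub> t" if "i \<in> I" for i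
      using that assms decomposesD(1,2)[OF I] by (simp add: tensor_mult_eq_legs(2))
    then show ?thesis
      using decomposesD(1,2)[OF I] assms(1,2) unfolding decomposesD(3)[OF I]
      by (simp add: AA.mult_sum_left tensor_of_closed)
  qed
  then show ?thesis by (rule AA.mult_left_cancel[OF assms(1,2)])
qed

section \<open>The coproduct in terms of tensors\<close>

sublocale regular_multiplier_hopf_algebra \<subseteq> AA: nondegenerate_algebra "A \<otimes>\<^sub>A A"
  using nondegenerate_tensor_algebra nondegenerate_algebra_axioms by blast

context regular_multiplier_hopf_algebra
begin

text \<open>The tensors \<open>\<Delta>(a)(1 \<otimes> y)\<close>, \<open>(x \<otimes> 1)\<Delta>(a)\<close> and \<open>\<Delta>(a)(x \<otimes> 1)\<close>\<close>

definition cop_right :: "'a \<Rightarrow> 'a \<Rightarrow> ('a, 'a) tensor" where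
  "cop_right a y = element (A \<otimes>\<^sub>A A) (coproduct_one_tensor A \<Delta> a y)"

definition left_cop :: "'a \<Rightarrow> 'a \<Rightarrow> ('a, 'a) tensor" where
  "left_cop x a = element (A \<otimes>\<^sub>A A) (tensor_one_coproduct A \<Delta> x a)"

definition cop_left :: "'a \<Rightarrow> 'a \<Rightarrow> ('a, 'a) tensor" where
  "cop_left a x = element (A \<otimes>\<^sub>A A) (coproduct_tensor_one A \<Delta> a x)"

lemma cop_closed:
  assumes "a \<in> carrier A" "x \<in> carrier A"
  shows "cop_right a x \<in> carrier (A \<otimes>\<^sub>A A)" "left_cop x a \<in> carrier (A \<otimes>\<^sub>A A)"
    "cop_left a x \<in> carrier (A \<otimes>\<^sub>A A)"
  unfolding cop_right_def left_cop_def cop_left_def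
  using assms by (simp_all add: element_in_carrier coproduct_one_tensor_in tensor_one_coproduct_in
      coproduct_tensor_one_in)

lemma cop_mult:
  assumes "a \<in> carrier A" "x \<in> carrier A" "s \<in> carrier (A \<otimes>\<^sub>A A)"
  shows "cop_right a x \<cdot>\<^bsub>A \<otimes>\<^sub>A A\<^esub> s = fst (\<Delta> a) (leg2 x s)"
    "left_cop x a \<cdot>\<^bsub>A \<otimes>\<^sub>A A\<^esub> s = leg1 x (fst (\<Delta> a) s)"
    "cop_left a x \<cdot>\<^bsub>A \<otimes>\<^sub>A A\<^esub> s = fst (\<Delta> a) (leg1 x s)"
  unfolding cop_right_def left_cop_def cop_left_def
  using assms
  by (simp_all add: element_mult coproduct_one_tensor_in tensor_one_coproduct_in coproduct_tensor_one_in)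
    (simp_all add: coproduct_one_tensor_def tensor_one_coproduct_def coproduct_tensor_one_def
      mult_multipliers)

lemmas Delta_multiplier = multiplierD[OF coproduct_closed]

lemma Delta_linear:
  "a \<in> carrier A \<Longrightarrow> a' \<in> carrier A \<Longrightarrow> fst (\<Delta> (a + a')) s = fst (\<Delta> a) s + fst (\<Delta> a') s"
  "a \<in> carrier A \<Longrightarrow> fst (\<Delta> (c *\<^sub>C a)) s = c *\<^sub>C fst (\<Delta> a) s"
  by (simp_all add: linear_onD[OF coproduct_linear] fst_scaleC scaleC_fun_apply)

lemma legs_linear:
  assumes "s \<in> carrier (A \<otimes>\<^sub>A A)" "x \<in> carrier A" "x' \<in> carrier A"
  shows "leg1 (x + x') s = leg1 x s + leg1 x' s" "leg1 (c *\<^sub>C x) s = c *\<^sub>C leg1 x s"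
    "leg2 (x + x') s = leg2 x s + leg2 x' s" "leg2 (c *\<^sub>C x) s = c *\<^sub>C leg2 x s"
proof -
  obtain I u v where I: "decomposes I u v s" by (rule ex_decomposes[OF assms(1)])
  show "leg1 (x + x') s = leg1 x s + leg1 x' s" "leg1 (c *\<^sub>C x) s = c *\<^sub>C leg1 x s"
    "leg2 (x + x') s = leg2 x s + leg2 x' s" "leg2 (c *\<^sub>C x) s = c *\<^sub>C leg2 x s"
    using decomposesD(1,2)[OF I] assms(2,3) unfolding decomposesD(3)[OF I]
    by (simp_all add: leg1_sum leg2_sum carrier_closed mult_linear tensor_of_linear sum.distrib
        cvec.scale_sum_right)
qed

lemma linear_on_leg: "x \<in> carrier A \<Longrightarrow> linear_on (carrier (A \<otimes>\<^sub>A A)) (leg1 x)"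
    "x \<in> carrier A \<Longrightarrow> linear_on (carrier (A \<otimes>\<^sub>A A)) (leg2 x)"
  using tensor_multiplier_linear[OF subspace_carrier subspace_carrier, of "embed A x" "\<one>\<^bsub>multipliers A\<^esub>"]
    tensor_multiplier_linear[OF subspace_carrier subspace_carrier, of "\<one>\<^bsub>multipliers A\<^esub>" "embed A x"]
  by (simp_all add: tensor_one_def one_tensor_def linear_pairs_def[of "A \<otimes>\<^sub>A A"] embed_linear_pairs
      one_linear_pairs subspace_carrier)

lemma bilinear_cop_right: "bilinear_on (carrier A) (carrier A) cop_right"
  by (rule bilinear_onI; rule AA.mult_right_cancel)
    (simp_all add: cop_closed carrier_closed AA.carrier_closed AA.mult_linear cop_mult Delta_linear legs_linear
      legs_closed linear_onD[OF Delta_multiplier(1)])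

lemma bilinear_left_cop: "bilinear_on (carrier A) (carrier A) left_cop"
  by (rule bilinear_onI; rule AA.mult_right_cancel)
    (simp_all add: cop_closed carrier_closed AA.carrier_closed AA.mult_linear cop_mult Delta_linear legs_linear
      legs_closed linear_onD[OF linear_on_leg(1)] Delta_multiplier(3))

lemma left_cop_linear:
  "x \<in> carrier A \<Longrightarrow> linear_on (carrier A) (left_cop x)"
  using bilinear_left_cop by (simp add: bilinear_on_def)

text \<open>Both sides are \<open>(x \<otimes> 1)\<Delta>(a)(1 \<otimes> y)\<close>.\<close>

lemma leg1_cop_right:
  assumes I: "decomposes I u v (left_cop x a)" and "x \<in> carrier A" "a \<in> carrier A" "y \<in> carrier A"
  shows "leg1 x (cop_right a y) = (\<Sum>i\<in>I. u i \<otimes>\<^sub>t (v i \<cdot> y))"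
  by (rule AA.mult_right_cancel)
    (use assms in \<open>simp_all add: right_legs_sum[OF I] right_legs_mult[OF I] legs_closed cop_closed cop_mult
      flip: legs_mult\<close>)

lemma cop_right_mult:
  assumes I: "decomposes I u v (cop_right a y)" and "a \<in> carrier A" "y \<in> carrier A" "z \<in> carrier A"
  shows "cop_right a (y \<cdot> z) = (\<Sum>i\<in>I. u i \<otimes>\<^sub>t (v i \<cdot> z))"
proof (rule AA.mult_right_cancel)
  fix s assume s: "s \<in> carrier (A \<otimes>\<^sub>A A)"
  obtain J p q where J: "decomposes J p q s" by (rule ex_decomposes[OF s])
  have "leg2 (y \<cdot> z) s = leg2 y (leg2 z s)"
    using decomposesD(1,2)[OF J] assms(2-) unfolding decomposesD(3)[OF J]
    by (simp add: leg2_sum alg_mult_closed alg_mult_assoc)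
  then show "cop_right a (y \<cdot> z) \<cdot>\<^bsub>A \<otimes>\<^sub>A A\<^esub> s = (\<Sum>i\<in>I. u i \<otimes>\<^sub>t (v i \<cdot> z)) \<cdot>\<^bsub>A \<otimes>\<^sub>A A\<^esub> s"
    using assms s by (simp add: right_legs_mult[OF I] cop_mult alg_mult_closed legs_closed)
qed (use assms in \<open>simp_all add: cop_closed alg_mult_closed right_legs_sum[OF I]\<close>)

text \<open>\<open>\<Delta>(a)(x \<otimes> y)\<close> is computed from either one-sided product by multiplying the remaining leg.\<close>

lemma fst_Delta_tensor_of:
  assumes "a \<in> carrier A" "x \<in> carrier A" "y \<in> carrier A"
  shows "decomposes I u v (cop_right a y) \<Longrightarrow> fst (\<Delta> a) (x \<otimes>\<^sub>t y) = (\<Sum>i\<in>I. (u i \<cdot> x) \<otimes>\<^sub>t v i)"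
    and "decomposes I u v (cop_left a x) \<Longrightarrow> fst (\<Delta> a) (x \<otimes>\<^sub>t y) = (\<Sum>i\<in>I. u i \<otimes>\<^sub>t (v i \<cdot> y))"
  by (rule AA.mult_right_cancel;
      use assms in \<open>simp add: right_legs_sum right_legs_mult cop_closed cop_mult legs_closed Delta_multiplier(3)
        tensor_of_closed tensor_mult_eq_legs(1) flip: Delta_multiplier(7)\<close>;
      use assms in \<open>simp add: flip: tensor_mult_eq_legs\<close>)+

lemma fst_Delta_cop_left:
  assumes "a \<in> carrier A" "a' \<in> carrier A" "x \<in> carrier A"
  shows "fst (\<Delta> a) (cop_left a' x) = cop_left (a \<cdot> a') x"
  by (rule AA.mult_right_cancel)
    (use assms in \<open>simp_all add: cop_closed alg_mult_closed Delta_multiplier(3) cop_mult legs_closed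
      coproduct_alg_mult mult_multipliers flip: Delta_multiplier(7)\<close>)

lemma cop_right_surj:
  assumes "t \<in> carrier (A \<otimes>\<^sub>A A)"
  obtains I :: "nat set" and p q where "\<And>i. i \<in> I \<Longrightarrow> p i \<in> carrier A" "\<And>i. i \<in> I \<Longrightarrow> q i \<in> carrier A"
    "t = (\<Sum>i\<in>I. cop_right (p i) (q i))"
proof -
  have "lift cop_right ` carrier (A \<otimes>\<^sub>A A) = carrier (A \<otimes>\<^sub>A A)"
    using galois unfolding galois_bijective_def by (simp add: bij_betw_def flip: cop_right_def)
  then obtain s where s: "s \<in> carrier (A \<otimes>\<^sub>A A)" "t = lift cop_right s" using assms by blast
  obtain I u v where I: "decomposes I u v s" by (rule ex_decomposes[OF s(1)])
  show thesis
    by (rule that[OF decomposesD(1,2)[OF I]]) (use s lift_decomposes[OF I bilinear_cop_right] in auto)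
qed

lemma tensor_one_linear_pairs:
  "x \<in> carrier A \<Longrightarrow> tensor_one A A x \<in> linear_pairs (A \<otimes>\<^sub>A A)"
  "x \<in> carrier A \<Longrightarrow> one_tensor A A x \<in> linear_pairs (A \<otimes>\<^sub>A A)"
  by (simp_all add: tensor_one_def one_tensor_def tensor_multiplier_linear embed_linear_pairs
      one_linear_pairs subspace_carrier)

lemma bilinear_coproduct_id:
  "bilinear_on (carrier A) (carrier A) (\<lambda>x y. tensor_multiplier (A \<otimes>\<^sub>A A) A (\<Delta> x) (embed A y))"
  "bilinear_on (carrier A) (carrier A) (\<lambda>x y. tensor_multiplier A (A \<otimes>\<^sub>A A) (embed A x) (\<Delta> y))"
  by (intro bilinear_on_tensor_multiplier subspace_carrier AA.subspace_carrier coproduct_linear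
      linear_on_embed embed_linear_pairs multiplier_linear_pairs coproduct_closed; assumption)+

text \<open>Coassociativity as an identity of tensors: the two multipliers in the axiom are applied to
\<open>\<alpha> \<otimes> (\<beta> \<otimes> \<gamma>)\<close>, on which all the products that occur in them are elements.\<close>

lemma coassociative_decomposed:
  assumes xyc: "x \<in> carrier A" "y \<in> carrier A" "c \<in> carrier A"
    and abg: "\<alpha> \<in> carrier A" "\<beta> \<in> carrier A" "\<gamma> \<in> carrier A"
    and I: "decomposes I u v (left_cop x c)" and K: "decomposes K p q (cop_right c y)"
  shows "(\<Sum>k\<in>K. tensor_assoc ((left_cop x (p k) \<cdot>\<^bsub>A \<otimes>\<^sub>A A\<^esub> (\<alpha> \<otimes>\<^sub>t \<beta>)) \<otimes>\<^sub>t (q k \<cdot> \<gamma>))) =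
    (\<Sum>i\<in>I. (u i \<cdot> \<alpha>) \<otimes>\<^sub>t (cop_right (v i) y \<cdot>\<^bsub>A \<otimes>\<^sub>A A\<^esub> (\<beta> \<otimes>\<^sub>t \<gamma>)))"
proof -
  let ?X = "(A \<otimes>\<^sub>A A) \<otimes>\<^sub>A A" and ?Y = "A \<otimes>\<^sub>A A \<otimes>\<^sub>A A"
  let ?T = "(\<alpha> \<otimes>\<^sub>t \<beta>) \<otimes>\<^sub>t \<gamma>" and ?T' = "\<alpha> \<otimes>\<^sub>t (\<beta> \<otimes>\<^sub>t \<gamma>)"
  note sub = subspace_carrier AA.subspace_carrier
  have T: "?T \<in> carrier ?X" "?T' \<in> carrier ?Y"
    using abg by (simp_all add: carrier_tensor_algebra tensor_of_in_tensor_set)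
  have pq: "p k \<in> carrier A" "q k \<in> carrier A" if "k \<in> K" for k using decomposesD[OF K] that by auto
  have uv: "u i \<in> carrier A" "v i \<in> carrier A" if "i \<in> I" for i using decomposesD[OF I] that by auto
  have "fst (coproduct_id A \<Delta> (cop_right c y)) ?T =
      (\<Sum>k\<in>K. fst (tensor_multiplier (A \<otimes>\<^sub>A A) A (\<Delta> (p k)) (embed A (q k))) ?T)"
    unfolding coproduct_id_def lift_decomposes[OF K bilinear_coproduct_id(1)]
    by (simp add: fst_sum sum_fun_apply)
  also have "\<dots> = (\<Sum>k\<in>K. fst (\<Delta> (p k)) (\<alpha> \<otimes>\<^sub>t \<beta>) \<otimes>\<^sub>t (q k \<cdot> \<gamma>))"
    using pq abg by (intro sum.cong refl) (simp add: tensor_multiplier_tensor_of sub fst_embed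
        tensor_of_closed multiplier_linear_pairs coproduct_closed embed_linear_pairs)
  finally have "fst (tensor_multiplier (A \<otimes>\<^sub>A A) A (tensor_one A A x) \<one>\<^bsub>multipliers A\<^esub>
        \<otimes>\<^bsub>multipliers ?X\<^esub> coproduct_id A \<Delta> (cop_right c y)) ?T =
      fst (tensor_multiplier (A \<otimes>\<^sub>A A) A (tensor_one A A x) \<one>\<^bsub>multipliers A\<^esub>)
        (\<Sum>k\<in>K. fst (\<Delta> (p k)) (\<alpha> \<otimes>\<^sub>t \<beta>) \<otimes>\<^sub>t (q k \<cdot> \<gamma>))"
    by (simp add: mult_multipliers)
  also have "\<dots> = (\<Sum>k\<in>K. (left_cop x (p k) \<cdot>\<^bsub>A \<otimes>\<^sub>A A\<^esub> (\<alpha> \<otimes>\<^sub>t \<beta>)) \<otimes>\<^sub>t (q k \<cdot> \<gamma>))"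
    using pq abg xyc by (subst tensor_multiplier_sum)
      (simp_all add: sub tensor_one_linear_pairs one_linear_pairs Delta_multiplier(3) tensor_of_closed
        alg_mult_closed fst_one cop_mult)
  finally have "fst (transport ?X ?Y tensor_assoc
      (tensor_multiplier (A \<otimes>\<^sub>A A) A (tensor_one A A x) \<one>\<^bsub>multipliers A\<^esub>
        \<otimes>\<^bsub>multipliers ?X\<^esub> coproduct_id A \<Delta> (cop_right c y))) ?T' =
      tensor_assoc (\<Sum>k\<in>K. (left_cop x (p k) \<cdot>\<^bsub>A \<otimes>\<^sub>A A\<^esub> (\<alpha> \<otimes>\<^sub>t \<beta>)) \<otimes>\<^sub>t (q k \<cdot> \<gamma>))"
    using T by (simp add: transport_def inv_tensor_assoc)
  also have "\<dots> = (\<Sum>k\<in>K. tensor_assoc ((left_cop x (p k) \<cdot>\<^bsub>A \<otimes>\<^sub>A A\<^esub> (\<alpha> \<otimes>\<^sub>t \<beta>)) \<otimes>\<^sub>t (q k \<cdot> \<gamma>)))"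
    by (rule linear_on_sum[OF linear_on_tensor_assoc]) simp_all
  finally have lhs: "fst (transport ?X ?Y tensor_assoc
      (tensor_multiplier (A \<otimes>\<^sub>A A) A (tensor_one A A x) \<one>\<^bsub>multipliers A\<^esub>
        \<otimes>\<^bsub>multipliers ?X\<^esub> coproduct_id A \<Delta> (cop_right c y))) ?T' =
      (\<Sum>k\<in>K. tensor_assoc ((left_cop x (p k) \<cdot>\<^bsub>A \<otimes>\<^sub>A A\<^esub> (\<alpha> \<otimes>\<^sub>t \<beta>)) \<otimes>\<^sub>t (q k \<cdot> \<gamma>)))" .
  have "fst (tensor_multiplier A (A \<otimes>\<^sub>A A) \<one>\<^bsub>multipliers A\<^esub> (one_tensor A A y)) ?T' = \<alpha> \<otimes>\<^sub>t (\<beta> \<otimes>\<^sub>t (y \<cdot> \<gamma>))"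
    using abg xyc by (simp add: tensor_multiplier_tensor_of sub tensor_one_linear_pairs one_linear_pairs
        tensor_of_closed fst_one leg2_tensor_of)
  then have "fst (id_coproduct A \<Delta> (left_cop x c) \<otimes>\<^bsub>multipliers ?Y\<^esub>
        tensor_multiplier A (A \<otimes>\<^sub>A A) \<one>\<^bsub>multipliers A\<^esub> (one_tensor A A y)) ?T' =
      (\<Sum>i\<in>I. fst (tensor_multiplier A (A \<otimes>\<^sub>A A) (embed A (u i)) (\<Delta> (v i))) (\<alpha> \<otimes>\<^sub>t (\<beta> \<otimes>\<^sub>t (y \<cdot> \<gamma>))))"
    unfolding id_coproduct_def lift_decomposes[OF I bilinear_coproduct_id(2)]
    by (simp add: fst_sum sum_fun_apply mult_multipliers)
  also have "\<dots> = (\<Sum>i\<in>I. (u i \<cdot> \<alpha>) \<otimes>\<^sub>t (cop_right (v i) y \<cdot>\<^bsub>A \<otimes>\<^sub>A A\<^esub> (\<beta> \<otimes>\<^sub>t \<gamma>)))"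
    using uv abg xyc by (intro sum.cong refl) (simp add: tensor_multiplier_tensor_of sub fst_embed
        tensor_of_closed multiplier_linear_pairs coproduct_closed embed_linear_pairs alg_mult_closed
        cop_mult leg2_tensor_of)
  finally show ?thesis
    using coassociative[OF xyc, folded cop_right_def left_cop_def] lhs by simp
qed

end

section \<open>Slices of the coproduct by the left integral\<close>

locale hopf_algebra_with_left_integral = regular_multiplier_hopf_algebra A \<Delta>
  for A :: "'a::complex_vector algebra" (structure) and \<Delta> :: "'a coproduct" +
  fixes \<phi> \<epsilon> :: "'a \<Rightarrow> complex" and S :: "'a \<Rightarrow> 'a"
  assumes left_integral: "left_integral A \<Delta> \<phi>"
    and counit: "is_counit A \<Delta> \<epsilon>"
    and antipode: "is_antipode A \<Delta> \<epsilon> S"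
begin

lemma integral_linear: "linear_on (carrier A) \<phi>"
  and ex_integral_nonzero: "\<exists>e\<in>carrier A. \<phi> e \<noteq> 0"
  using left_integral by (auto simp: left_integral_def)

lemma counit_linear: "linear_on (carrier A) \<epsilon>"
  using counit by (simp add: is_counit_def)

lemma counit_left: "a \<in> carrier A \<Longrightarrow> y \<in> carrier A \<Longrightarrow> lift (\<lambda>u v. \<epsilon> u *\<^sub>C v) (cop_right a y) = a \<cdot> y"
  using counit by (simp add: is_counit_def cop_right_def)

lemma antipode_linear: "linear_on (carrier A) S"
  and antipode_bij: "bij_betw S (carrier A) (carrier A)"
  and antipode_mult: "a \<in> carrier A \<Longrightarrow> a' \<in> carrier A \<Longrightarrow> S (a \<cdot> a') = S a' \<cdot> S a"
  using antipode by (auto simp: is_antipode_def)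

lemma antipode_left: "a \<in> carrier A \<Longrightarrow> y \<in> carrier A \<Longrightarrow> lift (\<lambda>u v. S u \<cdot> v) (cop_right a y) = \<epsilon> a *\<^sub>C y"
  using antipode by (simp add: is_antipode_def cop_right_def)

lemma antipode_closed: "a \<in> carrier A \<Longrightarrow> S a \<in> carrier A"
  using antipode_bij by (auto simp: bij_betw_def)

lemma bilinear_slice:
  "linear_on (carrier A) f \<Longrightarrow> bilinear_on (carrier A) (carrier A) (\<lambda>u v. f v *\<^sub>C u)"
  "linear_on (carrier A) f \<Longrightarrow> bilinear_on (carrier A) (carrier A) (\<lambda>u v. f u *\<^sub>C v)"
  by (auto intro!: bilinear_onI simp: linear_onD scaleC_add_left scaleC_add_right scaleC_scaleC mult.commute)

lemma bilinear_antipode: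
  "bilinear_on (carrier A) (carrier A) (\<lambda>u v. S u \<cdot> v)" "bilinear_on (carrier A) (carrier A) (\<lambda>u v. u \<cdot> S v)"
  by (auto intro!: bilinear_onI simp: linear_onD[OF antipode_linear] mult_linear antipode_closed)

text \<open>\<open>act c a\<close> is \<open>b \<triangleright> a = (\<iota> \<otimes> b)\<Delta>(a)\<close> for \<open>b = \<phi>(\<cdot> c)\<close>. It is indexed by \<open>c\<close> because \<open>\<Delta>(a)(1 \<otimes> c)\<close> is a tensor while \<open>\<Delta>(a)\<close> is not.\<close>

definition act :: "'a \<Rightarrow> 'a \<Rightarrow> 'a" where
  "act c a = lift (\<lambda>u v. \<phi> v *\<^sub>C u) (cop_right a c)"

lemma lift_closed:
  assumes "bilinear_on (carrier A) (carrier A) f" "t \<in> carrier (A \<otimes>\<^sub>A A)"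
    "\<And>u v. u \<in> carrier A \<Longrightarrow> v \<in> carrier A \<Longrightarrow> f u v \<in> carrier A"
  shows "lift f t \<in> carrier A"
proof -
  obtain I u v where I: "decomposes I u v t" by (rule ex_decomposes[OF assms(2)])
  show ?thesis
    using decomposesD(1,2)[OF I] by (simp add: lift_decomposes[OF I assms(1)] carrier_closed assms(3))
qed

lemma act_closed: "c \<in> carrier A \<Longrightarrow> a \<in> carrier A \<Longrightarrow> act c a \<in> carrier A"
  unfolding act_def by (rule lift_closed) (auto simp: bilinear_slice integral_linear cop_closed carrier_closed)

lemma cop_right_linear:
  "a \<in> carrier A \<Longrightarrow> a' \<in> carrier A \<Longrightarrow> y \<in> carrier A \<Longrightarrow> cop_right (a + a') y = cop_right a y + cop_right a' y"
  "a \<in> carrier A \<Longrightarrow> y \<in> carrier A \<Longrightarrow> y' \<in> carrier A \<Longrightarrow> cop_right a (y + y') = cop_right a y + cop_right a y'"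
  "a \<in> carrier A \<Longrightarrow> y \<in> carrier A \<Longrightarrow> cop_right (c *\<^sub>C a) y = c *\<^sub>C cop_right a y"
  "a \<in> carrier A \<Longrightarrow> y \<in> carrier A \<Longrightarrow> cop_right a (c *\<^sub>C y) = c *\<^sub>C cop_right a y"
  using bilinear_cop_right by (simp_all add: bilinear_on_def linear_on_def)

lemma bilinear_act: "bilinear_on (carrier A) (carrier A) act"
proof -
  note lin = linear_onD[OF linear_on_lift[OF bilinear_slice(1)[OF integral_linear]]]
  show ?thesis
    unfolding act_def
    by (rule bilinear_onI) (simp_all add: cop_right_linear cop_closed lin)
qed

lemma act_linear:
  "c \<in> carrier A \<Longrightarrow> linear_on (carrier A) (act c)"
  "a \<in> carrier A \<Longrightarrow> linear_on (carrier A) (\<lambda>c. act c a)"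
  using bilinear_act by (auto simp: bilinear_on_def)

text \<open>Applying \<open>\<epsilon> \<otimes> \<phi>\<close> to \<open>\<Delta>(a)(1 \<otimes> c)\<close> in either order gives the two sides.\<close>

lemma counit_act:
  assumes "a \<in> carrier A" "c \<in> carrier A"
  shows "\<epsilon> (act c a) = \<phi> (a \<cdot> c)"
proof -
  obtain I u v where I: "decomposes I u v (cop_right a c)" using cop_closed(1)[OF assms] by (rule ex_decomposes)
  note uv = decomposesD(1,2)[OF I]
  have "\<epsilon> (act c a) = (\<Sum>i\<in>I. \<phi> (v i) * \<epsilon> (u i))"
    using uv by (simp add: act_def lift_decomposes[OF I] bilinear_slice integral_linear
        linear_on_sum[OF counit_linear subspace_carrier] carrier_closed linear_onD[OF counit_linear])
  also have "\<dots> = \<phi> (\<Sum>i\<in>I. \<epsilon> (u i) *\<^sub>C v i)"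
    using uv by (simp add: linear_on_sum[OF integral_linear subspace_carrier] carrier_closed
        linear_onD[OF integral_linear] mult.commute)
  also have "\<dots> = \<phi> (a \<cdot> c)"
    using counit_left[OF assms] by (simp add: lift_decomposes[OF I] bilinear_slice counit_linear)
  finally show ?thesis .
qed

text \<open>Applying \<open>\<iota> \<otimes> \<phi>\<close> to \<open>(x \<otimes> 1)\<Delta>(a)(1 \<otimes> c)\<close> gives both sides. It follows that \<open>act c a\<close> depends on \<open>c\<close>
only through the functional \<open>\<phi>(\<cdot> c)\<close>.\<close>

lemma mult_act:
  assumes I: "decomposes I u v (left_cop x a)" and "x \<in> carrier A" "a \<in> carrier A" "c \<in> carrier A"
  shows "x \<cdot> act c a = (\<Sum>i\<in>I. \<phi> (v i \<cdot> c) *\<^sub>C u i)"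
proof -
  obtain J p q where J: "decomposes J p q (cop_right a c)"
    using cop_closed(1)[OF assms(3,4)] by (rule ex_decomposes)
  note pq = decomposesD(1,2)[OF J] and uv = decomposesD(1,2)[OF I]
  note slice = bilinear_slice(1)[OF integral_linear]
  have "x \<cdot> act c a = (\<Sum>j\<in>J. \<phi> (q j) *\<^sub>C (x \<cdot> p j))"
    using pq assms by (simp add: act_def lift_decomposes[OF J slice] mult_sum_right carrier_closed mult_linear)
  also have "\<dots> = lift (\<lambda>u v. \<phi> v *\<^sub>C u) (leg1 x (cop_right a c))"
    using pq assms unfolding decomposesD(3)[OF J]
    by (simp add: leg1_sum lift_sum slice tensor_of_closed alg_mult_closed lift_tensor_of)
  also have "\<dots> = (\<Sum>i\<in>I. \<phi> (v i \<cdot> c) *\<^sub>C u i)"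
    using uv assms unfolding leg1_cop_right[OF assms]
    by (simp add: lift_sum slice tensor_of_closed alg_mult_closed lift_tensor_of)
  finally show ?thesis .
qed

text \<open>The tensors \<open>\<Delta>(p)(1 \<otimes> q)\<close> span \<open>A \<otimes> A\<close>; slicing \<open>a \<otimes> e\<close> with \<open>\<phi>(e) = 1\<close> gives \<open>a\<close>.\<close>

lemma act_span:
  assumes "a \<in> carrier A"
  obtains I :: "nat set" and p q where "\<And>i. i \<in> I \<Longrightarrow> p i \<in> carrier A" "\<And>i. i \<in> I \<Longrightarrow> q i \<in> carrier A"
    "a = (\<Sum>i\<in>I. act (q i) (p i))"
proof -
  obtain e where e: "e \<in> carrier A" "\<phi> e \<noteq> 0" using ex_integral_nonzero by blast
  have "a \<otimes>\<^sub>t ((1 / \<phi> e) *\<^sub>C e) \<in> carrier (A \<otimes>\<^sub>A A)"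
    using assms e by (simp add: tensor_of_closed carrier_closed)
  then obtain I :: "nat set" and p q where I: "\<And>i. i \<in> I \<Longrightarrow> p i \<in> carrier A" "\<And>i. i \<in> I \<Longrightarrow> q i \<in> carrier A"
    "a \<otimes>\<^sub>t ((1 / \<phi> e) *\<^sub>C e) = (\<Sum>i\<in>I. cop_right (p i) (q i))"
    by (rule cop_right_surj) (rule that; assumption)
  note slice = bilinear_slice(1)[OF integral_linear]
  have "a = lift (\<lambda>u v. \<phi> v *\<^sub>C u) (a \<otimes>\<^sub>t ((1 / \<phi> e) *\<^sub>C e))"
    using assms e by (simp add: lift_tensor_of slice carrier_closed linear_onD[OF integral_linear] scaleC_one)
  also have "\<dots> = (\<Sum>i\<in>I. act (q i) (p i))"
    unfolding I(3) using I(1,2) by (simp add: lift_sum slice cop_closed act_def)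
  finally show thesis using that I(1,2) by blast
qed

text \<open>The same argument with the slice \<open>\<epsilon> \<otimes> \<iota>\<close>, which sends \<open>\<Delta>(p)(1 \<otimes> q)\<close> to \<open>p q\<close>. If \<open>\<epsilon> = 0\<close>, then all
products vanish and \<open>A = 0\<close> by non-degeneracy.\<close>

lemma mult_span:
  assumes "a \<in> carrier A"
  obtains I :: "nat set" and p q where "\<And>i. i \<in> I \<Longrightarrow> p i \<in> carrier A" "\<And>i. i \<in> I \<Longrightarrow> q i \<in> carrier A"
    "a = (\<Sum>i\<in>I. p i \<cdot> q i)"
proof (cases "\<exists>e\<in>carrier A. \<epsilon> e \<noteq> 0")
  case True
  then obtain e where e: "e \<in> carrier A" "\<epsilon> e \<noteq> 0" by blast
  have "((1 / \<epsilon> e) *\<^sub>C e) \<otimes>\<^sub>t a \<in> carrier (A \<otimes>\<^sub>A A)"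
    using assms e by (simp add: tensor_of_closed carrier_closed)
  then obtain I :: "nat set" and p q where I: "\<And>i. i \<in> I \<Longrightarrow> p i \<in> carrier A" "\<And>i. i \<in> I \<Longrightarrow> q i \<in> carrier A"
    "((1 / \<epsilon> e) *\<^sub>C e) \<otimes>\<^sub>t a = (\<Sum>i\<in>I. cop_right (p i) (q i))"
    by (rule cop_right_surj) (rule that; assumption)
  note slice = bilinear_slice(2)[OF counit_linear]
  have "a = lift (\<lambda>u v. \<epsilon> u *\<^sub>C v) (((1 / \<epsilon> e) *\<^sub>C e) \<otimes>\<^sub>t a)"
    using assms e by (simp add: lift_tensor_of slice carrier_closed linear_onD[OF counit_linear] scaleC_one)
  also have "\<dots> = (\<Sum>i\<in>I. p i \<cdot> q i)"
    unfolding I(3) using I(1,2) by (simp add: lift_sum slice cop_closed counit_left)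
  finally show thesis using that I(1,2) by blast
next
  case False
  have "x \<cdot> y = 0" if xy: "x \<in> carrier A" "y \<in> carrier A" for x y
  proof -
    obtain I u v where I: "decomposes I u v (cop_right x y)" using cop_closed(1)[OF xy] by (rule ex_decomposes)
    have "x \<cdot> y = (\<Sum>i\<in>I. \<epsilon> (u i) *\<^sub>C v i)"
      using counit_left[OF xy] by (simp add: lift_decomposes[OF I] bilinear_slice counit_linear)
    also have "\<dots> = 0" using False decomposesD(1)[OF I] by (intro sum.neutral) auto
    finally show ?thesis .
  qed
  then have "a = 0" using assms nondegenerate_left by blast
  then show thesis using that[of "{}"] by simp
qed

text \<open>The identity \<open>(x \<otimes> 1)\<Delta>(b \<triangleright> a) = (\<iota> \<otimes> (b \<triangleright> \<cdot>))((x \<otimes> 1)\<Delta>(a))\<close> for \<open>b = \<phi>(\<cdot> c)\<close>: coassociativity with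
\<open>b\<close> applied to the third leg.\<close>

lemma left_cop_act:
  assumes I: "decomposes I u v (left_cop x a)" and xa: "x \<in> carrier A" "a \<in> carrier A" and c: "c \<in> carrier A"
  shows "left_cop x (act c a) = (\<Sum>i\<in>I. u i \<otimes>\<^sub>t act c (v i))"
proof -
  note uv = decomposesD(1,2)[OF I]
  have closed: "(\<Sum>i\<in>I. u i \<otimes>\<^sub>t act c (v i)) \<in> carrier (A \<otimes>\<^sub>A A)" if "c \<in> carrier A" for c
    using that uv by (intro tensor_sum_closed tensor_of_closed act_closed)
  have product: "left_cop x (act (y \<cdot> \<gamma>) a) = (\<Sum>i\<in>I. u i \<otimes>\<^sub>t act (y \<cdot> \<gamma>) (v i))"
    if y: "y \<in> carrier A" "\<gamma> \<in> carrier A" for y \<gamma>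
  proof (rule AA.mult_right_cancel)
    \<comment> \<open>Coassociativity, applied to \<open>\<alpha> \<otimes> \<beta> \<otimes> \<gamma>\<close>, puts \<open>\<gamma>\<close> to the right of the third leg. This is why the claim is first proved for \<open>c = y \<gamma>\<close>; such products span \<open>A\<close>.\<close>
    obtain K p q where K: "decomposes K p q (cop_right a y)" using cop_closed(1)[OF xa(2) y(1)] by (rule ex_decomposes)
    note pq = decomposesD(1,2)[OF K]
    have act_a: "act (y \<cdot> \<gamma>) a = (\<Sum>k\<in>K. \<phi> (q k \<cdot> \<gamma>) *\<^sub>C p k)"
      using pq y by (simp add: act_def cop_right_mult[OF K xa(2) y] lift_sum bilinear_slice integral_linear
          tensor_of_closed alg_mult_closed lift_tensor_of)
    show "left_cop x (act (y \<cdot> \<gamma>) a) \<in> carrier (A \<otimes>\<^sub>A A)"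
      using xa y by (simp add: cop_closed act_closed alg_mult_closed)
    show "(\<Sum>i\<in>I. u i \<otimes>\<^sub>t act (y \<cdot> \<gamma>) (v i)) \<in> carrier (A \<otimes>\<^sub>A A)"
      using y by (intro closed alg_mult_closed)
    have pure: "left_cop x (act (y \<cdot> \<gamma>) a) \<cdot>\<^bsub>A \<otimes>\<^sub>A A\<^esub> (\<alpha> \<otimes>\<^sub>t \<beta>) =
        (\<Sum>i\<in>I. u i \<otimes>\<^sub>t act (y \<cdot> \<gamma>) (v i)) \<cdot>\<^bsub>A \<otimes>\<^sub>A A\<^esub> (\<alpha> \<otimes>\<^sub>t \<beta>)"
      if ab: "\<alpha> \<in> carrier A" "\<beta> \<in> carrier A" for \<alpha> \<beta>
    proof -
      note slice = bilinear_slice(1)[OF integral_linear]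
      \<comment> \<open>\<open>\<iota> \<otimes> \<iota> \<otimes> \<phi>\<close> on \<open>A \<otimes> (A \<otimes> A)\<close>\<close>
      define slice3 where "slice3 = tensor_lift (carrier A) (carrier (A \<otimes>\<^sub>A A))
        (\<lambda>z r. z \<otimes>\<^sub>t lift (\<lambda>u v. \<phi> v *\<^sub>C u) r)"
      have bil3: "bilinear_on (carrier A) (carrier (A \<otimes>\<^sub>A A)) (\<lambda>z r. z \<otimes>\<^sub>t lift (\<lambda>u v. \<phi> v *\<^sub>C u) r)"
        using linear_onD[OF linear_on_lift[OF slice]] by (auto intro!: bilinear_onI simp: tensor_of_linear)
      note lin3 = linear_on_tensor_lift[OF subspace_carrier AA.subspace_carrier bil3, folded slice3_def]
      note sub3 = subspace_tensor_set[of "carrier A" "carrier (A \<otimes>\<^sub>A A)"]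
      have slice3_tensor: "slice3 (z \<otimes>\<^sub>t r) = z \<otimes>\<^sub>t lift (\<lambda>u v. \<phi> v *\<^sub>C u) r"
        if "z \<in> carrier A" "r \<in> carrier (A \<otimes>\<^sub>A A)" for z r
        using that by (simp add: slice3_def tensor_lift_tensor_of subspace_carrier AA.subspace_carrier bil3)
      have slice3_assoc: "tensor_assoc (s \<otimes>\<^sub>t z) \<in> tensor_set (carrier A) (carrier (A \<otimes>\<^sub>A A)) \<and>
          slice3 (tensor_assoc (s \<otimes>\<^sub>t z)) = \<phi> z *\<^sub>C s"
        if s: "s \<in> carrier (A \<otimes>\<^sub>A A)" and z: "z \<in> carrier A" for s z
      proof -
        obtain J m n where J: "decomposes J m n s" using s by (rule ex_decomposes)
        have "tensor_assoc (s \<otimes>\<^sub>t z) = (\<Sum>j\<in>J. m j \<otimes>\<^sub>t (n j \<otimes>\<^sub>t z))"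
          unfolding decomposesD(3)[OF J] tensor_of_sum_left
          by (simp add: linear_on_sum[OF linear_on_tensor_assoc] tensor_assoc_tensor_of)
        moreover have "m j \<otimes>\<^sub>t (n j \<otimes>\<^sub>t z) \<in> tensor_set (carrier A) (carrier (A \<otimes>\<^sub>A A))" if "j \<in> J" for j
          using that z decomposesD(1,2)[OF J] by (simp add: tensor_of_in_tensor_set tensor_of_closed)
        ultimately show ?thesis
          using z decomposesD(1,2)[OF J] unfolding decomposesD(3)[OF J]
          by (simp add: cvec.subspace_sum[OF sub3] linear_on_sum[OF lin3 sub3] slice3_tensor tensor_of_closed
              lift_tensor_of slice tensor_of_linear cvec.scale_sum_right)
      qed
      have right: "lift (\<lambda>u v. \<phi> v *\<^sub>C u) (cop_right w y \<cdot>\<^bsub>A \<otimes>\<^sub>A A\<^esub> (\<beta> \<otimes>\<^sub>t \<gamma>)) = act (y \<cdot> \<gamma>) w \<cdot> \<beta>"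
        if w: "w \<in> carrier A" for w
      proof -
        obtain J m n where J: "decomposes J m n (cop_right w y)"
          using cop_closed(1)[OF w y(1)] by (rule ex_decomposes)
        note mn = decomposesD(1,2)[OF J]
        have "cop_right w y \<cdot>\<^bsub>A \<otimes>\<^sub>A A\<^esub> (\<beta> \<otimes>\<^sub>t \<gamma>) = (\<Sum>j\<in>J. (m j \<cdot> \<beta>) \<otimes>\<^sub>t (n j \<cdot> \<gamma>))"
          unfolding decomposesD(3)[OF J] using mn ab y
          by (simp add: AA.mult_sum_left tensor_of_closed tensor_mult_pure)
        then show ?thesis
          using mn ab y by (simp add: act_def cop_right_mult[OF J w y] lift_sum slice tensor_of_closed
              alg_mult_closed lift_tensor_of mult_sum_left carrier_closed mult_linear)
      qed
      have cp: "left_cop x (p k) \<cdot>\<^bsub>A \<otimes>\<^sub>A A\<^esub> (\<alpha> \<otimes>\<^sub>t \<beta>) \<in> carrier (A \<otimes>\<^sub>A A)" if "k \<in> K" for k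
        using that pq ab xa by (simp add: AA.alg_mult_closed cop_closed tensor_of_closed)
      have "left_cop x (act (y \<cdot> \<gamma>) a) \<cdot>\<^bsub>A \<otimes>\<^sub>A A\<^esub> (\<alpha> \<otimes>\<^sub>t \<beta>) =
          (\<Sum>k\<in>K. \<phi> (q k \<cdot> \<gamma>) *\<^sub>C (left_cop x (p k) \<cdot>\<^bsub>A \<otimes>\<^sub>A A\<^esub> (\<alpha> \<otimes>\<^sub>t \<beta>)))"
        unfolding act_a using pq ab xa
        by (simp add: linear_on_sum[OF left_cop_linear subspace_carrier] carrier_closed
            linear_onD[OF left_cop_linear] AA.mult_sum_left AA.carrier_closed AA.mult_linear cop_closed tensor_of_closed)
      also have "\<dots> = slice3 (\<Sum>k\<in>K. tensor_assoc ((left_cop x (p k) \<cdot>\<^bsub>A \<otimes>\<^sub>A A\<^esub> (\<alpha> \<otimes>\<^sub>t \<beta>)) \<otimes>\<^sub>t (q k \<cdot> \<gamma>)))"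
        using pq y by (simp add: linear_on_sum[OF lin3 sub3] slice3_assoc cp alg_mult_closed)
      also have "\<dots> = slice3 (\<Sum>i\<in>I. (u i \<cdot> \<alpha>) \<otimes>\<^sub>t (cop_right (v i) y \<cdot>\<^bsub>A \<otimes>\<^sub>A A\<^esub> (\<beta> \<otimes>\<^sub>t \<gamma>)))"
        by (simp add: coassociative_decomposed[OF xa(1) y(1) xa(2) ab y(2) I K])
      also have "\<dots> = (\<Sum>i\<in>I. (u i \<cdot> \<alpha>) \<otimes>\<^sub>t (act (y \<cdot> \<gamma>) (v i) \<cdot> \<beta>))"
        using uv ab y by (simp add: linear_on_sum[OF lin3 sub3] slice3_tensor alg_mult_closed AA.alg_mult_closed
            cop_closed tensor_of_closed tensor_of_in_tensor_set right)
      also have "\<dots> = (\<Sum>i\<in>I. u i \<otimes>\<^sub>t act (y \<cdot> \<gamma>) (v i)) \<cdot>\<^bsub>A \<otimes>\<^sub>A A\<^esub> (\<alpha> \<otimes>\<^sub>t \<beta>)"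
        using uv ab y by (simp add: AA.mult_sum_left tensor_of_closed tensor_mult_pure act_closed alg_mult_closed)
      finally show ?thesis .
    qed
    fix s assume "s \<in> carrier (A \<otimes>\<^sub>A A)"
    then obtain J m n where J: "decomposes J m n s" by (rule ex_decomposes)
    show "left_cop x (act (y \<cdot> \<gamma>) a) \<cdot>\<^bsub>A \<otimes>\<^sub>A A\<^esub> s = (\<Sum>i\<in>I. u i \<otimes>\<^sub>t act (y \<cdot> \<gamma>) (v i)) \<cdot>\<^bsub>A \<otimes>\<^sub>A A\<^esub> s"
      using decomposesD(1,2)[OF J] closed[of "y \<cdot> \<gamma>"] y xa unfolding decomposesD(3)[OF J]
      by (simp add: AA.mult_sum_right tensor_of_closed cop_closed act_closed alg_mult_closed pure)
  qed
  obtain J :: "nat set" and p q where J: "\<And>j. j \<in> J \<Longrightarrow> p j \<in> carrier A" "\<And>j. j \<in> J \<Longrightarrow> q j \<in> carrier A"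
    "c = (\<Sum>j\<in>J. p j \<cdot> q j)"
    using c by (rule mult_span) (rule that; assumption)
  have act_sum: "act c w = (\<Sum>j\<in>J. act (p j \<cdot> q j) w)" if "w \<in> carrier A" for w
    unfolding J(3) using J(1,2)
    by (intro linear_on_sum[OF act_linear(2)[OF that] subspace_carrier] alg_mult_closed)
  have "left_cop x (act c a) = (\<Sum>j\<in>J. \<Sum>i\<in>I. u i \<otimes>\<^sub>t act (p j \<cdot> q j) (v i))"
    using J(1,2) xa by (simp add: act_sum linear_on_sum[OF left_cop_linear subspace_carrier] act_closed
        alg_mult_closed product)
  also have "\<dots> = (\<Sum>i\<in>I. u i \<otimes>\<^sub>t act c (v i))"
    using uv by (subst sum.swap) (simp add: act_sum tensor_of_sum_right)
  finally show ?thesis .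
qed

section \<open>Strong left invariance and the right-handed axioms\<close>

lemmas slice = bilinear_slice(1)[OF integral_linear]

lemma integral_left_invariant:
  assumes "a \<in> carrier A" "x \<in> carrier A"
  shows "lift (\<lambda>u v. \<phi> v *\<^sub>C u) (cop_left a x) = \<phi> a *\<^sub>C x"
proof -
  have "fst (id_slice A \<Delta> \<phi> a) x = fst (\<phi> a *\<^sub>C \<one>\<^bsub>multipliers A\<^esub>) x"
    using left_integral assms(1) by (simp add: left_integral_def)
  then show ?thesis
    using assms by (simp add: id_slice_def cop_left_def fst_scaleC scaleC_fun_apply fst_one)
qed

text \<open>The slice of \<open>\<Delta>(a)(x \<otimes> y)\<close> is taken after writing it as \<open>\<Delta>(a)(1 \<otimes> y)\<close> times \<open>x \<otimes> 1\<close>.\<close>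

lemma slice_Delta:
  assumes "a \<in> carrier A" "x \<in> carrier A" "y \<in> carrier A"
  shows "lift (\<lambda>u v. \<phi> v *\<^sub>C u) (fst (\<Delta> a) (x \<otimes>\<^sub>t y)) = act y a \<cdot> x"
proof -
  obtain I u v where I: "decomposes I u v (cop_right a y)" using cop_closed(1)[OF assms(1,3)] by (rule ex_decomposes)
  note uv = decomposesD(1,2)[OF I]
  have "lift (\<lambda>u v. \<phi> v *\<^sub>C u) (fst (\<Delta> a) (x \<otimes>\<^sub>t y)) = (\<Sum>i\<in>I. \<phi> (v i) *\<^sub>C (u i \<cdot> x))"
    using uv assms by (simp add: fst_Delta_tensor_of(1)[OF assms I] lift_sum slice tensor_of_closed
        alg_mult_closed lift_tensor_of)
  also have "\<dots> = act y a \<cdot> x"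
    using uv assms by (simp add: act_def lift_decomposes[OF I slice] mult_sum_left carrier_closed mult_linear)
  finally show ?thesis .
qed

text \<open>Left invariance of \<open>\<phi>\<close> at \<open>\<Delta>(a)\<Delta>(d)(c \<otimes> 1) = \<Delta>(a d)(c \<otimes> 1)\<close>\<close>

lemma sum_act_mult:
  assumes J: "decomposes J p q (cop_left d c)" and "a \<in> carrier A" "d \<in> carrier A" "c \<in> carrier A"
  shows "(\<Sum>j\<in>J. act (q j) a \<cdot> p j) = \<phi> (a \<cdot> d) *\<^sub>C c"
proof -
  note pq = decomposesD(1,2)[OF J]
  have "fst (\<Delta> a) (cop_left d c) = (\<Sum>j\<in>J. fst (\<Delta> a) (p j \<otimes>\<^sub>t q j))"
    unfolding decomposesD(3)[OF J] using pq assms(2)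
    by (intro linear_on_sum[OF Delta_multiplier(1)] AA.subspace_carrier tensor_of_closed)
  then have "lift (\<lambda>u v. \<phi> v *\<^sub>C u) (cop_left (a \<cdot> d) c) = (\<Sum>j\<in>J. act (q j) a \<cdot> p j)"
    using pq assms by (simp add: fst_Delta_cop_left[symmetric] lift_sum slice tensor_of_closed
        Delta_multiplier(3) slice_Delta)
  then show ?thesis using assms by (simp add: integral_left_invariant alg_mult_closed)
qed

text \<open>The axiom for \<open>\<epsilon>\<close> concerns the first leg only. For elements \<open>b \<triangleright> a\<close>, \<open>left_cop_act\<close> moves \<open>\<epsilon>\<close> onto
\<open>b \<triangleright> \<cdot>\<close>, where the axiom applies, and these elements span \<open>A\<close>.\<close>

lemma counit_right:
  assumes "x \<in> carrier A" "a \<in> carrier A"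
  shows "lift (\<lambda>u v. \<epsilon> v *\<^sub>C u) (left_cop x a) = x \<cdot> a"
proof -
  have pure: "lift (\<lambda>u v. \<epsilon> v *\<^sub>C u) (left_cop x (act c a)) = x \<cdot> act c a"
    if a: "a \<in> carrier A" and c: "c \<in> carrier A" for a c
  proof -
    obtain I u v where I: "decomposes I u v (left_cop x a)" using cop_closed(2)[OF a assms(1)] by (rule ex_decomposes)
    show ?thesis
      using decomposesD(1,2)[OF I] c assms(1) a
      by (simp add: left_cop_act[OF I] mult_act[OF I] lift_sum bilinear_slice counit_linear tensor_of_closed
          act_closed lift_tensor_of counit_act)
  qed
  obtain I :: "nat set" and p q where I: "\<And>i. i \<in> I \<Longrightarrow> p i \<in> carrier A" "\<And>i. i \<in> I \<Longrightarrow> q i \<in> carrier A"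
    "a = (\<Sum>i\<in>I. act (q i) (p i))"
    using assms(2) by (rule act_span) (rule that; assumption)
  show ?thesis
    unfolding I(3) using I(1,2) assms(1)
    by (simp add: linear_on_sum[OF left_cop_linear subspace_carrier] act_closed lift_sum bilinear_slice
        counit_linear cop_closed pure mult_sum_right)
qed

text \<open>In Sweedler notation \<open>a\<^sub>(\<^sub>1\<^sub>) \<otimes> a\<^sub>(\<^sub>2\<^sub>) d\<^sub>(\<^sub>1\<^sub>) c \<phi>(a\<^sub>(\<^sub>3\<^sub>) d\<^sub>(\<^sub>2\<^sub>)) = a\<^sub>(\<^sub>1\<^sub>) \<otimes> c \<phi>(a\<^sub>(\<^sub>2\<^sub>) d)\<close>, by left invariance. This
finds the preimage of \<open>act d a \<otimes> c\<close> under the canonical map, on which the antipode axiom determines \<open>S\<close>.\<close>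

lemma cop_right_act_sum:
  assumes J: "decomposes J p q (cop_left d c)" and adc: "a \<in> carrier A" "d \<in> carrier A" "c \<in> carrier A"
  shows "(\<Sum>j\<in>J. cop_right (act (q j) a) (p j)) = act d a \<otimes>\<^sub>t c"
proof (rule leg1_cancel)
  note pq = decomposesD(1,2)[OF J]
  show "(\<Sum>j\<in>J. cop_right (act (q j) a) (p j)) \<in> carrier (A \<otimes>\<^sub>A A)"
    using pq adc by (intro tensor_sum_closed cop_closed act_closed)
  show "act d a \<otimes>\<^sub>t c \<in> carrier (A \<otimes>\<^sub>A A)"
    using adc by (intro tensor_of_closed act_closed)
  fix x assume x: "x \<in> carrier A"
  obtain I u v where I: "decomposes I u v (left_cop x a)" using cop_closed(2)[OF adc(1) x] by (rule ex_decomposes)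
  note uv = decomposesD(1,2)[OF I]
  have "leg1 x (cop_right (act (q j) a) (p j)) = (\<Sum>i\<in>I. u i \<otimes>\<^sub>t (act (q j) (v i) \<cdot> p j))" if j: "j \<in> J" for j
  proof (rule leg1_cop_right)
    show "decomposes I u (\<lambda>i. act (q j) (v i)) (left_cop x (act (q j) a))"
      using uv pq(2)[OF j] left_cop_act[OF I x adc(1) pq(2)[OF j]] by (simp add: decomposes_def act_closed)
  qed (use x pq[OF j] adc in \<open>simp_all add: act_closed\<close>)
  then have "leg1 x (\<Sum>j\<in>J. cop_right (act (q j) a) (p j)) = (\<Sum>j\<in>J. \<Sum>i\<in>I. u i \<otimes>\<^sub>t (act (q j) (v i) \<cdot> p j))"
    using pq adc x by (simp add: linear_on_sum[OF linear_on_leg(1) AA.subspace_carrier] cop_closed act_closed)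
  also have "\<dots> = (\<Sum>i\<in>I. u i \<otimes>\<^sub>t (\<phi> (v i \<cdot> d) *\<^sub>C c))"
    using uv adc by (subst sum.swap) (simp add: sum_act_mult[OF J] flip: tensor_of_sum_right)
  also have "\<dots> = (x \<cdot> act d a) \<otimes>\<^sub>t c"
    using adc x by (simp add: mult_act[OF I] tensor_of_sum_left tensor_of_linear)
  finally show "leg1 x (\<Sum>j\<in>J. cop_right (act (q j) a) (p j)) = leg1 x (act d a \<otimes>\<^sub>t c)"
    using adc x by (simp add: leg1_tensor_of act_closed)
qed

text \<open>The identity \<open>(\<iota> \<otimes> \<phi>)((1 \<otimes> a)\<Delta>(d)) = S((\<iota> \<otimes> \<phi>)(\<Delta>(a)(1 \<otimes> d)))\<close>, multiplied by \<open>c\<close> from the right.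
It is the antipode axiom at the preimage of \<open>act d a \<otimes> c\<close> just found.\<close>

lemma strong_left_invariance:
  assumes J: "decomposes J p q (cop_left d c)" and adc: "a \<in> carrier A" "d \<in> carrier A" "c \<in> carrier A"
  shows "(\<Sum>j\<in>J. \<phi> (a \<cdot> q j) *\<^sub>C p j) = S (act d a) \<cdot> c"
proof -
  note pq = decomposesD(1,2)[OF J]
  have "S (act d a) \<cdot> c = lift (\<lambda>u v. S u \<cdot> v) (act d a \<otimes>\<^sub>t c)"
    using adc by (simp add: lift_tensor_of bilinear_antipode act_closed)
  also have "\<dots> = (\<Sum>j\<in>J. \<phi> (a \<cdot> q j) *\<^sub>C p j)"
    unfolding cop_right_act_sum[OF assms, symmetric] using pq adc
    by (simp add: lift_sum bilinear_antipode cop_closed act_closed antipode_left counit_act)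
  finally show ?thesis by simp
qed

text \<open>\<open>S(b \<triangleright> v)\<close> for \<open>b = \<phi>(\<cdot> d)\<close> is replaced by strong left invariance; what remains is left
invariance for \<open>\<Delta>(a)\<Delta>(d)\<close>.\<close>

lemma antipode_right_act:
  assumes I: "decomposes I u v (left_cop x a)" and x: "x \<in> carrier A" "a \<in> carrier A" "d \<in> carrier A"
  shows "(\<Sum>i\<in>I. u i \<cdot> S (act d (v i))) = \<phi> (a \<cdot> d) *\<^sub>C x"
proof (rule mult_right_cancel)
  note uv = decomposesD(1,2)[OF I]
  show "(\<Sum>i\<in>I. u i \<cdot> S (act d (v i))) \<in> carrier A"
    using uv x by (intro carrier_closed alg_mult_closed antipode_closed act_closed)
  show "\<phi> (a \<cdot> d) *\<^sub>C x \<in> carrier A" using x by (simp add: carrier_closed)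
  fix c assume c: "c \<in> carrier A"
  obtain J p q where J: "decomposes J p q (cop_left d c)" using cop_closed(3)[OF x(3) c] by (rule ex_decomposes)
  note pq = decomposesD(1,2)[OF J]
  have "(\<Sum>i\<in>I. u i \<cdot> S (act d (v i))) \<cdot> c = (\<Sum>i\<in>I. u i \<cdot> (S (act d (v i)) \<cdot> c))"
    using uv x c by (simp add: mult_sum_left alg_mult_closed antipode_closed act_closed alg_mult_assoc)
  also have "\<dots> = (\<Sum>i\<in>I. \<Sum>j\<in>J. \<phi> (v i \<cdot> q j) *\<^sub>C (u i \<cdot> p j))"
    using uv pq x c by (simp add: mult_sum_right mult_linear carrier_closed flip: strong_left_invariance[OF J])
  also have "\<dots> = (\<Sum>j\<in>J. (\<Sum>i\<in>I. \<phi> (v i \<cdot> q j) *\<^sub>C u i) \<cdot> p j)"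
    using uv pq by (subst sum.swap) (simp add: mult_sum_left mult_linear carrier_closed)
  also have "\<dots> = (\<Sum>j\<in>J. x \<cdot> (act (q j) a \<cdot> p j))"
    using pq x by (simp add: mult_act[OF I, symmetric] alg_mult_assoc act_closed)
  also have "\<dots> = x \<cdot> (\<phi> (a \<cdot> d) *\<^sub>C c)"
    using pq x c by (simp add: sum_act_mult[OF J, symmetric] mult_sum_right alg_mult_closed act_closed)
  finally show "(\<Sum>i\<in>I. u i \<cdot> S (act d (v i))) \<cdot> c = (\<phi> (a \<cdot> d) *\<^sub>C x) \<cdot> c"
    using x c by (simp add: mult_linear)
qed

text \<open>By \<open>left_cop_act\<close> the previous identity is the claim at the elements \<open>b \<triangleright> a\<close>, which span \<open>A\<close>.\<close>

lemma antipode_right: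
  assumes "x \<in> carrier A" "a \<in> carrier A"
  shows "lift (\<lambda>u v. u \<cdot> S v) (left_cop x a) = \<epsilon> a *\<^sub>C x"
proof -
  have pure: "lift (\<lambda>u v. u \<cdot> S v) (left_cop x (act c a)) = \<epsilon> (act c a) *\<^sub>C x"
    if a: "a \<in> carrier A" and c: "c \<in> carrier A" for a c
  proof -
    obtain I u v where I: "decomposes I u v (left_cop x a)" using cop_closed(2)[OF a assms(1)] by (rule ex_decomposes)
    show ?thesis
      using decomposesD(1,2)[OF I] c assms(1) a
      by (simp add: left_cop_act[OF I] lift_sum bilinear_antipode tensor_of_closed act_closed lift_tensor_of
          counit_act antipode_right_act[OF I])
  qed
  obtain I :: "nat set" and p q where I: "\<And>i. i \<in> I \<Longrightarrow> p i \<in> carrier A" "\<And>i. i \<in> I \<Longrightarrow> q i \<in> carrier A"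
    "a = (\<Sum>i\<in>I. act (q i) (p i))"
    using assms(2) by (rule act_span) (rule that; assumption)
  show ?thesis
    unfolding I(3) using I(1,2) assms(1)
    by (simp add: linear_on_sum[OF left_cop_linear subspace_carrier] act_closed lift_sum bilinear_antipode
        cop_closed pure linear_on_sum[OF counit_linear subspace_carrier] cvec.scale_sum_left)
qed

section \<open>Faithfulness of the left integral\<close>

text \<open>Let \<open>K\<close> consist of the \<open>v\<close> with \<open>\<phi>(v d) = 0\<close> for all \<open>d\<close>. By strong left invariance and
injectivity of \<open>S\<close>, all \<open>(\<iota> \<otimes> \<phi>(\<cdot> d))\<Delta>(k)\<close> with \<open>k \<in> K\<close> vanish, so \<open>(x \<otimes> 1)\<Delta>(k)\<close> lies in \<open>A \<otimes> K\<close>. If it is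
\<open>\<Sum> u\<^sub>i \<otimes> v\<^sub>i\<close>, then \<open>\<Sum> v\<^sub>i S\<^sup>-\<^sup>1(u\<^sub>i)\<close> is annihilated by \<open>\<phi>\<close> and equals \<open>\<epsilon>(k) S\<^sup>-\<^sup>1(x)\<close> by the right
antipode identity, which forces \<open>\<epsilon>(k) = 0\<close>. Hence \<open>\<epsilon>\<close> vanishes on \<open>K\<close>, and
\<open>x k = (\<iota> \<otimes> \<epsilon>)((x \<otimes> 1)\<Delta>(k)) = 0\<close> for all \<open>x\<close>.\<close>

lemma integral_faithful:
  assumes a: "a \<in> carrier A" and zero: "\<And>d. d \<in> carrier A \<Longrightarrow> \<phi> (a \<cdot> d) = 0"
  shows "a = 0"
proof -
  define K where "K = {v \<in> carrier A. \<forall>d\<in>carrier A. \<phi> (v \<cdot> d) = 0}"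
  have S0: "S 0 = 0" using linear_on_zero[OF antipode_linear subspace_carrier] .
  have S_inj: "x = 0" if "x \<in> carrier A" "S x = 0" for x
    using antipode_bij that S0 carrier_closed(4) by (metis bij_betw_def inj_onD)
  have act_zero: "act d v = 0" if v: "v \<in> K" and d: "d \<in> carrier A" for v d
  proof (rule S_inj)
    have v': "v \<in> carrier A" using v by (simp add: K_def)
    show "act d v \<in> carrier A" using v' d by (simp add: act_closed)
    have "S (act d v) \<cdot> c = 0" if c: "c \<in> carrier A" for c
    proof -
      obtain J p q where J: "decomposes J p q (cop_left d c)" using cop_closed(3)[OF d c] by (rule ex_decomposes)
      have "S (act d v) \<cdot> c = (\<Sum>j\<in>J. \<phi> (v \<cdot> q j) *\<^sub>C p j)"
        using strong_left_invariance[OF J v' d c] by simp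
      also have "\<dots> = 0" using v decomposesD(2)[OF J] by (intro sum.neutral) (simp add: K_def)
      finally show ?thesis .
    qed
    then show "S (act d v) = 0" using v' d nondegenerate_left by (simp add: antipode_closed act_closed)
  qed
  have coideal: "\<exists>I u v. decomposes I u v (left_cop x k) \<and> (\<forall>i\<in>I. v i \<in> K)"
    if x: "x \<in> carrier A" and k: "k \<in> K" for x k
  proof -
    have k': "k \<in> carrier A" using k by (simp add: K_def)
    have "left_cop x k \<in> tensor_set (carrier A) (carrier A)"
      using cop_closed(2)[OF k' x] by (simp add: carrier_tensor_algebra)
    then obtain I :: "nat set" and u v where I: "\<And>i. i \<in> I \<Longrightarrow> u i \<in> carrier A" "\<And>i. i \<in> I \<Longrightarrow> v i \<in> carrier A"
        "left_cop x k = (\<Sum>i\<in>I. u i \<otimes>\<^sub>t v i)"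
      and indep: "\<And>c i. (\<Sum>i\<in>I. c i *\<^sub>C u i) = 0 \<Longrightarrow> i \<in> I \<Longrightarrow> c i = 0"
      by (rule tensor_set_independent_cases[OF subspace_carrier subspace_carrier]) (rule that; assumption)
    have dec: "decomposes I u v (left_cop x k)" using I by (simp add: decomposes_def)
    have "\<phi> (v i \<cdot> d) = 0" if i: "i \<in> I" and d: "d \<in> carrier A" for i d
      using mult_act[OF dec x k' d] act_zero[OF k d] mult_linear(4)[of x 0 0] x carrier_closed(4)
        indep[of "\<lambda>i. \<phi> (v i \<cdot> d)"] i by simp
    then show ?thesis using dec I(2) by (intro exI[of _ I] exI[of _ u] exI[of _ v]) (simp add: K_def)
  qed
  obtain e where e: "e \<in> carrier A" "\<phi> e \<noteq> 0" using ex_integral_nonzero by blast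
  \<comment> \<open>The choice \<open>x = S(e)\<close> makes \<open>\<phi>(S\<^sup>-\<^sup>1(x)) = \<phi>(e)\<close> non-zero.\<close>
  obtain x0 where x0: "x0 \<in> carrier A" "S e = x0" using e antipode_closed by blast
  have counit_zero: "\<epsilon> k = 0" if k: "k \<in> K" for k
  proof -
    obtain I u v where I: "decomposes I u v (left_cop x0 k)" and vK: "\<forall>i\<in>I. v i \<in> K"
      using coideal[OF x0(1) k] by blast
    note uv = decomposesD(1,2)[OF I]
    define w where "w i = inv_into (carrier A) S (u i)" for i
    have w: "w i \<in> carrier A" "S (w i) = u i" if "i \<in> I" for i
      using uv(1)[OF that] antipode_bij unfolding w_def bij_betw_def
      by (metis inv_into_into, metis f_inv_into_f)
    have k': "k \<in> carrier A" using k by (simp add: K_def)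
    have "S (\<Sum>i\<in>I. v i \<cdot> w i) = (\<Sum>i\<in>I. u i \<cdot> S (v i))"
      using uv w by (simp add: linear_on_sum[OF antipode_linear subspace_carrier] alg_mult_closed antipode_mult)
    also have "\<dots> = S (\<epsilon> k *\<^sub>C e)"
      using antipode_right[OF x0(1) k'] e x0(2)
      by (simp add: lift_decomposes[OF I bilinear_antipode(2)] linear_onD[OF antipode_linear])
    finally have "(\<Sum>i\<in>I. v i \<cdot> w i) = \<epsilon> k *\<^sub>C e"
      using antipode_bij uv w e unfolding bij_betw_def
      by (metis (no_types, lifting) inj_onD carrier_closed(3,5) alg_mult_closed)
    moreover have "\<phi> (\<Sum>i\<in>I. v i \<cdot> w i) = 0"
      using uv w vK by (simp add: linear_on_sum[OF integral_linear subspace_carrier] alg_mult_closed K_def)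
    ultimately show ?thesis using e by (simp add: linear_onD[OF integral_linear])
  qed
  have "x \<cdot> a = 0" if x: "x \<in> carrier A" for x
  proof -
    have "a \<in> K" using a zero by (simp add: K_def)
    then obtain I u v where I: "decomposes I u v (left_cop x a)" and vK: "\<forall>i\<in>I. v i \<in> K"
      using coideal[OF x] by blast
    then show ?thesis
      using counit_right[OF x a] vK
      by (simp add: lift_decomposes[OF I] bilinear_slice counit_linear counit_zero)
  qed
  then show ?thesis using a nondegenerate_right by blast
qed

section \<open>The dual algebra\<close>

abbreviation B :: "('a \<Rightarrow> complex) algebra" where "B \<equiv> dual A \<Delta> \<phi>"

abbreviation dual_elem :: "'a \<Rightarrow> 'a \<Rightarrow> complex" where "dual_elem \<equiv> dual_element A \<phi>"

lemma carrier_dual: "carrier B = dual_elem ` carrier A"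
  by (simp add: dual_def)

lemma dual_elem_closed: "c \<in> carrier A \<Longrightarrow> dual_elem c \<in> carrier B"
  by (simp add: carrier_dual)

lemma dual_cases:
  assumes "b \<in> carrier B" obtains c where "c \<in> carrier A" "b = dual_elem c"
  using assms by (auto simp: carrier_dual)

lemma dual_elem_apply: "a \<in> carrier A \<Longrightarrow> dual_elem c a = \<phi> (a \<cdot> c)"
  by (simp add: dual_element_def)

lemma dual_elem_linear:
  assumes "c \<in> carrier A"
  shows "c' \<in> carrier A \<Longrightarrow> dual_elem (c + c') = dual_elem c + dual_elem c'" "dual_elem (k *\<^sub>C c) = k *\<^sub>C dual_elem c"
  using assms by (auto simp: dual_element_def fun_eq_iff scaleC_fun_apply mult_linear alg_mult_closed
      linear_onD[OF integral_linear])

lemma subspace_dual: "cvec.subspace (carrier B)"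
proof (rule cvec.subspaceI)
  have "0 = dual_elem 0"
    using dual_elem_linear(2)[of 0 0] carrier_closed(4) by simp
  then show "0 \<in> carrier B" using dual_elem_closed carrier_closed(4) by metis
  show "b + b' \<in> carrier B" if "b \<in> carrier B" "b' \<in> carrier B" for b b'
    using that unfolding carrier_dual by (auto simp: carrier_closed simp flip: dual_elem_linear)
  show "k *\<^sub>C b \<in> carrier B" if "b \<in> carrier B" for k b
    using that unfolding carrier_dual by (auto simp: carrier_closed simp flip: dual_elem_linear)
qed

lemma linear_on_dual: "b \<in> carrier B \<Longrightarrow> linear_on (carrier A) b"
  by (auto simp: carrier_dual dual_elem_apply linear_on_def carrier_closed mult_linear alg_mult_closed
      linear_onD[OF integral_linear])

lemma dual_outside: "b \<in> carrier B \<Longrightarrow> a \<notin> carrier A \<Longrightarrow> b a = 0"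
  by (auto simp: carrier_dual dual_element_def)

lemma dual_eqI:
  "b \<in> carrier B \<Longrightarrow> b' \<in> carrier B \<Longrightarrow> (\<And>a. a \<in> carrier A \<Longrightarrow> b a = b' a) \<Longrightarrow> b = b'"
  using dual_outside by (metis ext)

lemma dual_separates:
  assumes "x \<in> carrier A" "y \<in> carrier A" "\<And>b. b \<in> carrier B \<Longrightarrow> b x = b y"
  shows "x = y"
proof -
  have "\<phi> ((x - y) \<cdot> d) = 0" if d: "d \<in> carrier A" for d
    using assms(3)[OF dual_elem_closed[OF d]] assms(1,2) d
    by (simp add: dual_elem_apply mult_diff linear_on_diff[OF integral_linear subspace_carrier] alg_mult_closed)
  then show ?thesis using integral_faithful[of "x - y"] assms(1,2) by (simp add: carrier_closed)
qed

lemma mult_act_dual: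
  assumes "decomposes I u v (left_cop x a)" "x \<in> carrier A" "a \<in> carrier A" "c \<in> carrier A"
  shows "x \<cdot> act c a = (\<Sum>i\<in>I. dual_elem c (v i) *\<^sub>C u i)"
  using mult_act[OF assms] decomposesD(2)[OF assms(1)] by (simp add: dual_elem_apply)

lemma act_cong:
  assumes "dual_elem c = dual_elem c'" "c \<in> carrier A" "c' \<in> carrier A" "a \<in> carrier A"
  shows "act c a = act c' a"
proof (rule mult_left_cancel)
  fix x assume x: "x \<in> carrier A"
  obtain I u v where I: "decomposes I u v (left_cop x a)" using cop_closed(2)[OF assms(4) x] by (rule ex_decomposes)
  show "x \<cdot> act c a = x \<cdot> act c' a"
    using assms x by (simp add: mult_act_dual[OF I])
qed (use assms in \<open>simp_all add: act_closed\<close>)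

text \<open>The value in the definition of \<open>multiplier_pairing\<close> is unambiguous: \<open>\<phi>(\<cdot> d)\<close> evaluated at \<open>act d' a\<close>
depends only on \<open>\<phi>(\<cdot> d)\<close> and, by \<open>act_cong\<close>, on \<open>\<phi>(\<cdot> d')\<close>.\<close>

lemma dual_mult_apply:
  assumes c: "c \<in> carrier A" "c' \<in> carrier A" and a: "a \<in> carrier A"
  shows "(dual_elem c \<cdot>\<^bsub>B\<^esub> dual_elem c') a = dual_elem c (act c' a)"
proof -
  have pairing: "lift (\<lambda>x y. \<phi> x * \<phi> y) (fst (\<Delta> a) (d \<otimes>\<^sub>t d')) = dual_elem d (act d' a)"
    if d: "d \<in> carrier A" "d' \<in> carrier A" for d d'
  proof -
    obtain I u v where I: "decomposes I u v (fst (\<Delta> a) (d \<otimes>\<^sub>t d'))"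
      using Delta_multiplier(3)[OF a tensor_of_closed[OF d]] by (rule ex_decomposes)
    have "bilinear_on (carrier A) (carrier A) (\<lambda>x y. \<phi> x * \<phi> y)"
      by (rule bilinear_onI) (simp_all add: linear_onD[OF integral_linear] algebra_simps)
    then have "lift (\<lambda>x y. \<phi> x * \<phi> y) (fst (\<Delta> a) (d \<otimes>\<^sub>t d')) = \<phi> (lift (\<lambda>u v. \<phi> v *\<^sub>C u) (fst (\<Delta> a) (d \<otimes>\<^sub>t d')))"
      using decomposesD(1,2)[OF I] by (simp add: lift_decomposes[OF I] slice carrier_closed mult.commute
          linear_on_sum[OF integral_linear subspace_carrier] linear_onD[OF integral_linear])
    then show ?thesis using d a by (simp add: slice_Delta dual_elem_apply act_closed)
  qed
  have "multiplier_pairing A \<phi> (\<Delta> a) (dual_elem c) (dual_elem c') = dual_elem c (act c' a)"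
    unfolding multiplier_pairing_def
  proof (rule the_equality)
    show "\<exists>d\<in>carrier A. \<exists>d'\<in>carrier A. dual_elem c = dual_elem d \<and> dual_elem c' = dual_elem d' \<and>
        dual_elem c (act c' a) = lift (\<lambda>x y. \<phi> x * \<phi> y) (fst (\<Delta> a) (d \<otimes>\<^sub>t d'))"
      using c by (intro bexI[of _ c] bexI[of _ c']) (simp_all add: pairing)
    fix z assume "\<exists>d\<in>carrier A. \<exists>d'\<in>carrier A. dual_elem c = dual_elem d \<and> dual_elem c' = dual_elem d' \<and>
        z = lift (\<lambda>x y. \<phi> x * \<phi> y) (fst (\<Delta> a) (d \<otimes>\<^sub>t d'))"
    then obtain d d' where "d \<in> carrier A" "d' \<in> carrier A" "dual_elem c = dual_elem d" "dual_elem c' = dual_elem d'"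
      "z = lift (\<lambda>x y. \<phi> x * \<phi> y) (fst (\<Delta> a) (d \<otimes>\<^sub>t d'))" by blast
    then show "z = dual_elem c (act c' a)"
      using pairing[of d d'] act_cong[of c' d' a] c a by simp
  qed
  then show ?thesis using a by (simp add: dual_def)
qed

lemma dual_mult_outside: "a \<notin> carrier A \<Longrightarrow> (b \<cdot>\<^bsub>B\<^esub> b') a = 0"
  by (simp add: dual_def)

lemma dual_mult_act:
  "b \<in> carrier B \<Longrightarrow> c \<in> carrier A \<Longrightarrow> a \<in> carrier A \<Longrightarrow> (b \<cdot>\<^bsub>B\<^esub> dual_elem c) a = b (act c a)"
  by (auto elim!: dual_cases simp: dual_mult_apply)

lemma dual_act_eq:
  assumes "c \<in> carrier A" "a \<in> carrier A"
  shows "dual_act A B (dual_elem c) a = act c a"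
  unfolding dual_act_def
proof (rule the_equality)
  show "act c a \<in> carrier A \<and> (\<forall>b'\<in>carrier B. b' (act c a) = (b' \<cdot>\<^bsub>B\<^esub> dual_elem c) a)"
    using assms by (simp add: act_closed dual_mult_act)
  show "x = act c a" if "x \<in> carrier A \<and> (\<forall>b'\<in>carrier B. b' x = (b' \<cdot>\<^bsub>B\<^esub> dual_elem c) a)" for x
    using that assms by (intro dual_separates) (simp_all add: act_closed dual_mult_act)
qed

lemma act_on_dual_eq:
  "a \<in> carrier A \<Longrightarrow> c \<in> carrier A \<Longrightarrow> act_on_dual A a (dual_elem c) = dual_elem (a \<cdot> c)"
  by (auto simp: act_on_dual_def dual_element_def alg_mult_closed alg_mult_assoc)

lemma bilinear_dual_mult: "bilinear_on (carrier B) (carrier B) (\<lambda>b b'. b \<cdot>\<^bsub>B\<^esub> b')"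
proof (rule bilinear_onI; rule ext)
  fix b b' b1 a k assume b: "b \<in> carrier B" "b' \<in> carrier B"
  obtain c' where c': "c' \<in> carrier A" "b' = dual_elem c'" using b(2) by (rule dual_cases)
  show "((k *\<^sub>C b) \<cdot>\<^bsub>B\<^esub> b') a = (k *\<^sub>C (b \<cdot>\<^bsub>B\<^esub> b')) a"
    using b c' by (cases "a \<in> carrier A") (simp_all add: dual_mult_act dual_mult_outside scaleC_fun_apply
        cvec.subspace_scale[OF subspace_dual])
  show "(b \<cdot>\<^bsub>B\<^esub> (k *\<^sub>C b')) a = (k *\<^sub>C (b \<cdot>\<^bsub>B\<^esub> b')) a"
    using b c' by (cases "a \<in> carrier A") (simp_all add: dual_mult_act dual_mult_outside scaleC_fun_apply
        linear_onD[OF act_linear(2)] linear_onD[OF linear_on_dual] act_closed carrier_closed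
        flip: dual_elem_linear)
  assume b1: "b1 \<in> carrier B"
  then obtain c1 where c1: "c1 \<in> carrier A" "b1 = dual_elem c1" by (rule dual_cases)
  show "(b \<cdot>\<^bsub>B\<^esub> (b' + b1)) a = (b \<cdot>\<^bsub>B\<^esub> b' + b \<cdot>\<^bsub>B\<^esub> b1) a"
    using b c' c1 by (cases "a \<in> carrier A") (simp_all add: dual_mult_act dual_mult_outside
        linear_onD[OF act_linear(2)] linear_onD[OF linear_on_dual] act_closed carrier_closed
        flip: dual_elem_linear)
next
  fix b b1 b' a assume b: "b \<in> carrier B" "b1 \<in> carrier B" "b' \<in> carrier B"
  obtain c' where c': "c' \<in> carrier A" "b' = dual_elem c'" using b(3) by (rule dual_cases)
  show "((b + b1) \<cdot>\<^bsub>B\<^esub> b') a = (b \<cdot>\<^bsub>B\<^esub> b' + b1 \<cdot>\<^bsub>B\<^esub> b') a"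
    using b c' by (cases "a \<in> carrier A") (simp_all add: dual_mult_act dual_mult_outside
        cvec.subspace_add[OF subspace_dual])
qed

sublocale dual_primal: bilinear_multiplications B A
  by unfold_locales (rule subspace_dual subspace_carrier bilinear_dual_mult alg_mult_bilinear)+

section \<open>Elements of the tensor product of the dual with the algebra as operators\<close>

text \<open>The operator \<open>T\<^sub>t\<close> of \<open>t\<close>, evaluated at \<open>w\<close>\<close>

definition eval_dual :: "'a \<Rightarrow> ('a \<Rightarrow> complex, 'a) tensor \<Rightarrow> 'a" where
  "eval_dual w t = tensor_lift (carrier B) (carrier A) (\<lambda>b a. b w *\<^sub>C a) t"

lemma bilinear_eval_dual: "bilinear_on (carrier B) (carrier A) (\<lambda>b a. b w *\<^sub>C a)"
  by (rule bilinear_onI) (simp_all add: scaleC_add_left scaleC_add_right scaleC_fun_apply scaleC_scaleC mult.commute)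

lemma dual_primal_cases:
  assumes "t \<in> carrier (B \<otimes>\<^sub>A A)"
  obtains I :: "nat set" and c y where "\<And>i. i \<in> I \<Longrightarrow> c i \<in> carrier A" "\<And>i. i \<in> I \<Longrightarrow> y i \<in> carrier A"
    "t = (\<Sum>i\<in>I. dual_elem (c i) \<otimes>\<^sub>t y i)"
proof -
  obtain I :: "nat set" and b y where I: "\<And>i. i \<in> I \<Longrightarrow> b i \<in> carrier B" "\<And>i. i \<in> I \<Longrightarrow> y i \<in> carrier A"
    "t = (\<Sum>i\<in>I. b i \<otimes>\<^sub>t y i)"
    using assms by (rule dual_primal.tensor_algebra_cases) (rule that; assumption)
  from I(1) obtain c where "\<And>i. i \<in> I \<Longrightarrow> c i \<in> carrier A \<and> b i = dual_elem (c i)"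
    unfolding carrier_dual image_iff by metis
  with I show thesis by (intro that[of I c y]) auto
qed

lemma eval_dual_sum:
  "(\<And>i. i \<in> I \<Longrightarrow> b i \<in> carrier B) \<Longrightarrow> (\<And>i. i \<in> I \<Longrightarrow> y i \<in> carrier A) \<Longrightarrow>
    eval_dual w (\<Sum>i\<in>I. b i \<otimes>\<^sub>t y i) = (\<Sum>i\<in>I. b i w *\<^sub>C y i)"
  unfolding eval_dual_def by (rule tensor_lift_sum_tensor[OF subspace_dual subspace_carrier bilinear_eval_dual])

lemma linear_on_eval_dual: "linear_on (carrier (B \<otimes>\<^sub>A A)) (eval_dual w)"
  unfolding eval_dual_def carrier_tensor_algebra
  by (rule linear_on_tensor_lift[OF subspace_dual subspace_carrier bilinear_eval_dual])

lemma eval_dual_closed: "t \<in> carrier (B \<otimes>\<^sub>A A) \<Longrightarrow> eval_dual w t \<in> carrier A"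
  by (erule dual_primal_cases) (simp add: eval_dual_sum dual_elem_closed carrier_closed)

lemma dual_primal_closed: "b \<in> carrier B \<Longrightarrow> a \<in> carrier A \<Longrightarrow> b \<otimes>\<^sub>t a \<in> carrier (B \<otimes>\<^sub>A A)"
  by (simp add: carrier_tensor_algebra tensor_of_in_tensor_set)

lemma subspace_dual_primal: "cvec.subspace (carrier (B \<otimes>\<^sub>A A))"
  by (simp add: carrier_tensor_algebra subspace_tensor_set)

lemma eval_dual_zero:
  assumes t: "t \<in> carrier (B \<otimes>\<^sub>A A)" and zero: "\<And>w. w \<in> carrier A \<Longrightarrow> eval_dual w t = 0"
  shows "t = 0"
proof (rule tensor_separated_left[OF subspace_dual subspace_carrier, where H = "(\<lambda>w b. b w) ` carrier A"])
  show "t \<in> tensor_set (carrier B) (carrier A)" using t by (simp add: carrier_tensor_algebra)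
  show "linear_on (carrier B) h" if "h \<in> (\<lambda>w b. b w) ` carrier A" for h :: "('a \<Rightarrow> complex) \<Rightarrow> complex"
    using that by (auto simp: linear_on_def scaleC_fun_apply)
  show "b = 0" if "b \<in> carrier B" "\<And>h. h \<in> (\<lambda>w b. b w) ` carrier A \<Longrightarrow> h b = (0 :: complex)" for b
    using that by (intro dual_eqI cvec.subspace_0[OF subspace_dual]) auto
  show "tensor_lift (carrier B) (carrier A) (\<lambda>x y. h x *\<^sub>C y) t = 0" if "h \<in> (\<lambda>w b. b w) ` carrier A" for h
    using that zero by (auto simp: eval_dual_def)
qed

lemma eval_dual_eqI:
  assumes "s \<in> carrier (B \<otimes>\<^sub>A A)" "t \<in> carrier (B \<otimes>\<^sub>A A)"
    "\<And>w. w \<in> carrier A \<Longrightarrow> eval_dual w s = eval_dual w t"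
  shows "s = t"
  using eval_dual_zero[of "s - t"] assms
  by (simp add: cvec.subspace_diff[OF subspace_dual_primal] linear_on_diff[OF linear_on_eval_dual subspace_dual_primal])

text \<open>The cross pairing consists of the matrix coefficients of these operators.\<close>

lemma cross_pairing_eval:
  assumes t: "t \<in> carrier (B \<otimes>\<^sub>A A)" and a': "a' \<in> carrier A" and b': "b' \<in> carrier B"
  shows "cross_pairing A B t (a' \<otimes>\<^sub>t b') = b' (eval_dual a' t)"
proof -
  have t': "t \<in> tensor_set (carrier B) (carrier A)" using t by (simp add: carrier_tensor_algebra)
  have inner: "bilinear_on (carrier A) (carrier B) (\<lambda>a' b'. b a' * b' a)" if "b \<in> carrier B" "a \<in> carrier A" for b a
    using that by (intro bilinear_onI) (simp_all add: linear_onD[OF linear_on_dual] scaleC_fun_apply algebra_simps)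
  have "cross_pairing A B t (a' \<otimes>\<^sub>t b') = tensor_lift (carrier B) (carrier A) (\<lambda>b a. b a' * b' a) t"
    unfolding cross_pairing_def using a' b'
    by (intro tensor_lift_cong[OF subspace_dual t'])
      (simp add: tensor_lift_tensor_of subspace_dual subspace_carrier inner)
  also have "\<dots> = b' (eval_dual a' t)"
  proof -
    obtain I :: "nat set" and c y where I: "\<And>i. i \<in> I \<Longrightarrow> c i \<in> carrier A" "\<And>i. i \<in> I \<Longrightarrow> y i \<in> carrier A"
      "t = (\<Sum>i\<in>I. dual_elem (c i) \<otimes>\<^sub>t y i)"
      using t by (rule dual_primal_cases) (rule that; assumption)
    have "bilinear_on (carrier B) (carrier A) (\<lambda>b a. b a' * b' a)"
      using b' by (intro bilinear_onI) (simp_all add: linear_onD[OF linear_on_dual] scaleC_fun_apply algebra_simps)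
    then show ?thesis
      unfolding I(3) using I(1,2) b'
      by (simp add: tensor_lift_sum_tensor subspace_dual subspace_carrier dual_elem_closed eval_dual_sum
          carrier_closed linear_on_sum[OF linear_on_dual subspace_carrier] linear_onD[OF linear_on_dual])
  qed
  finally show ?thesis .
qed

text \<open>Multiplying \<open>z\<close> by \<open>b \<otimes> a\<close> and evaluating the first leg at \<open>w\<close> gives \<open>T\<^sub>z(b \<triangleright> w) a\<close>, because
\<open>(b' b)(w) = b'(b \<triangleright> w)\<close>. Non-degeneracy of \<open>A\<close> removes \<open>a\<close>, and the elements \<open>b \<triangleright> w\<close> span \<open>A\<close>.\<close>

lemma dual_primal_nondegenerate:
  assumes z: "z \<in> carrier (B \<otimes>\<^sub>A A)" and zero: "\<And>y. y \<in> carrier (B \<otimes>\<^sub>A A) \<Longrightarrow> z \<cdot>\<^bsub>B \<otimes>\<^sub>A A\<^esub> y = 0"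
  shows "z = 0"
proof (rule eval_dual_zero[OF z])
  obtain I :: "nat set" and b y where I: "\<And>i. i \<in> I \<Longrightarrow> b i \<in> carrier B" "\<And>i. i \<in> I \<Longrightarrow> y i \<in> carrier A"
    "z = (\<Sum>i\<in>I. b i \<otimes>\<^sub>t y i)"
    using z by (rule dual_primal.tensor_algebra_cases) (rule that; assumption)
  have eval_act: "eval_dual (act c w) z = 0" if c: "c \<in> carrier A" and w: "w \<in> carrier A" for c w
  proof -
    have "eval_dual (act c w) z \<cdot> a = 0" if a: "a \<in> carrier A" for a
    proof -
      have bil: "bilinear_on UNIV UNIV (\<lambda>f x. f w *\<^sub>C x)" for w :: 'a
        by (rule bilinear_onI) (simp_all add: scaleC_add_left scaleC_add_right scaleC_fun_apply scaleC_scaleC mult.commute)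
      have "z \<cdot>\<^bsub>B \<otimes>\<^sub>A A\<^esub> (dual_elem c \<otimes>\<^sub>t a) = (\<Sum>i\<in>I. (b i \<cdot>\<^bsub>B\<^esub> dual_elem c) \<otimes>\<^sub>t (y i \<cdot> a))"
        unfolding I(3) using I(1,2) c a
          dual_primal.tensor_mult_sums[of I b y "{()}" "\<lambda>_. dual_elem c" "\<lambda>_. a"]
        by (simp add: dual_elem_closed)
      then have "(\<Sum>i\<in>I. (b i \<cdot>\<^bsub>B\<^esub> dual_elem c) \<otimes>\<^sub>t (y i \<cdot> a)) = (\<Sum>i\<in>{}. b i \<otimes>\<^sub>t y i)"
        using zero c a by (simp add: dual_primal_closed dual_elem_closed)
      from arg_cong[where f = "tensor_lift UNIV UNIV (\<lambda>f x. f w *\<^sub>C x)", OF this]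
      have "(\<Sum>i\<in>I. (b i \<cdot>\<^bsub>B\<^esub> dual_elem c) w *\<^sub>C (y i \<cdot> a)) = 0"
        unfolding tensor_lift_sum_tensor[OF cvec.subspace_UNIV cvec.subspace_UNIV bil UNIV_I UNIV_I] by simp
      then show ?thesis
        unfolding I(3) using I(1,2) c a w
        by (simp add: eval_dual_sum mult_sum_left carrier_closed mult_linear dual_mult_act)
    qed
    then show ?thesis using eval_dual_closed[OF z] nondegenerate_left by blast
  qed
  fix w assume w: "w \<in> carrier A"
  obtain J :: "nat set" and p q where J: "\<And>i. i \<in> J \<Longrightarrow> p i \<in> carrier A" "\<And>i. i \<in> J \<Longrightarrow> q i \<in> carrier A"
    "w = (\<Sum>i\<in>J. act (q i) (p i))"
    using w by (rule act_span) (rule that; assumption)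
  have "eval_dual w z = (\<Sum>i\<in>I. \<Sum>j\<in>J. b i (act (q j) (p j)) *\<^sub>C y i)"
    unfolding I(3) J(3) using I(1,2) J(1,2)
    by (simp add: eval_dual_sum linear_on_sum[OF linear_on_dual subspace_carrier] act_closed cvec.scale_sum_left)
  also have "\<dots> = (\<Sum>j\<in>J. eval_dual (act (q j) (p j)) z)"
    unfolding I(3) using I(1,2) by (subst sum.swap) (simp add: eval_dual_sum)
  finally show "eval_dual w z = 0" using J by (simp add: eval_act)
qed

section \<open>The antipode of the dual\<close>

lemma bilinear_eval_pair:
  "bilinear_on (carrier B) (carrier B) (\<lambda>b b'. b a * b' a')"
  by (rule bilinear_onI) (simp_all add: scaleC_fun_apply algebra_simps)

lemma tensor_pairing_tensor_left:
  assumes a: "a \<in> carrier A" "a' \<in> carrier A" and t: "t \<in> carrier (B \<otimes>\<^sub>A B)"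
  shows "tensor_pairing A B (a \<otimes>\<^sub>t a') t = tensor_lift (carrier B) (carrier B) (\<lambda>b b'. b a * b' a') t"
proof -
  have "t \<in> tensor_set (carrier B) (carrier B)" using t by (simp add: carrier_tensor_algebra)
  then obtain I :: "nat set" and b b' where I: "\<And>i. i \<in> I \<Longrightarrow> b i \<in> carrier B" "\<And>i. i \<in> I \<Longrightarrow> b' i \<in> carrier B"
    "t = (\<Sum>i\<in>I. b i \<otimes>\<^sub>t b' i)"
    by (rule tensor_set_cases[OF subspace_dual]) (rule that; assumption)
  have eq: "tensor_lift (carrier B) (carrier B) (\<lambda>b b'. b a * b' a') t = (\<Sum>i\<in>I. b i a * b' i a')" for a a'
    unfolding I(3) using I(1,2) by (intro tensor_lift_sum_tensor subspace_dual bilinear_eval_pair)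
  have "bilinear_on (carrier A) (carrier A) (\<lambda>a a'. tensor_lift (carrier B) (carrier B) (\<lambda>b b'. b a * b' a') t)"
    unfolding eq using I(1,2)
    by (intro bilinear_onI) (simp_all add: linear_onD[OF linear_on_dual] algebra_simps sum.distrib sum_distrib_left)
  then show ?thesis
    unfolding tensor_pairing_def using a by (rule lift_tensor_of)
qed

lemma tensor_pairing_tensor_right:
  assumes "s \<in> carrier (A \<otimes>\<^sub>A A)" "b \<in> carrier B" "b' \<in> carrier B"
  shows "tensor_pairing A B s (b \<otimes>\<^sub>t b') = lift (\<lambda>a a'. b a * b' a') s"
  unfolding tensor_pairing_def using assms
  by (intro tensor_lift_cong[OF subspace_carrier])
    (simp_all add: carrier_tensor_algebra tensor_lift_tensor_of subspace_dual bilinear_eval_pair)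

lemma dual_tensor_separated:
  assumes t: "t \<in> carrier (B \<otimes>\<^sub>A B)"
    and zero: "\<And>a a'. a \<in> carrier A \<Longrightarrow> a' \<in> carrier A \<Longrightarrow> tensor_pairing A B (a \<otimes>\<^sub>t a') t = 0"
  shows "t = 0"
proof (rule tensor_separated_left[OF subspace_dual subspace_dual, where H = "(\<lambda>w b. b w) ` carrier A"])
  show t': "t \<in> tensor_set (carrier B) (carrier B)" using t by (simp add: carrier_tensor_algebra)
  show "linear_on (carrier B) h" if "h \<in> (\<lambda>w b. b w) ` carrier A" for h :: "('a \<Rightarrow> complex) \<Rightarrow> complex"
    using that by (auto simp: linear_on_def scaleC_fun_apply)
  show "b = 0" if "b \<in> carrier B" "\<And>h. h \<in> (\<lambda>w b. b w) ` carrier A \<Longrightarrow> h b = (0 :: complex)" for b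
    using that by (intro dual_eqI cvec.subspace_0[OF subspace_dual]) auto
  show "tensor_lift (carrier B) (carrier B) (\<lambda>x y. h x *\<^sub>C y) t = 0" if h: "h \<in> (\<lambda>w b. b w) ` carrier A" for h
  proof -
    obtain a where a: "a \<in> carrier A" "h = (\<lambda>b. b a)" using h by blast
    obtain I :: "nat set" and b b' where I: "\<And>i. i \<in> I \<Longrightarrow> b i \<in> carrier B" "\<And>i. i \<in> I \<Longrightarrow> b' i \<in> carrier B"
      "t = (\<Sum>i\<in>I. b i \<otimes>\<^sub>t b' i)"
      using t' by (rule tensor_set_cases[OF subspace_dual]) (rule that; assumption)
    have bil: "bilinear_on (carrier B) (carrier B) (\<lambda>x y. x a *\<^sub>C y)"
      by (rule bilinear_onI) (simp_all add: scaleC_fun_apply scaleC_add_left scaleC_add_right scaleC_scaleC mult.commute)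
    have eq: "tensor_lift (carrier B) (carrier B) (\<lambda>x y. h x *\<^sub>C y) t = (\<Sum>i\<in>I. b i a *\<^sub>C b' i)"
      unfolding I(3) a(2) using I(1,2) by (intro tensor_lift_sum_tensor subspace_dual bil)
    have "(\<Sum>i\<in>I. b i a *\<^sub>C b' i) = 0"
    proof (rule dual_eqI)
      show "(\<Sum>i\<in>I. b i a *\<^sub>C b' i) \<in> carrier B"
        using I(2) subspace_dual by (simp add: cvec.subspace_sum cvec.subspace_scale)
      show "0 \<in> carrier B" using subspace_dual by (rule cvec.subspace_0)
      fix a' assume a': "a' \<in> carrier A"
      have "(\<Sum>i\<in>I. b i a *\<^sub>C b' i) a' = tensor_lift (carrier B) (carrier B) (\<lambda>b b'. b a * b' a') t"
        unfolding I(3) using I(1,2)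
        by (simp add: tensor_lift_sum_tensor subspace_dual bilinear_eval_pair sum_fun_apply scaleC_fun_apply)
      then show "(\<Sum>i\<in>I. b i a *\<^sub>C b' i) a' = 0 a'"
        using zero[OF a(1) a'] tensor_pairing_tensor_left[OF a(1) a' t] by simp
    qed
    with eq show ?thesis by simp
  qed
qed

text \<open>An explicit preimage of \<open>\<phi>(\<cdot> c) \<otimes> \<phi>(\<cdot> d)\<close> under the canonical map of the dual: evaluated at \<open>a \<otimes> a'\<close>, the
left side is \<open>(\<phi> \<otimes> \<phi>)((a \<otimes> 1)\<Delta>(a')\<Delta>(d)(c \<otimes> 1))\<close>, which is \<open>\<phi>(a c) \<phi>(a' d)\<close> by left invariance.\<close>

lemma dual_galois_sum:
  assumes \<Delta>\<^sub>B: "is_dual_coproduct A \<Delta> B \<Delta>\<^sub>B"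
    and J: "decomposes J p q (cop_left d c)" and c: "c \<in> carrier A" "d \<in> carrier A"
  shows "\<And>j. j \<in> J \<Longrightarrow> element (B \<otimes>\<^sub>A B) (coproduct_one_tensor B \<Delta>\<^sub>B (dual_elem (p j)) (dual_elem (q j))) \<in> carrier (B \<otimes>\<^sub>A B)"
    and "(\<Sum>j\<in>J. element (B \<otimes>\<^sub>A B) (coproduct_one_tensor B \<Delta>\<^sub>B (dual_elem (p j)) (dual_elem (q j)))) =
      dual_elem c \<otimes>\<^sub>t dual_elem d"
proof -
  define g where "g j = element (B \<otimes>\<^sub>A B) (coproduct_one_tensor B \<Delta>\<^sub>B (dual_elem (p j)) (dual_elem (q j)))" for j
  note pq = decomposesD(1,2)[OF J]
  have sub: "cvec.subspace (carrier (B \<otimes>\<^sub>A B))" by (simp add: carrier_tensor_algebra subspace_tensor_set)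
  show g: "g j \<in> carrier (B \<otimes>\<^sub>A B)" if "j \<in> J" for j
    unfolding g_def using \<Delta>\<^sub>B pq[OF that] by (intro element_in_carrier) (simp add: is_dual_coproduct_def dual_elem_closed)
  have cd: "dual_elem c \<otimes>\<^sub>t dual_elem d \<in> carrier (B \<otimes>\<^sub>A B)"
    using c by (simp add: carrier_tensor_algebra tensor_of_in_tensor_set dual_elem_closed)
  have "(\<Sum>j\<in>J. g j) - dual_elem c \<otimes>\<^sub>t dual_elem d = 0"
  proof (rule dual_tensor_separated)
    have sum: "(\<Sum>j\<in>J. g j) \<in> carrier (B \<otimes>\<^sub>A B)" using g sub by (intro cvec.subspace_sum)
    then show diff: "(\<Sum>j\<in>J. g j) - dual_elem c \<otimes>\<^sub>t dual_elem d \<in> carrier (B \<otimes>\<^sub>A B)"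
      using cd sub by (intro cvec.subspace_diff)
    fix a a' assume a: "a \<in> carrier A" "a' \<in> carrier A"
    let ?ev = "tensor_lift (carrier B) (carrier B) (\<lambda>b b'. b a * b' a')"
    have lin: "linear_on (carrier (B \<otimes>\<^sub>A B)) ?ev"
      unfolding carrier_tensor_algebra by (intro linear_on_tensor_lift subspace_dual bilinear_eval_pair)
    obtain I u v where I: "decomposes I u v (left_cop a a')" using cop_closed(2)[OF a(2,1)] by (rule ex_decomposes)
    note uv = decomposesD(1,2)[OF I]
    have ev_g: "?ev (g j) = \<phi> (a \<cdot> (act (q j) a' \<cdot> p j))" if j: "j \<in> J" for j
    proof -
      have "?ev (g j) = tensor_pairing A B (left_cop a a') (dual_elem (p j) \<otimes>\<^sub>t dual_elem (q j))"
        using \<Delta>\<^sub>B a pq[OF j] g[OF j]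
        by (simp add: is_dual_coproduct_def dual_elem_closed g_def left_cop_def flip: tensor_pairing_tensor_left)
      also have "\<dots> = (\<Sum>i\<in>I. dual_elem (p j) (u i) * dual_elem (q j) (v i))"
      proof -
        have "bilinear_on (carrier A) (carrier A) (\<lambda>a a'. dual_elem (p j) a * dual_elem (q j) a')"
          using pq[OF j] by (intro bilinear_onI) (simp_all add: linear_onD[OF linear_on_dual] dual_elem_closed algebra_simps)
        then show ?thesis
          using cop_closed(2)[OF a(2,1)] pq[OF j] I
          by (simp add: tensor_pairing_tensor_right dual_elem_closed lift_decomposes)
      qed
      also have "\<dots> = \<phi> ((a \<cdot> act (q j) a') \<cdot> p j)"
        using uv pq[OF j] a unfolding mult_act_dual[OF I a pq(2)[OF j]]
        by (simp add: mult_sum_left carrier_closed linear_on_sum[OF integral_linear subspace_carrier]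
            alg_mult_closed mult_linear linear_onD[OF integral_linear] dual_elem_apply mult.commute)
      finally show ?thesis using a pq[OF j] by (simp add: alg_mult_assoc act_closed)
    qed
    have "?ev (\<Sum>j\<in>J. g j) = \<phi> (\<Sum>j\<in>J. a \<cdot> (act (q j) a' \<cdot> p j))"
      using g pq a by (simp add: linear_on_sum[OF lin sub] ev_g linear_on_sum[OF integral_linear subspace_carrier]
          alg_mult_closed act_closed)
    also have "(\<Sum>j\<in>J. a \<cdot> (act (q j) a' \<cdot> p j)) = a \<cdot> (\<phi> (a' \<cdot> d) *\<^sub>C c)"
      using pq a c by (simp add: sum_act_mult[OF J, symmetric] mult_sum_right alg_mult_closed act_closed)
    also have "\<phi> \<dots> = ?ev (dual_elem c \<otimes>\<^sub>t dual_elem d)"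
      using a c by (simp add: tensor_lift_tensor_of subspace_dual bilinear_eval_pair dual_elem_closed
          dual_elem_apply mult_linear alg_mult_closed linear_onD[OF integral_linear])
    finally show "tensor_pairing A B (a \<otimes>\<^sub>t a') ((\<Sum>j\<in>J. g j) - dual_elem c \<otimes>\<^sub>t dual_elem d) = 0"
      using a diff sum cd by (simp add: tensor_pairing_tensor_left linear_on_diff[OF lin sub])
  qed
  then show "(\<Sum>j\<in>J. g j) = dual_elem c \<otimes>\<^sub>t dual_elem d" by simp
qed

text \<open>The counit axiom of the dual at the preimage of \<open>\<phi>(\<cdot> c) \<otimes> \<phi>(\<cdot> d)\<close> reads
\<open>\<Sum> \<phi>(\<cdot> c\<^sub>i)\<phi>(\<cdot> d\<^sub>i) = \<epsilon>(\<phi>(\<cdot> c)) \<phi>(\<cdot> d)\<close>, and the left side is \<open>\<phi>(c) \<phi>(\<cdot> d)\<close> by left invariance.\<close>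

lemma dual_counit_eq:
  assumes \<Delta>\<^sub>B: "is_dual_coproduct A \<Delta> B \<Delta>\<^sub>B" and \<epsilon>\<^sub>B: "is_counit B \<Delta>\<^sub>B \<epsilon>\<^sub>B" and c: "c \<in> carrier A"
  shows "\<epsilon>\<^sub>B (dual_elem c) = \<phi> c"
proof -
  have lin: "linear_on (carrier B) \<epsilon>\<^sub>B" using \<epsilon>\<^sub>B by (simp add: is_counit_def)
  have bil: "bilinear_on (carrier B) (carrier B) (\<lambda>x y. \<epsilon>\<^sub>B x *\<^sub>C y)"
    by (rule bilinear_onI) (simp_all add: linear_onD[OF lin] scaleC_add_left scaleC_add_right scaleC_scaleC mult.commute)
  have key: "\<epsilon>\<^sub>B (dual_elem c) * \<phi> (a \<cdot> d) = \<phi> (a \<cdot> d) * \<phi> c" if ad: "a \<in> carrier A" "d \<in> carrier A" for a d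
  proof -
    obtain J p q where J: "decomposes J p q (cop_left d c)" using cop_closed(3)[OF ad(2) c] by (rule ex_decomposes)
    note pq = decomposesD(1,2)[OF J]
    note g = dual_galois_sum[OF \<Delta>\<^sub>B J c ad(2)]
    have "\<epsilon>\<^sub>B (dual_elem c) *\<^sub>C dual_elem d = tensor_lift (carrier B) (carrier B) (\<lambda>x y. \<epsilon>\<^sub>B x *\<^sub>C y) (dual_elem c \<otimes>\<^sub>t dual_elem d)"
      using c ad by (simp add: tensor_lift_tensor_of subspace_dual bil dual_elem_closed)
    also have "\<dots> = (\<Sum>j\<in>J. dual_elem (p j) \<cdot>\<^bsub>B\<^esub> dual_elem (q j))"
      unfolding g(2)[symmetric] using g(1) \<epsilon>\<^sub>B pq
      by (simp add: tensor_lift_sum subspace_dual bil carrier_tensor_algebra is_counit_def dual_elem_closed)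
    finally have "(\<epsilon>\<^sub>B (dual_elem c) *\<^sub>C dual_elem d) a = (\<Sum>j\<in>J. dual_elem (p j) \<cdot>\<^bsub>B\<^esub> dual_elem (q j)) a"
      by simp
    also have "\<dots> = \<phi> (\<Sum>j\<in>J. act (q j) a \<cdot> p j)"
      using pq ad by (simp add: sum_fun_apply dual_mult_apply dual_elem_apply act_closed alg_mult_closed
          linear_on_sum[OF integral_linear subspace_carrier])
    finally show ?thesis
      using ad c by (simp add: sum_act_mult[OF J] scaleC_fun_apply dual_elem_apply linear_onD[OF integral_linear])
  qed
  obtain e where e: "e \<in> carrier A" "\<phi> e \<noteq> 0" using ex_integral_nonzero by blast
  obtain I :: "nat set" and p q where I: "\<And>i. i \<in> I \<Longrightarrow> p i \<in> carrier A" "\<And>i. i \<in> I \<Longrightarrow> q i \<in> carrier A"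
    "e = (\<Sum>i\<in>I. p i \<cdot> q i)"
    using e(1) by (rule mult_span) (rule that; assumption)
  have "\<epsilon>\<^sub>B (dual_elem c) * \<phi> e = \<phi> e * \<phi> c"
    unfolding I(3) using I(1,2)
    by (simp add: linear_on_sum[OF integral_linear subspace_carrier] alg_mult_closed sum_distrib_left
        sum_distrib_right key)
  then show ?thesis using e(2) by simp
qed

text \<open>The antipode axiom of the dual at the same preimage gives \<open>S(b)\<phi>(\<cdot> d) = \<Sum> \<phi>(c\<^sub>i) \<phi>(\<cdot> d\<^sub>i)\<close> for
\<open>b = \<phi>(\<cdot> c)\<close>. At \<open>w\<close>, the left side is the value of \<open>S(b)\<close> at \<open>act d w\<close>, and the right side is the value of \<open>b\<close> at
\<open>S(act d w)\<close> by strong left invariance.\<close>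

lemma dual_antipode_eq:
  assumes \<Delta>\<^sub>B: "is_dual_coproduct A \<Delta> B \<Delta>\<^sub>B" and \<epsilon>\<^sub>B: "is_counit B \<Delta>\<^sub>B \<epsilon>\<^sub>B"
    and S\<^sub>B: "is_antipode B \<Delta>\<^sub>B \<epsilon>\<^sub>B S\<^sub>B" and b: "b \<in> carrier B" and a: "a \<in> carrier A"
  shows "S\<^sub>B b a = b (S a)"
proof -
  have lin: "linear_on (carrier B) S\<^sub>B" and closed: "\<And>b. b \<in> carrier B \<Longrightarrow> S\<^sub>B b \<in> carrier B"
    using S\<^sub>B by (auto simp: is_antipode_def bij_betw_def)
  have bil: "bilinear_on (carrier B) (carrier B) (\<lambda>x y. S\<^sub>B x \<cdot>\<^bsub>B\<^esub> y)"
    using bilinear_dual_mult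
    by (intro bilinear_onI) (simp_all add: linear_onD[OF lin] closed bilinear_on_def linear_on_def)
  obtain c where c: "c \<in> carrier A" "b = dual_elem c" using b by (rule dual_cases)
  have key: "S\<^sub>B b (act d w) = b (S (act d w))" if d: "d \<in> carrier A" and w: "w \<in> carrier A" for d w
  proof -
    obtain J p q where J: "decomposes J p q (cop_left d c)" using cop_closed(3)[OF d c(1)] by (rule ex_decomposes)
    note pq = decomposesD(1,2)[OF J]
    note g = dual_galois_sum[OF \<Delta>\<^sub>B J c(1) d]
    have "S\<^sub>B b \<cdot>\<^bsub>B\<^esub> dual_elem d = tensor_lift (carrier B) (carrier B) (\<lambda>x y. S\<^sub>B x \<cdot>\<^bsub>B\<^esub> y) (dual_elem c \<otimes>\<^sub>t dual_elem d)"
      using c d by (simp add: tensor_lift_tensor_of subspace_dual bil dual_elem_closed)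
    also have "\<dots> = (\<Sum>j\<in>J. \<phi> (p j) *\<^sub>C dual_elem (q j))"
      unfolding g(2)[symmetric] using g(1) S\<^sub>B pq
      by (simp add: tensor_lift_sum subspace_dual bil carrier_tensor_algebra is_antipode_def dual_elem_closed
          dual_counit_eq[OF \<Delta>\<^sub>B \<epsilon>\<^sub>B])
    finally have "(S\<^sub>B b \<cdot>\<^bsub>B\<^esub> dual_elem d) w = (\<Sum>j\<in>J. \<phi> (p j) *\<^sub>C dual_elem (q j)) w" by simp
    also have "\<dots> = \<phi> (\<Sum>j\<in>J. \<phi> (w \<cdot> q j) *\<^sub>C p j)"
      using pq w by (simp add: sum_fun_apply scaleC_fun_apply dual_elem_apply linear_onD[OF integral_linear]
          linear_on_sum[OF integral_linear subspace_carrier] carrier_closed mult.commute)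
    also have "\<dots> = b (S (act d w))"
      using c d w by (simp add: strong_left_invariance[OF J] dual_elem_apply antipode_closed act_closed)
    finally show ?thesis using b closed d w by (simp add: dual_mult_act)
  qed
  obtain I :: "nat set" and p q where I: "\<And>i. i \<in> I \<Longrightarrow> p i \<in> carrier A" "\<And>i. i \<in> I \<Longrightarrow> q i \<in> carrier A"
    "a = (\<Sum>i\<in>I. act (q i) (p i))"
    using a by (rule act_span) (rule that; assumption)
  show ?thesis
    unfolding I(3) using I(1,2) b closed
    by (simp add: linear_on_sum[OF linear_on_dual subspace_carrier] linear_on_sum[OF antipode_linear subspace_carrier]
        act_closed antipode_closed key)
qed

section \<open>Multipliers determined by their pairing\<close>

text \<open>The pairing of \<open>m\<close> with \<open>(b \<triangleright> w) \<otimes> (y \<triangleright> b')\<close> is, on the one hand, the matrix coefficient \<open>b'(T(w))\<close> of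
\<open>m(b \<otimes> y)\<close> and, on the other hand, \<open>(y \<triangleright> b')(F(b \<triangleright> w)) = b'(F(b \<triangleright> w) y)\<close>. It will be used with
\<open>F = \<iota>\<close> and \<open>F = S\<close>.\<close>

lemma multiplier_eval_tensor:
  assumes P: "is_extended_pairing A B P" and m: "m \<in> carrier (multipliers (B \<otimes>\<^sub>A A))"
    and F: "\<And>a. a \<in> carrier A \<Longrightarrow> F a \<in> carrier A"
    and val: "\<And>a b. a \<in> carrier A \<Longrightarrow> b \<in> carrier B \<Longrightarrow> P m (a \<otimes>\<^sub>t b) = b (F a)"
    and c: "c \<in> carrier A" and y: "y \<in> carrier A" and w: "w \<in> carrier A"
  shows "eval_dual w (fst m (dual_elem c \<otimes>\<^sub>t y)) = F (act c w) \<cdot> y"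
proof (rule dual_separates)
  have t: "fst m (dual_elem c \<otimes>\<^sub>t y) \<in> carrier (B \<otimes>\<^sub>A A)"
    using m c y by (simp add: multiplierD(3) dual_primal_closed dual_elem_closed)
  then show "eval_dual w (fst m (dual_elem c \<otimes>\<^sub>t y)) \<in> carrier A" by (rule eval_dual_closed)
  show "F (act c w) \<cdot> y \<in> carrier A" using F c y w by (simp add: alg_mult_closed act_closed)
  fix b assume "b \<in> carrier B"
  then obtain d where d: "d \<in> carrier A" "b = dual_elem d" by (rule dual_cases)
  have "b (eval_dual w (fst m (dual_elem c \<otimes>\<^sub>t y))) = cross_pairing A B (fst m (dual_elem c \<otimes>\<^sub>t y)) (w \<otimes>\<^sub>t b)"
    using t w d by (simp add: cross_pairing_eval dual_elem_closed)
  also have "\<dots> = P m (dual_act A B (dual_elem c) w \<otimes>\<^sub>t act_on_dual A y b)"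
    using P m c y w d by (simp add: is_extended_pairing_def dual_elem_closed)
  also have "\<dots> = P m (act c w \<otimes>\<^sub>t dual_elem (y \<cdot> d))"
    using c y w d by (simp add: dual_act_eq act_on_dual_eq)
  also have "\<dots> = dual_elem (y \<cdot> d) (F (act c w))"
    using c y w d by (simp add: val act_closed dual_elem_closed alg_mult_closed)
  also have "\<dots> = b (F (act c w) \<cdot> y)"
    using F c y w d by (simp add: dual_elem_apply act_closed alg_mult_closed alg_mult_assoc)
  finally show "b (eval_dual w (fst m (dual_elem c \<otimes>\<^sub>t y))) = b (F (act c w) \<cdot> y)" .
qed

lemma multiplier_eval:
  assumes P: "is_extended_pairing A B P" and m: "m \<in> carrier (multipliers (B \<otimes>\<^sub>A A))"
    and F: "\<And>a. a \<in> carrier A \<Longrightarrow> F a \<in> carrier A"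
    and val: "\<And>a b. a \<in> carrier A \<Longrightarrow> b \<in> carrier B \<Longrightarrow> P m (a \<otimes>\<^sub>t b) = b (F a)"
    and cy: "\<And>i. i \<in> I \<Longrightarrow> c i \<in> carrier A" "\<And>i. i \<in> I \<Longrightarrow> y i \<in> carrier A" and w: "w \<in> carrier A"
  shows "eval_dual w (fst m (\<Sum>i\<in>I. dual_elem (c i) \<otimes>\<^sub>t y i)) = (\<Sum>i\<in>I. F (act (c i) w) \<cdot> y i)"
proof -
  have "fst m (\<Sum>i\<in>I. dual_elem (c i) \<otimes>\<^sub>t y i) = (\<Sum>i\<in>I. fst m (dual_elem (c i) \<otimes>\<^sub>t y i))"
    using cy by (intro linear_on_sum[OF multiplierD(1)[OF m] subspace_dual_primal] dual_primal_closed dual_elem_closed)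
  then have "eval_dual w (fst m (\<Sum>i\<in>I. dual_elem (c i) \<otimes>\<^sub>t y i)) =
      (\<Sum>i\<in>I. eval_dual w (fst m (dual_elem (c i) \<otimes>\<^sub>t y i)))"
    using cy m by (simp add: linear_on_sum[OF linear_on_eval_dual subspace_dual_primal] multiplierD(3)
        dual_primal_closed dual_elem_closed)
  then show ?thesis using cy w by (simp add: multiplier_eval_tensor[OF P m F val])
qed

text \<open>The right component is determined by the left one through \<open>(t m) y = t (m y)\<close> and non-degeneracy.\<close>

lemma multiplier_eqI:
  assumes m: "m \<in> carrier (multipliers (B \<otimes>\<^sub>A A))" and n: "n \<in> carrier (multipliers (B \<otimes>\<^sub>A A))"
    and eq: "\<And>t. t \<in> carrier (B \<otimes>\<^sub>A A) \<Longrightarrow> fst m t = fst n t"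
  shows "m = n"
proof -
  have "snd m t = snd n t" if t: "t \<in> carrier (B \<otimes>\<^sub>A A)" for t
  proof -
    have "snd m t - snd n t = 0"
    proof (rule dual_primal_nondegenerate)
      show "snd m t - snd n t \<in> carrier (B \<otimes>\<^sub>A A)"
        using t m n by (intro cvec.subspace_diff subspace_dual_primal multiplierD(4))
      show "(snd m t - snd n t) \<cdot>\<^bsub>B \<otimes>\<^sub>A A\<^esub> y = 0" if y: "y \<in> carrier (B \<otimes>\<^sub>A A)" for y
        using t m n y by (simp add: linear_on_diff[OF dual_primal.linear_on_tensor_mult subspace_dual_primal]
            multiplierD(4) multiplierD(8) eq)
    qed
    then show ?thesis by simp
  qed
  then have "fst m t = fst n t \<and> snd m t = snd n t" for t
    using eq multiplierD(5,6)[OF m] multiplierD(5,6)[OF n] by (cases "t \<in> carrier (B \<otimes>\<^sub>A A)") auto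
  then show ?thesis by (simp add: prod_eq_iff fun_eq_iff)
qed

lemma multiplier_mult_one:
  assumes m: "m \<in> carrier (multipliers (B \<otimes>\<^sub>A A))" and n: "n \<in> carrier (multipliers (B \<otimes>\<^sub>A A))"
    and inv: "\<And>t. t \<in> carrier (B \<otimes>\<^sub>A A) \<Longrightarrow> fst m (fst n t) = t"
  shows "m \<otimes>\<^bsub>multipliers (B \<otimes>\<^sub>A A)\<^esub> n = \<one>\<^bsub>multipliers (B \<otimes>\<^sub>A A)\<^esub>"
proof -
  have "snd n (snd m t) = t" if t: "t \<in> carrier (B \<otimes>\<^sub>A A)" for t
  proof -
    have "snd n (snd m t) - t = 0"
    proof (rule dual_primal_nondegenerate)
      show "snd n (snd m t) - t \<in> carrier (B \<otimes>\<^sub>A A)"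
        using t m n by (intro cvec.subspace_diff subspace_dual_primal multiplierD(4))
      show "(snd n (snd m t) - t) \<cdot>\<^bsub>B \<otimes>\<^sub>A A\<^esub> y = 0" if y: "y \<in> carrier (B \<otimes>\<^sub>A A)" for y
        using t m n y by (simp add: linear_on_diff[OF dual_primal.linear_on_tensor_mult subspace_dual_primal]
            multiplierD(3,4,8) inv)
    qed
    then show ?thesis by simp
  qed
  moreover have "fst m 0 = 0" "snd n 0 = 0"
    using linear_on_zero[OF multiplierD(1)[OF m] subspace_dual_primal]
      linear_on_zero[OF multiplierD(2)[OF n] subspace_dual_primal] by auto
  ultimately show ?thesis
    using inv multiplierD(5,6)[OF m] multiplierD(5,6)[OF n]
    by (auto simp: mult_multipliers one_multipliers fun_eq_iff)
qed

lemma left_inverse_on_tensors: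
  assumes m: "m \<in> carrier (multipliers (B \<otimes>\<^sub>A A))" and n: "n \<in> carrier (multipliers (B \<otimes>\<^sub>A A))"
    and pure: "\<And>c y. c \<in> carrier A \<Longrightarrow> y \<in> carrier A \<Longrightarrow>
      fst m (fst n (dual_elem c \<otimes>\<^sub>t y)) = dual_elem c \<otimes>\<^sub>t y"
    and t: "t \<in> carrier (B \<otimes>\<^sub>A A)"
  shows "fst m (fst n t) = t"
proof -
  obtain I :: "nat set" and c y where I: "\<And>i. i \<in> I \<Longrightarrow> c i \<in> carrier A" "\<And>i. i \<in> I \<Longrightarrow> y i \<in> carrier A"
    "t = (\<Sum>i\<in>I. dual_elem (c i) \<otimes>\<^sub>t y i)"
    using t by (rule dual_primal_cases) (rule that; assumption)
  show ?thesis
    unfolding I(3) using I(1,2) m n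
    by (simp add: linear_on_sum[OF multiplierD(1) subspace_dual_primal] dual_primal_closed dual_elem_closed
        multiplierD(3) pure)
qed

section \<open>The inverse\<close>

context
  fixes P V W
  assumes P: "is_extended_pairing A B P"
    and V: "V \<in> carrier (multipliers (B \<otimes>\<^sub>A A))"
    and V_val: "\<And>a b. a \<in> carrier A \<Longrightarrow> b \<in> carrier B \<Longrightarrow> P V (a \<otimes>\<^sub>t b) = b a"
    and W: "W \<in> carrier (multipliers (B \<otimes>\<^sub>A A))"
    and W_val: "\<And>a b. a \<in> carrier A \<Longrightarrow> b \<in> carrier B \<Longrightarrow> P W (a \<otimes>\<^sub>t b) = b (S a)"
begin

text \<open>Multiplied by \<open>x\<close> from the left, \<open>T\<^sub>V\<^sub>W\<^sub>t(w) = w\<^sub>(\<^sub>1\<^sub>) S(w\<^sub>(\<^sub>2\<^sub>)) T\<^sub>t(w\<^sub>(\<^sub>3\<^sub>))\<close> becomes a sum over the legs of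
\<open>(x \<otimes> 1)\<Delta>(w)\<close>, to which the right antipode identity applies.\<close>

lemma V_after_W:
  assumes c: "c \<in> carrier A" and y: "y \<in> carrier A"
  shows "fst V (fst W (dual_elem c \<otimes>\<^sub>t y)) = dual_elem c \<otimes>\<^sub>t y"
proof (rule eval_dual_eqI)
  have cy: "dual_elem c \<otimes>\<^sub>t y \<in> carrier (B \<otimes>\<^sub>A A)" using c y by (simp add: dual_primal_closed dual_elem_closed)
  then have t: "fst W (dual_elem c \<otimes>\<^sub>t y) \<in> carrier (B \<otimes>\<^sub>A A)" by (rule multiplierD(3)[OF W])
  then show "fst V (fst W (dual_elem c \<otimes>\<^sub>t y)) \<in> carrier (B \<otimes>\<^sub>A A)" by (rule multiplierD(3)[OF V])
  show "dual_elem c \<otimes>\<^sub>t y \<in> carrier (B \<otimes>\<^sub>A A)" by fact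
  obtain I :: "nat set" and d z where I: "\<And>i. i \<in> I \<Longrightarrow> d i \<in> carrier A" "\<And>i. i \<in> I \<Longrightarrow> z i \<in> carrier A"
    "fst W (dual_elem c \<otimes>\<^sub>t y) = (\<Sum>i\<in>I. dual_elem (d i) \<otimes>\<^sub>t z i)"
    using t by (rule dual_primal_cases) (rule that; assumption)
  have slices: "(\<Sum>i\<in>I. dual_elem (d i) w *\<^sub>C z i) = S (act c w) \<cdot> y" if w: "w \<in> carrier A" for w
    using multiplier_eval_tensor[OF P W antipode_closed W_val c y w] I
    by (simp add: eval_dual_sum dual_elem_closed)
  fix w assume w: "w \<in> carrier A"
  have "(\<Sum>i\<in>I. act (d i) w \<cdot> z i) = \<phi> (w \<cdot> c) *\<^sub>C y"
  proof (rule mult_left_cancel)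
    show "(\<Sum>i\<in>I. act (d i) w \<cdot> z i) \<in> carrier A" using I w by (intro carrier_closed alg_mult_closed act_closed)
    show "\<phi> (w \<cdot> c) *\<^sub>C y \<in> carrier A" using y by (rule carrier_closed)
    fix x assume x: "x \<in> carrier A"
    obtain K u v where K: "decomposes K u v (left_cop x w)" using cop_closed(2)[OF w x] by (rule ex_decomposes)
    note uv = decomposesD(1,2)[OF K]
    have "x \<cdot> (\<Sum>i\<in>I. act (d i) w \<cdot> z i) = (\<Sum>i\<in>I. (x \<cdot> act (d i) w) \<cdot> z i)"
      using I w x by (simp add: mult_sum_right alg_mult_closed act_closed alg_mult_assoc)
    also have "\<dots> = (\<Sum>i\<in>I. \<Sum>k\<in>K. u k \<cdot> (dual_elem (d i) (v k) *\<^sub>C z i))"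
      using I uv w x by (simp add: mult_act_dual[OF K] mult_sum_left mult_linear carrier_closed)
    also have "\<dots> = (\<Sum>k\<in>K. u k \<cdot> (S (act c (v k)) \<cdot> y))"
      using I uv by (subst sum.swap) (simp add: mult_sum_right carrier_closed flip: slices)
    also have "\<dots> = (\<Sum>k\<in>K. u k \<cdot> S (act c (v k))) \<cdot> y"
      using uv y c by (simp add: mult_sum_left alg_mult_closed antipode_closed act_closed alg_mult_assoc)
    also have "\<dots> = x \<cdot> (\<phi> (w \<cdot> c) *\<^sub>C y)"
      using x y w c by (simp add: antipode_right_act[OF K] mult_linear)
    finally show "x \<cdot> (\<Sum>i\<in>I. act (d i) w \<cdot> z i) = x \<cdot> (\<phi> (w \<cdot> c) *\<^sub>C y)" .
  qed
  moreover have "eval_dual w (fst V (fst W (dual_elem c \<otimes>\<^sub>t y))) = (\<Sum>i\<in>I. act (d i) w \<cdot> z i)"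
    unfolding I(3) using I w by (intro multiplier_eval[OF P V]) (simp_all add: V_val)
  moreover have "eval_dual w (dual_elem c \<otimes>\<^sub>t y) = \<phi> (w \<cdot> c) *\<^sub>C y"
    using eval_dual_sum[of "{()}" "\<lambda>_. dual_elem c" "\<lambda>_. y" w] c y w by (simp add: dual_elem_closed dual_elem_apply)
  ultimately show "eval_dual w (fst V (fst W (dual_elem c \<otimes>\<^sub>t y))) = eval_dual w (dual_elem c \<otimes>\<^sub>t y)" by simp
qed

text \<open>Here \<open>S\<close> reverses products, so the operator of \<open>V t\<close> cannot be multiplied from the left as before. Instead,
\<open>\<Sum> act (d i) w \<otimes> z i\<close>, where \<open>V t = \<Sum> \<phi>(\<cdot> d\<^sub>i) \<otimes> z\<^sub>i\<close>, is identified with \<open>\<Delta>(act c w)(1 \<otimes> y)\<close>, on which the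
antipode axiom evaluates \<open>S\<close> applied to the first leg times the second.\<close>

lemma W_after_V:
  assumes c: "c \<in> carrier A" and y: "y \<in> carrier A"
  shows "fst W (fst V (dual_elem c \<otimes>\<^sub>t y)) = dual_elem c \<otimes>\<^sub>t y"
proof (rule eval_dual_eqI)
  have cy: "dual_elem c \<otimes>\<^sub>t y \<in> carrier (B \<otimes>\<^sub>A A)" using c y by (simp add: dual_primal_closed dual_elem_closed)
  then have t: "fst V (dual_elem c \<otimes>\<^sub>t y) \<in> carrier (B \<otimes>\<^sub>A A)" by (rule multiplierD(3)[OF V])
  then show "fst W (fst V (dual_elem c \<otimes>\<^sub>t y)) \<in> carrier (B \<otimes>\<^sub>A A)" by (rule multiplierD(3)[OF W])
  show "dual_elem c \<otimes>\<^sub>t y \<in> carrier (B \<otimes>\<^sub>A A)" by fact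
  obtain I :: "nat set" and d z where I: "\<And>i. i \<in> I \<Longrightarrow> d i \<in> carrier A" "\<And>i. i \<in> I \<Longrightarrow> z i \<in> carrier A"
    "fst V (dual_elem c \<otimes>\<^sub>t y) = (\<Sum>i\<in>I. dual_elem (d i) \<otimes>\<^sub>t z i)"
    using t by (rule dual_primal_cases) (rule that; assumption)
  have slices: "(\<Sum>i\<in>I. dual_elem (d i) w *\<^sub>C z i) = act c w \<cdot> y" if w: "w \<in> carrier A" for w
    using multiplier_eval_tensor[OF P V _ V_val c y w] I
    by (simp add: eval_dual_sum dual_elem_closed)
  fix w assume w: "w \<in> carrier A"
  have Z: "(\<Sum>i\<in>I. act (d i) w \<otimes>\<^sub>t z i) = cop_right (act c w) y"
  proof (rule leg1_cancel)
    show "(\<Sum>i\<in>I. act (d i) w \<otimes>\<^sub>t z i) \<in> carrier (A \<otimes>\<^sub>A A)"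
      using I w by (intro tensor_sum_closed tensor_of_closed act_closed)
    show "cop_right (act c w) y \<in> carrier (A \<otimes>\<^sub>A A)" using c y w by (simp add: cop_closed act_closed)
    fix x assume x: "x \<in> carrier A"
    obtain K u v where K: "decomposes K u v (left_cop x w)" using cop_closed(2)[OF w x] by (rule ex_decomposes)
    note uv = decomposesD(1,2)[OF K]
    have "leg1 x (\<Sum>i\<in>I. act (d i) w \<otimes>\<^sub>t z i) = (\<Sum>i\<in>I. \<Sum>k\<in>K. u k \<otimes>\<^sub>t (dual_elem (d i) (v k) *\<^sub>C z i))"
      using I w x by (simp add: leg1_sum act_closed mult_act_dual[OF K] tensor_of_sum_left tensor_of_linear)
    also have "\<dots> = (\<Sum>k\<in>K. u k \<otimes>\<^sub>t (act c (v k) \<cdot> y))"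
      using uv by (subst sum.swap) (simp flip: slices tensor_of_sum_right)
    also have "\<dots> = leg1 x (cop_right (act c w) y)"
    proof (rule leg1_cop_right[symmetric])
      show "decomposes K u (\<lambda>k. act c (v k)) (left_cop x (act c w))"
        using uv left_cop_act[OF K x w c] c by (simp add: decomposes_def act_closed)
    qed (use x c w y in \<open>simp_all add: act_closed\<close>)
    finally show "leg1 x (\<Sum>i\<in>I. act (d i) w \<otimes>\<^sub>t z i) = leg1 x (cop_right (act c w) y)" .
  qed
  have "eval_dual w (fst W (fst V (dual_elem c \<otimes>\<^sub>t y))) = (\<Sum>i\<in>I. S (act (d i) w) \<cdot> z i)"
    unfolding I(3) using I w by (intro multiplier_eval[OF P W]) (simp_all add: W_val antipode_closed)
  also have "\<dots> = lift (\<lambda>u v. S u \<cdot> v) (\<Sum>i\<in>I. act (d i) w \<otimes>\<^sub>t z i)"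
    using I w by (simp add: lift_sum bilinear_antipode tensor_of_closed act_closed lift_tensor_of)
  also have "\<dots> = \<phi> (w \<cdot> c) *\<^sub>C y"
    unfolding Z using c y w by (simp add: antipode_left act_closed counit_act)
  also have "\<dots> = eval_dual w (dual_elem c \<otimes>\<^sub>t y)"
    using eval_dual_sum[of "{()}" "\<lambda>_. dual_elem c" "\<lambda>_. y" w] c y w by (simp add: dual_elem_closed dual_elem_apply)
  finally show "eval_dual w (fst W (fst V (dual_elem c \<otimes>\<^sub>t y))) = eval_dual w (dual_elem c \<otimes>\<^sub>t y)" .
qed

lemma V_W_inverse:
  "V \<otimes>\<^bsub>multipliers (B \<otimes>\<^sub>A A)\<^esub> W = \<one>\<^bsub>multipliers (B \<otimes>\<^sub>A A)\<^esub>"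
  "W \<otimes>\<^bsub>multipliers (B \<otimes>\<^sub>A A)\<^esub> V = \<one>\<^bsub>multipliers (B \<otimes>\<^sub>A A)\<^esub>"
  by (rule multiplier_mult_one[OF V W], rule left_inverse_on_tensors[OF V W V_after_W], assumption+)
    (rule multiplier_mult_one[OF W V], rule left_inverse_on_tensors[OF W V W_after_V], assumption+)

end

lemma multiplier_determined:
  assumes P: "is_extended_pairing A B P" and F: "\<And>a. a \<in> carrier A \<Longrightarrow> F a \<in> carrier A"
    and m: "m \<in> carrier (multipliers (B \<otimes>\<^sub>A A))"
      "\<And>a b. a \<in> carrier A \<Longrightarrow> b \<in> carrier B \<Longrightarrow> P m (a \<otimes>\<^sub>t b) = b (F a)"
    and n: "n \<in> carrier (multipliers (B \<otimes>\<^sub>A A))"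
      "\<And>a b. a \<in> carrier A \<Longrightarrow> b \<in> carrier B \<Longrightarrow> P n (a \<otimes>\<^sub>t b) = b (F a)"
  shows "m = n"
proof (rule multiplier_eqI[OF m(1) n(1)])
  fix t assume t: "t \<in> carrier (B \<otimes>\<^sub>A A)"
  then obtain I :: "nat set" and c y where I: "\<And>i. i \<in> I \<Longrightarrow> c i \<in> carrier A" "\<And>i. i \<in> I \<Longrightarrow> y i \<in> carrier A"
    "t = (\<Sum>i\<in>I. dual_elem (c i) \<otimes>\<^sub>t y i)"
    by (rule dual_primal_cases) (rule that; assumption)
  show "fst m t = fst n t"
  proof (rule eval_dual_eqI)
    show "eval_dual w (fst m t) = eval_dual w (fst n t)" if w: "w \<in> carrier A" for w
      unfolding I(3) using I(1,2) w
      by (simp add: multiplier_eval[OF P m(1) F m(2)] multiplier_eval[OF P n(1) F n(2)])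
  qed (use t m(1) n(1) in \<open>simp_all add: multiplierD(3)\<close>)
qed

end

text \<open>The inverse is computed from the two equations alone: the monoid laws are at hand only for a carrier
closed under multiplication, over which the unit is a multiplier.\<close>

lemma multipliers_inv_eq:
  assumes V: "V \<in> carrier (multipliers A)" and W: "W \<in> carrier (multipliers A)"
    and VW: "V \<otimes>\<^bsub>multipliers A\<^esub> W = \<one>\<^bsub>multipliers A\<^esub>" and WV: "W \<otimes>\<^bsub>multipliers A\<^esub> V = \<one>\<^bsub>multipliers A\<^esub>"
  shows "V \<in> Units (multipliers A)" "inv\<^bsub>multipliers A\<^esub> V = W"
proof -
  have assoc: "m \<otimes>\<^bsub>multipliers A\<^esub> n \<otimes>\<^bsub>multipliers A\<^esub> k = m \<otimes>\<^bsub>multipliers A\<^esub> (n \<otimes>\<^bsub>multipliers A\<^esub> k)" for m n k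
    by (simp add: mult_multipliers o_assoc)
  have one_left: "\<one>\<^bsub>multipliers A\<^esub> \<otimes>\<^bsub>multipliers A\<^esub> m = m" and one_right: "m \<otimes>\<^bsub>multipliers A\<^esub> \<one>\<^bsub>multipliers A\<^esub> = m"
    if m: "m \<in> carrier (multipliers A)" and zero: "fst m 0 = 0" "snd m 0 = 0" for m
    using multiplierD(3-6)[OF m] zero by (auto simp: mult_multipliers one_multipliers prod_eq_iff fun_eq_iff)
  have zero: "fst m 0 = 0" "snd m 0 = 0" if m: "m \<in> carrier (multipliers A)" for m
  proof -
    show "fst m 0 = 0" "snd m 0 = 0"
      using linear_onD(2)[OF multiplierD(1)[OF m], of 0 0] linear_onD(2)[OF multiplierD(2)[OF m], of 0 0]
        multiplierD(5,6)[OF m, of 0] by (cases "0 \<in> carrier A"; simp)+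
  qed
  show "V \<in> Units (multipliers A)"
    using V W VW WV by (auto simp: Units_def)
  show "inv\<^bsub>multipliers A\<^esub> V = W"
    unfolding m_inv_def
  proof (rule the_equality)
    fix Y assume Y: "Y \<in> carrier (multipliers A) \<and> V \<otimes>\<^bsub>multipliers A\<^esub> Y = \<one>\<^bsub>multipliers A\<^esub> \<and>
      Y \<otimes>\<^bsub>multipliers A\<^esub> V = \<one>\<^bsub>multipliers A\<^esub>"
    then have "Y = (W \<otimes>\<^bsub>multipliers A\<^esub> V) \<otimes>\<^bsub>multipliers A\<^esub> Y"
      using zero by (simp add: WV one_left)
    also have "\<dots> = W" using Y W zero by (simp add: assoc one_right)
    finally show "Y = W" .
  qed (use W VW WV in auto)
qed

theorem proposition3p12:
  fixes A :: "'a::complex_vector algebra"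
    and \<Delta> :: "'a coproduct"
    and \<phi> \<epsilon> :: "'a \<Rightarrow> complex"
    and S :: "'a \<Rightarrow> 'a"
    and B :: "('a \<Rightarrow> complex) algebra"
    and \<Delta>\<^sub>B :: "('a \<Rightarrow> complex) coproduct"
    and \<epsilon>\<^sub>B :: "('a \<Rightarrow> complex) \<Rightarrow> complex"
    and S\<^sub>B :: "('a \<Rightarrow> complex) \<Rightarrow> ('a \<Rightarrow> complex)"
    and P :: "('a \<Rightarrow> complex, 'a) tensor multiplier \<Rightarrow> ('a, 'a \<Rightarrow> complex) tensor \<Rightarrow> complex"
    and V SV VS :: "('a \<Rightarrow> complex, 'a) tensor multiplier"
  assumes "algebraic_quantum_group A \<Delta>"
    and "left_integral A \<Delta> \<phi>"
    and "is_counit A \<Delta> \<epsilon>"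
    and "is_antipode A \<Delta> \<epsilon> S"
    and "B = dual A \<Delta> \<phi>"
    and "is_dual_coproduct A \<Delta> B \<Delta>\<^sub>B"
    and "is_counit B \<Delta>\<^sub>B \<epsilon>\<^sub>B"
    and "is_antipode B \<Delta>\<^sub>B \<epsilon>\<^sub>B S\<^sub>B"
    and "is_extended_pairing A B P"
    and "V \<in> carrier (multipliers (B \<otimes>\<^sub>A A))"
    and "\<forall>a\<in>carrier A. \<forall>b\<in>carrier B. P V (a \<otimes>\<^sub>t b) = b a"
    \<comment> \<open>\<open>SV = (S \<otimes> \<iota>)V\<close> and \<open>VS = (\<iota> \<otimes> S)V\<close>\<close>
    and "SV \<in> carrier (multipliers (B \<otimes>\<^sub>A A))"
    and "\<forall>a\<in>carrier A. \<forall>b\<in>carrier B. P SV (a \<otimes>\<^sub>t b) = P V (S a \<otimes>\<^sub>t b)"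
    and "VS \<in> carrier (multipliers (B \<otimes>\<^sub>A A))"
    and "\<forall>a\<in>carrier A. \<forall>b\<in>carrier B. P VS (a \<otimes>\<^sub>t b) = P V (a \<otimes>\<^sub>t S\<^sub>B b)"
  shows "V \<in> Units (multipliers (B \<otimes>\<^sub>A A)) \<and>
    inv\<^bsub>multipliers (B \<otimes>\<^sub>A A)\<^esub> V = SV \<and> SV = VS"
proof -
  interpret algebraic_quantum_group A \<Delta> by fact
  interpret H: hopf_algebra_with_left_integral A \<Delta> \<phi> \<epsilon> S
    by unfold_locales fact+
  note B = assms(5)
  have S\<^sub>B: "S\<^sub>B b \<in> carrier B" if "b \<in> carrier B" for b
    using assms(8) that by (auto simp: is_antipode_def bij_betw_def)
  have SV: "P SV (a \<otimes>\<^sub>t b) = b (S a)" if "a \<in> carrier A" "b \<in> carrier B" for a b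
    using assms(11,13) that by (simp add: H.antipode_closed)
  have VS: "P VS (a \<otimes>\<^sub>t b) = b (S a)" if "a \<in> carrier A" "b \<in> carrier B" for a b
    using assms(11,15) that S\<^sub>B H.dual_antipode_eq[of \<Delta>\<^sub>B \<epsilon>\<^sub>B S\<^sub>B b a] assms(6-8) by (simp add: B)
  have inverse: "V \<otimes>\<^bsub>multipliers (B \<otimes>\<^sub>A A)\<^esub> SV = \<one>\<^bsub>multipliers (B \<otimes>\<^sub>A A)\<^esub>"
    "SV \<otimes>\<^bsub>multipliers (B \<otimes>\<^sub>A A)\<^esub> V = \<one>\<^bsub>multipliers (B \<otimes>\<^sub>A A)\<^esub>"
    using H.V_W_inverse[of P V SV] assms(9-12) SV by (simp_all add: B)
  have "SV = VS"
    using H.multiplier_determined[of P S SV VS] assms(9,12,14) SV VS H.antipode_closed by (simp add: B)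
  with multipliers_inv_eq[OF assms(10,12) inverse] show ?thesis by simp
qed

end
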